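(* Consider the interconnected system described in the context, with a partition $\{1,\dots,n\}=I_\Sigma\cup I_{\max}$, and assume each subsystem $i$ has an ISS Lyapunov function $V_i$ (in the mixed sense defined in the context) with gains $\gamma_{ij}\in\mathcal{K}_\infty\cup\{0\}$, $\gamma_i\in\mathcal{K}$. Let $\Gamma$ and $\overline\Gamma$ be the associated operators. If there exists $\alpha\in\mathcal{K}_\infty$ such that $\Gamma\circ D_\alpha(s)\not\ge s$ for all $s\in\mathbb{R}^n_+\setminus\{0\}$, then the whole system $\dot x=f(x,u)$ is ISS; moreover there exist an $\Omega$-path $\sigma$ and $\phi\in\mathcal{K}_\infty$ such that $\overline\Gamma(\sigma(r),\phi(r))<\sigma(r)$ for all $r>0$, and $V(x)=\max_{i=1,\dots,n}\sigma_i^{-1}(V_i(x_i))$ is an ISS Lyapunov function for the whole system.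
   Context: The interconnection is $\dot x_i=f_i(x_1,\dots,x_n,u_i)$, $i=1,\dots,n$, $x_i\in\mathbb{R}^{N_i}$, $u_i\in\mathbb{R}^{m_i}$, each $f_i$ continuous and, for every $r$, locally Lipschitz in $x=(x_1^T,\dots,x_n^T)^T$ uniformly in $|u_i|\le r$; written as $\dot x=f(x,u)$. $\mathcal{K}$: continuous strictly increasing functions $\mathbb{R}_+\to\mathbb{R}_+$ vanishing at $0$; $\mathcal{K}_\infty$: unbounded ones. A continuous $\rho:\mathbb{R}_+\to\mathbb{R}_+$ is positive definite if $\rho(r)=0\iff r=0$. $V:\mathbb{R}^N\to\mathbb{R}_+$ is proper and positive definite if $\psi_1(\|x\|)\le V(x)\le\psi_2(\|x\|)$ for some $\psi_1,\psi_2\in\mathcal{K}_\infty$. An ISS Lyapunov function for $\dot x=f(x,u)$ is a continuous $V$, proper, positive definite, locally Lipschitz on $\mathbb{R}^N\setminus\{0\}$, such that for some $\gamma\in\mathcal{K}$ and positive definite $\alpha$, at all points of differentiability, $V(x)\ge\gamma(\|u\|)\Rightarrow\nabla V(x)f(x,u)\le-\alpha(\|x\|)$. $V_i:\mathbb{R}^{N_i}\to\mathbb{R}_+$ is an ISS Lyapunov function for subsystem $i$ if it is continuous, proper, positive definite, locally Lipschitz on $\mathbb{R}^{N_i}\setminus\{0\}$, and there are $\gamma_{ij}\in\mathcal{K}_\infty\cup\{0\}$ ($\gamma_{ii}\equiv0$), $\gamma_i\in\mathcal{K}$ and positive definite $\alpha_i$ such that at all points of differentiability of $V_i$: for $i\in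 I_\Sigma$, $V_i(x_i)\ge\sum_j\gamma_{ij}(V_j(x_j))+\gamma_i(\|u\|)\Rightarrow\nabla V_i(x_i)f_i(x,u)\le-\alpha_i(\|x_i\|)$; for $i\in I_{\max}$, $V_i(x_i)\ge\max\{\max_j\gamma_{ij}(V_j(x_j)),\gamma_i(\|u\|)\}\Rightarrow\nabla V_i(x_i)f_i(x,u)\le-\alpha_i(\|x_i\|)$. $\Gamma(s)=(\Gamma_i(s))_i$ with $\Gamma_i(s)=\sum_j\gamma_{ij}(s_j)$ ($i\in I_\Sigma$), $\Gamma_i(s)=\max_j\gamma_{ij}(s_j)$ ($i\in I_{\max}$). $\overline\Gamma:\mathbb{R}^n_+\times\mathbb{R}_+\to\mathbb{R}^n_+$ is $\overline\Gamma_i(s,r)=\sum_j\gamma_{ij}(s_j)+\gamma_i(r)$ for $i\in I_\Sigma$ and $\overline\Gamma_i(s,r)=\max\{\max_j\gamma_{ij}(s_j),\gamma_i(r)\}$ for $i\in I_{\max}$. $D_\alpha(s)=(D_i(s_i))_i$ with $D_i=\mathrm{id}+\alpha$ for $i\in I_\Sigma$, $D_i=\mathrm{id}$ for $i\in I_{\max}$. For $x,y\in\mathbb{R}^n$: $x<y$ iff $x_i<y_i$ for all $i$; $x\not\ge y$ iff $x_i<y_i$ for some $i$. A continuous $\sigma=(\sigma_1,\dots,\sigma_n)$ with $\sigma_i\in\mathcal{K}_\infty$ is an $\Omega$-path (with respect to $\Gamma$) if (i) each $\sigma_i^{-1}$ is locally Lipschitz on $(0,\infty)$; (ii) for every compact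 $P\subset(0,\infty)$ there are constants $0<c\le C$ with $c\le(\sigma_i^{-1})'(r)\le C$ for all $r\in P$ at which $\sigma_i^{-1}$ is differentiable; (iii) $\Gamma(\sigma(r))<\sigma(r)$ for all $r>0$. *)

theory Defs
  imports "HOL-Analysis.Analysis"
begin

text \<open>Class K: continuous, strictly increasing on [0,oo), vanishing at 0
  (values at negative arguments are irrelevant).\<close>
definition classK :: "(real \<Rightarrow> real) \<Rightarrow> bool" where
  "classK g \<longleftrightarrow> g 0 = 0 \<and> continuous_on {0..} g \<and> strict_mono_on {0..} g"

definition classKinf :: "(real \<Rightarrow> real) \<Rightarrow> bool" where
  "classKinf g \<longleftrightarrow> classK g \<and> filterlim g at_top at_top"

definition posdef :: "(real \<Rightarrow> real) \<Rightarrow> bool" where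
  "posdef \<rho> \<longleftrightarrow> continuous_on {0..} \<rho> \<and> (\<forall>r\<ge>0. 0 \<le> \<rho> r) \<and> (\<forall>r\<ge>0. \<rho> r = 0 \<longleftrightarrow> r = 0)"

definition classKL :: "(real \<Rightarrow> real \<Rightarrow> real) \<Rightarrow> bool" where
  "classKL \<beta> \<longleftrightarrow> continuous_on ({0..} \<times> {0..}) (\<lambda>(s, t). \<beta> s t)
     \<and> (\<forall>t\<ge>0. classK (\<lambda>s. \<beta> s t))
     \<and> (\<forall>s\<ge>0. (\<forall>t1 t2. 0 \<le> t1 \<longrightarrow> t1 \<le> t2 \<longrightarrow> \<beta> s t2 \<le> \<beta> s t1) \<and> (\<beta> s \<longlongrightarrow> 0) at_top)"

definition loc_lipschitz_on :: "'a::metric_space set \<Rightarrow> ('a \<Rightarrow> 'b::metric_space) \<Rightarrow> bool" where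
  "loc_lipschitz_on S V \<longleftrightarrow> (\<forall>x\<in>S. \<exists>r>0. \<exists>L. L-lipschitz_on (cball x r \<inter> S) V)"

definition proper_posdef :: "'a::real_normed_vector set \<Rightarrow> ('a \<Rightarrow> real) \<Rightarrow> bool" where
  "proper_posdef S V \<longleftrightarrow> (\<exists>\<psi>1 \<psi>2. classKinf \<psi>1 \<and> classKinf \<psi>2 \<and>
       (\<forall>x\<in>S. \<psi>1 (norm x) \<le> V x \<and> V x \<le> \<psi>2 (norm x)))"

definition proj :: "'a::euclidean_space set \<Rightarrow> 'a \<Rightarrow> 'a" where
  "proj B x = (\<Sum>b\<in>B. (x \<bullet> b) *\<^sub>R b)"

definition block_partition :: "nat \<Rightarrow> (nat \<Rightarrow> 'a::euclidean_space set) \<Rightarrow> bool" where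
  "block_partition n B \<longleftrightarrow> (\<forall>i<n. B i \<subseteq> Basis) \<and>
     (\<forall>i<n. \<forall>j<n. i \<noteq> j \<longrightarrow> B i \<inter> B j = {}) \<and> (\<Union>i<n. B i) = Basis"

definition admissible_input :: "(real \<Rightarrow> 'b::euclidean_space) \<Rightarrow> bool" where
  "admissible_input u \<longleftrightarrow> set_borel_measurable lebesgue {0..} u \<and>
     (\<exists>c. AE t in lebesgue. t \<in> {0..} \<longrightarrow> norm (u t) \<le> c)"

definition linf_norm :: "(real \<Rightarrow> 'b::euclidean_space) \<Rightarrow> real" where
  "linf_norm u = Inf {c. AE t in lebesgue. t \<in> {0..} \<longrightarrow> norm (u t) \<le> c}"

definition is_solution ::
  "('a::euclidean_space \<Rightarrow> 'b \<Rightarrow> 'a) \<Rightarrow> 'a \<Rightarrow> (real \<Rightarrow> 'b) \<Rightarrow> real set \<Rightarrow> (real \<Rightarrow> 'a) \<Rightarrow> bool" where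
  "is_solution F x0 u I x \<longleftrightarrow> continuous_on I x \<and> x 0 = x0 \<and>
     (\<forall>t\<in>I. (\<lambda>s. F (x s) (u s)) absolutely_integrable_on {0..t} \<and>
             x t = x0 + integral {0..t} (\<lambda>s. F (x s) (u s)))"

definition ISS :: "('a::euclidean_space \<Rightarrow> 'b::euclidean_space \<Rightarrow> 'a) \<Rightarrow> bool" where
  "ISS F \<longleftrightarrow> (\<exists>\<beta> \<gamma>. classKL \<beta> \<and> classK \<gamma> \<and>
     (\<forall>x0 u. admissible_input u \<longrightarrow>
        (\<exists>x. is_solution F x0 u {0..} x) \<and>
        (\<forall>x T. is_solution F x0 u {0..T} x \<longrightarrow>
           (\<forall>t\<in>{0..T}. norm (x t) \<le> \<beta> (norm x0) t + \<gamma> (linf_norm u)))))"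

definition ISS_lyapunov :: "('a::euclidean_space \<Rightarrow> 'b::euclidean_space \<Rightarrow> 'a) \<Rightarrow> ('a \<Rightarrow> real) \<Rightarrow> bool" where
  "ISS_lyapunov F V \<longleftrightarrow> continuous_on UNIV V \<and> proper_posdef UNIV V \<and>
     loc_lipschitz_on (UNIV - {0}) V \<and>
     (\<exists>\<gamma> \<alpha>. classK \<gamma> \<and> posdef \<alpha> \<and>
        (\<forall>x u D. (V has_derivative D) (at x) \<longrightarrow> \<gamma> (norm u) \<le> V x \<longrightarrow> D (F x u) \<le> - \<alpha> (norm x)))"

definition Gam :: "nat \<Rightarrow> nat set \<Rightarrow> (nat \<Rightarrow> nat \<Rightarrow> real \<Rightarrow> real) \<Rightarrow> (nat \<Rightarrow> real) \<Rightarrow> nat \<Rightarrow> real" where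
  "Gam n Isum \<gamma> s = (\<lambda>i. if i \<in> Isum then (\<Sum>j<n. \<gamma> i j (s j))
                         else Max ((\<lambda>j. \<gamma> i j (s j)) ` {..<n}))"

definition Gambar :: "nat \<Rightarrow> nat set \<Rightarrow> (nat \<Rightarrow> nat \<Rightarrow> real \<Rightarrow> real) \<Rightarrow> (nat \<Rightarrow> real \<Rightarrow> real)
      \<Rightarrow> (nat \<Rightarrow> real) \<Rightarrow> real \<Rightarrow> nat \<Rightarrow> real" where
  "Gambar n Isum \<gamma> \<gamma>u s r = (\<lambda>i. if i \<in> Isum then (\<Sum>j<n. \<gamma> i j (s j)) + \<gamma>u i r
                         else max (Max ((\<lambda>j. \<gamma> i j (s j)) ` {..<n})) (\<gamma>u i r))"

definition Dalpha :: "nat set \<Rightarrow> (real \<Rightarrow> real) \<Rightarrow> (nat \<Rightarrow> real) \<Rightarrow> nat \<Rightarrow> real" where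
  "Dalpha Isum \<alpha> s = (\<lambda>i. if i \<in> Isum then s i + \<alpha> (s i) else s i)"

definition sinv :: "(real \<Rightarrow> real) \<Rightarrow> real \<Rightarrow> real" where
  "sinv g = inv_into {0..} g"

definition omega_path :: "nat \<Rightarrow> nat set \<Rightarrow> (nat \<Rightarrow> nat \<Rightarrow> real \<Rightarrow> real) \<Rightarrow> (nat \<Rightarrow> real \<Rightarrow> real) \<Rightarrow> bool" where
  "omega_path n Isum \<gamma> \<sigma> \<longleftrightarrow>
     (\<forall>i<n. classKinf (\<sigma> i)) \<and>
     (\<forall>i<n. loc_lipschitz_on {0<..} (sinv (\<sigma> i))) \<and>
     (\<forall>P. compact P \<and> P \<subseteq> {0<..} \<longrightarrow>
        (\<exists>c C. 0 < c \<and> c \<le> C \<and>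
          (\<forall>i<n. \<forall>r\<in>P. \<forall>d. (sinv (\<sigma> i) has_real_derivative d) (at r) \<longrightarrow> c \<le> d \<and> d \<le> C))) \<and>
     (\<forall>r>0. \<forall>i<n. Gam n Isum \<gamma> (\<lambda>j. \<sigma> j r) i < \<sigma> i r)"

text \<open>Subsystem i has state x_i = proj (B i) x in span (B i) (= R^{N_i}) and input
  u_i = proj (C i) u in span (C i) (= R^{m_i}); V i is only relevant on span (B i).\<close>
definition sub_ISS_lyapunov ::
  "nat \<Rightarrow> nat set \<Rightarrow> (nat \<Rightarrow> 'a::euclidean_space set) \<Rightarrow> (nat \<Rightarrow> 'b::euclidean_space set)
   \<Rightarrow> (nat \<Rightarrow> 'a \<Rightarrow> 'b \<Rightarrow> 'a) \<Rightarrow> (nat \<Rightarrow> 'a \<Rightarrow> real)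
   \<Rightarrow> (nat \<Rightarrow> nat \<Rightarrow> real \<Rightarrow> real) \<Rightarrow> (nat \<Rightarrow> real \<Rightarrow> real) \<Rightarrow> (nat \<Rightarrow> real \<Rightarrow> real) \<Rightarrow> nat \<Rightarrow> bool" where
  "sub_ISS_lyapunov n Isum B C f V \<gamma> \<gamma>u \<alpha> i \<longleftrightarrow>
     continuous_on (span (B i)) (V i) \<and> proper_posdef (span (B i)) (V i) \<and>
     loc_lipschitz_on (span (B i) - {0}) (V i) \<and>
     (\<forall>j<n. classKinf (\<gamma> i j) \<or> (\<forall>s\<ge>0. \<gamma> i j s = 0)) \<and> (\<forall>s\<ge>0. \<gamma> i i s = 0) \<and>
     classK (\<gamma>u i) \<and> posdef (\<alpha> i) \<and>
     (\<forall>x u D. (V i has_derivative D) (at (proj (B i) x) within span (B i)) \<longrightarrow>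
        Gambar n Isum \<gamma> \<gamma>u (\<lambda>j. V j (proj (B j) x)) (norm u) i \<le> V i (proj (B i) x) \<longrightarrow>
        D (f i x (proj (C i) u)) \<le> - \<alpha> i (norm (proj (B i) x)))"

end

theory Submission
  imports Defs
begin

text \<open>
  The small gain condition holds with a robust margin: for some \<open>\<kappa>\<close> of class \<open>K\<close>-infinity,
  \<open>s \<le> \<Gamma> s + \<kappa> (\<Sum>s)\<close> (with a maximum instead of the sum in the maximization rows) still forces
  \<open>s = 0\<close>. Let \<open>A\<close> be this enlarged operator. Where \<open>A s \<le> s\<close>, the iterates of \<open>s \<mapsto> (A s + s) / 2\<close>
  decrease to \<open>0\<close>; a limit of such orbits with ever larger starting points is a two-sided chain
  that decreases from infinity to \<open>0\<close>, and interpolating it linearly in \<open>log r\<close> gives the path \<open>\<sigma>\<close>.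
  The margin \<open>\<kappa>\<close> becomes the input gain \<open>\<phi>\<close>.

  The functions \<open>V i\<close> are only Lipschitz, so everything differential rests on Rademacher's theorem:
  a decrease at the points of differentiability is a decrease of the increments along every direction
  close to that of the vector field. An active term of \<open>max\<^sub>i \<sigma>\<^sub>i\<^sup>-\<^sup>1 (V\<^sub>i)\<close> touches the maximum from
  below, so its increase backwards along the flow bounds the derivative of the maximum.

  A Lyapunov function with decay rate \<open>a\<close> decays exponentially after rescaling by \<open>exp (\<integral> 1 / a)\<close>,
  until it is dominated by the input. This bounds all solutions, and hence those of the vector field
  truncated outside a large ball, which exist globally by a fixed point argument.
\<close>

section \<open>Comparison functions\<close>

lemma classK_nonneg: "classK g \<Longrightarrow> 0 \<le> x \<Longrightarrow> 0 \<le> g x"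
  unfolding classK_def strict_mono_on_def
  by (metis atLeast_iff less_eq_real_def order_refl)

lemma classK_less: "classK g \<Longrightarrow> 0 \<le> x \<Longrightarrow> x < y \<Longrightarrow> g x < g y"
  unfolding classK_def strict_mono_on_def by auto

lemma classK_mono: "classK g \<Longrightarrow> 0 \<le> x \<Longrightarrow> x \<le> y \<Longrightarrow> g x \<le> g y"
  using classK_less[of g x y] by (cases "x = y") auto

lemma classK_pos: "classK g \<Longrightarrow> 0 < x \<Longrightarrow> 0 < g x"
  using classK_less[of g 0 x] by (auto simp: classK_def)

lemma classK_0: "classK g \<Longrightarrow> g 0 = 0"
  by (simp add: classK_def)

lemma classK_cont: "classK g \<Longrightarrow> continuous_on {0..} g"
  by (simp add: classK_def)

lemma classK_le_iff:
  assumes "classK g" "0 \<le> x" "0 \<le> y" shows "g x \<le> g y \<longleftrightarrow> x \<le> y"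
proof
  show "x \<le> y" if "g x \<le> g y"
  proof (rule ccontr)
    assume "\<not> x \<le> y"
    then have "g y < g x" using classK_less[OF assms(1,3)] by simp
    then show False using that by simp
  qed
qed (rule classK_mono[OF assms(1,2)])

lemma classK_less_iff:
  assumes "classK g" "0 \<le> x" "0 \<le> y" shows "g x < g y \<longleftrightarrow> x < y"
  using classK_le_iff[OF assms(1,3,2)] by linarith

lemma classK_tendsto:
  assumes "classK g" "(f \<longlongrightarrow> l) F" "0 \<le> l" "eventually (\<lambda>x. 0 \<le> f x) F"
  shows "((\<lambda>x. g (f x)) \<longlongrightarrow> g l) F"
  using continuous_on_tendsto_compose[OF classK_cont[OF assms(1)] assms(2)] assms(3,4) by simp

lemma classKI:
  assumes "g 0 = 0" "continuous_on {0..} g" "\<And>x y. 0 \<le> x \<Longrightarrow> x < y \<Longrightarrow> g x < g y"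
  shows "classK g"
  using assms unfolding classK_def strict_mono_on_def by auto

lemma classKinfD: "classKinf g \<Longrightarrow> classK g"
  by (simp add: classKinf_def)

lemma classKinf_unbounded: "classKinf g \<Longrightarrow> filterlim g at_top at_top"
  by (simp add: classKinf_def)

lemma classKinf_exceeds:
  assumes "classKinf g" obtains R where "0 < R" "\<And>x. R \<le> x \<Longrightarrow> M < g x"
proof -
  have "eventually (\<lambda>x. M < g x) at_top"
    using classKinf_unbounded[OF assms] by (simp add: filterlim_at_top_dense)
  then obtain R where "\<And>x. R \<le> x \<Longrightarrow> M < g x" by (auto simp: eventually_at_top_linorder)
  then show ?thesis by (intro that[of "max R 1"]) auto
qed

lemma classKinfI:
  assumes "classK g" "\<And>M. \<exists>x\<ge>0. M \<le> g x"
  shows "classKinf g"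
  unfolding classKinf_def filterlim_at_top eventually_at_top_linorder
proof (intro conjI assms(1) allI)
  fix M
  obtain x where "0 \<le> x" "M \<le> g x" using assms(2) by blast
  then show "\<exists>N. \<forall>y\<ge>N. M \<le> g y"
    using classK_mono[OF assms(1), of x] by (intro exI[of _ x]) (auto intro: order_trans)
qed

lemma classK_add:
  assumes "classK g" "classK h" shows "classK (\<lambda>x. g x + h x)"
  using assms by (intro classKI continuous_intros)
    (auto simp: classK_0 classK_cont intro: add_strict_mono classK_less)

lemma classKinf_add:
  assumes "classKinf g" "classK h" shows "classKinf (\<lambda>x. g x + h x)"
proof (rule classKinfI)
  show "classK (\<lambda>x. g x + h x)" using assms by (intro classK_add) (auto simp: classKinf_def)
  fix M
  obtain R where R: "0 < R" "\<And>x. R \<le> x \<Longrightarrow> M < g x" using classKinf_exceeds[OF assms(1)] by blast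
  then show "\<exists>x\<ge>0. M \<le> g x + h x"
    using classK_nonneg[OF assms(2), of R]
      by (intro exI[of _ R]) (auto intro: add_increasing2 less_imp_le)
qed

lemma classK_compose:
  assumes "classK g" "classK h" shows "classK (\<lambda>x. g (h x))"
proof (rule classKI)
  show "continuous_on {0..} (\<lambda>x. g (h x))"
    using assms
      by (intro continuous_on_compose2[OF classK_cont classK_cont]) (auto simp: classK_nonneg)
qed (use assms in \<open>auto simp: classK_0 classK_nonneg classK_less\<close>)

lemma classKinf_compose:
  assumes "classKinf g" "classKinf h" shows "classKinf (\<lambda>x. g (h x))"
  unfolding classKinf_def
  using classK_compose[of g h] filterlim_compose[OF classKinf_unbounded classKinf_unbounded] assms
  by (auto simp: classKinf_def)

lemma classKinf_id: "classKinf (\<lambda>x. x)"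
proof (intro classKinfI classKI)
  show "\<exists>x\<ge>0. M \<le> x" for M :: real by (intro exI[of _ "max 0 M"]) auto
qed auto

lemma classK_sum:
  assumes "finite A" "\<And>i. i \<in> A \<Longrightarrow> classK (g i)" "A \<noteq> {}"
  shows "classK (\<lambda>x. \<Sum>i\<in>A. g i x)"
  using assms
    by (intro classKI continuous_intros sum_strict_mono) (auto simp: classK_0 classK_cont classK_less)

lemma classKinf_sum:
  assumes "finite A" "\<And>i. i \<in> A \<Longrightarrow> classKinf (g i)" "A \<noteq> {}"
  shows "classKinf (\<lambda>x. \<Sum>i\<in>A. g i x)"
proof (rule classKinfI)
  show "classK (\<lambda>x. \<Sum>i\<in>A. g i x)" using assms by (intro classK_sum) (auto simp: classKinf_def)
  fix M
  obtain i where i: "i \<in> A" using assms by auto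
  obtain R where R: "0 < R" "\<And>x. R \<le> x \<Longrightarrow> M < g i x"
    using classKinf_exceeds[OF assms(2)[OF i]] by blast
  have "g i R \<le> (\<Sum>i\<in>A. g i R)"
    using assms R i by (intro member_le_sum) (auto simp: classKinf_def intro: classK_nonneg)
  then show "\<exists>x\<ge>0. M \<le> (\<Sum>i\<in>A. g i x)"
    using R by (intro exI[of _ R]) (auto intro: order_trans less_imp_le)
qed

lemma classKinf_surj:
  assumes "classKinf g" "0 \<le> y" obtains x where "0 \<le> x" "g x = y"
proof -
  obtain R where R: "0 < R" "\<And>x. R \<le> x \<Longrightarrow> y < g x" using classKinf_exceeds[OF assms(1)] by blast
  have "\<exists>x\<ge>0. x \<le> R \<and> g x = y"
    using assms R classKinfD[OF assms(1)]
    by (intro IVT') (auto simp: classK_0 less_imp_le intro: continuous_on_subset[OF classK_cont])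
  then show ?thesis using that by auto
qed

lemma sinv_apply: "classK g \<Longrightarrow> 0 \<le> x \<Longrightarrow> sinv g (g x) = x"
  unfolding sinv_def classK_def by (intro inv_into_f_f strict_mono_on_imp_inj_on) auto

lemma sinv_image: "classKinf g \<Longrightarrow> g ` {0..} = {0..}"
proof (intro equalityI subsetI)
  assume g: "classKinf g"
  show "y \<in> {0..}" if "y \<in> g ` {0..}" for y using that classK_nonneg[OF classKinfD[OF g]] by auto
  show "y \<in> g ` {0..}" if "y \<in> {0..}" for y
    using that classKinf_surj[OF g, of y] by (metis atLeast_iff image_eqI)
qed

lemma apply_sinv: "classKinf g \<Longrightarrow> 0 \<le> y \<Longrightarrow> g (sinv g y) = y"
  unfolding sinv_def by (intro f_inv_into_f) (simp add: sinv_image)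

lemma sinv_nonneg: "classKinf g \<Longrightarrow> 0 \<le> y \<Longrightarrow> 0 \<le> sinv g y"
  unfolding sinv_def using inv_into_into[of y g "{0..}"] by (simp add: sinv_image)

lemma classKinf_sinv:
  assumes "classKinf g" shows "classKinf (sinv g)"
proof (rule classKinfI, rule classKI)
  have g: "classK g" using assms by (rule classKinfD)
  show "sinv g 0 = 0" using sinv_apply[OF g, of 0] by (simp add: classK_0[OF g])
  show less: "sinv g x < sinv g y" if "0 \<le> x" "x < y" for x y
  proof -
    have "g (sinv g x) < g (sinv g y)" using that assms by (simp add: apply_sinv)
    then show ?thesis using that sinv_nonneg[OF assms] by (simp add: classK_less_iff[OF g])
  qed
  define e where "e y = (if 0 \<le> y then sinv g y else y)" for y
  have "range e = UNIV"
  proof (intro equalityI subsetI)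
    fix x :: real
    have "x = e (if 0 \<le> x then g x else x)"
      by (auto simp: e_def sinv_apply[OF g] classK_nonneg[OF g])
    then show "x \<in> range e" by blast
  qed auto
  moreover have "e x \<le> e y" if "x \<le> y" for x y
    using less[of x y] that sinv_nonneg[OF assms, of y] by (cases "x = y") (auto simp: e_def)
  ultimately have "continuous_on UNIV e" by (intro continuous_onI_mono) auto
  then have "continuous_on {0..} e" by (rule continuous_on_subset) simp
  then show "continuous_on {0..} (sinv g)"
    by (rule continuous_on_eq) (simp add: e_def)
  show "\<exists>x\<ge>0. M \<le> sinv g x" for M
    using sinv_apply[OF g, of "max 0 M"] classK_nonneg[OF g, of "max 0 M"]
    by (intro exI[of _ "g (max 0 M)"]) auto
qed

lemma sinv_less_iff:
  assumes "classKinf g" "0 \<le> x" "0 \<le> y" shows "sinv g x < y \<longleftrightarrow> x < g y"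
  using classK_less_iff[OF classKinfD[OF assms(1)] sinv_nonneg[OF assms(1,2)] assms(3)]
  by (simp add: apply_sinv[OF assms(1,2)])

lemma sinv_le_iff:
  assumes "classKinf g" "0 \<le> x" "0 \<le> y" shows "sinv g x \<le> y \<longleftrightarrow> x \<le> g y"
  using classK_le_iff[OF classKinfD[OF assms(1)] sinv_nonneg[OF assms(1,2)] assms(3)]
  by (simp add: apply_sinv[OF assms(1,2)])

lemma le_sinv_iff:
  assumes "classKinf g" "0 \<le> x" "0 \<le> y" shows "x \<le> sinv g y \<longleftrightarrow> g x \<le> y"
  using classK_le_iff[OF classKinfD[OF assms(1)] assms(2) sinv_nonneg[OF assms(1,3)]]
  by (simp add: apply_sinv[OF assms(1,3)])

lemma posdef_pos: "posdef \<rho> \<Longrightarrow> 0 < r \<Longrightarrow> 0 < \<rho> r"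
  unfolding posdef_def by (metis less_eq_real_def less_irrefl)

lemma posdef_0: "posdef \<rho> \<Longrightarrow> \<rho> 0 = 0"
  by (simp add: posdef_def)

lemma posdef_cont: "posdef \<rho> \<Longrightarrow> continuous_on {0..} \<rho>"
  by (simp add: posdef_def)

lemma posdefI:
  assumes "\<rho> 0 = 0" "continuous_on {0..} \<rho>" "\<And>r. 0 < r \<Longrightarrow> 0 < \<rho> r"
  shows "posdef \<rho>"
  using assms unfolding posdef_def by (metis less_eq_real_def less_irrefl)

lemma posdef_lower_bound_on_interval:
  assumes "posdef \<rho>" "0 < c"
  obtains \<mu> where "0 < \<mu>" "\<And>r. r \<in> {c..d} \<Longrightarrow> \<mu> \<le> \<rho> r"
proof (cases "c \<le> d")
  case True
  have "continuous_on {c..d} \<rho>"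
    using posdef_cont[OF assms(1)] by (rule continuous_on_subset) (use assms(2) in auto)
  then obtain s where s: "s \<in> {c..d}" "\<And>r. r \<in> {c..d} \<Longrightarrow> \<rho> s \<le> \<rho> r"
    using continuous_attains_inf[of "{c..d}" \<rho>] True by auto
  show ?thesis
  proof (rule that)
    show "0 < \<rho> s" using posdef_pos[OF assms(1), of s] s(1) assms(2) by simp
  qed (rule s(2))
next
  case False
  then show ?thesis by (intro that[of 1]) auto
qed

subsection \<open>Minorants below a parametrised condition\<close>

definition inf_conv :: "(real \<Rightarrow> real) \<Rightarrow> real \<Rightarrow> real" where
  "inf_conv q r = (INF t\<in>{0..}. q t + \<bar>r - t\<bar>)"

lemma inf_conv_ge:
  assumes "\<And>t. 0 \<le> t \<Longrightarrow> m \<le> q t + \<bar>r - t\<bar>" shows "m \<le> inf_conv q r"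
  unfolding inf_conv_def by (rule cINF_greatest) (use assms in auto)

lemma inf_conv_le:
  assumes "\<And>t. 0 \<le> t \<Longrightarrow> 0 \<le> q t" "0 \<le> t" shows "inf_conv q r \<le> q t + \<bar>r - t\<bar>"
  unfolding inf_conv_def
proof (rule cINF_lower)
  show "bdd_below ((\<lambda>t. q t + \<bar>r - t\<bar>) ` {0..})"
    using assms(1) by (intro bdd_belowI2[of _ 0] add_nonneg_nonneg) auto
qed (use assms(2) in simp)

lemma inf_conv_le_self:
  assumes "\<And>t. 0 \<le> t \<Longrightarrow> 0 \<le> q t" "0 \<le> r" shows "inf_conv q r \<le> q r"
  using inf_conv_le[of q r r] assms by simp

lemma inf_conv_lipschitz:
  assumes "\<And>t. 0 \<le> t \<Longrightarrow> 0 \<le> q t" shows "1-lipschitz_on S (inf_conv q)"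
proof (rule lipschitz_onI)
  have shift: "inf_conv q x - \<bar>x - y\<bar> \<le> inf_conv q y" for x y
  proof (rule inf_conv_ge)
    show "inf_conv q x - \<bar>x - y\<bar> \<le> q t + \<bar>y - t\<bar>" if "0 \<le> t" for t
      using inf_conv_le[of q t x, OF assms that] by linarith
  qed
  show "dist (inf_conv q x) (inf_conv q y) \<le> 1 * dist x y" for x y
    using shift[of x y] shift[of y x] by (simp add: dist_real_def abs_le_iff abs_minus_commute)
qed simp

lemma inf_conv_ge_min:
  assumes "\<And>t. 0 \<le> t \<Longrightarrow> 0 \<le> q t" "\<And>t. 0 \<le> t \<Longrightarrow> \<bar>r - t\<bar> < \<delta> \<Longrightarrow> c \<le> q t"
  shows "min c \<delta> \<le> inf_conv q r"
proof (rule inf_conv_ge)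
  fix t :: real assume "0 \<le> t"
  then show "min c \<delta> \<le> q t + \<bar>r - t\<bar>"
    using assms(1)[of t] assms(2)[of t] by (cases "\<bar>r - t\<bar> < \<delta>") auto
qed

lemma inf_conv_mono:
  assumes q: "\<And>t. 0 \<le> t \<Longrightarrow> 0 \<le> q t" "\<And>s t. 0 \<le> s \<Longrightarrow> s \<le> t \<Longrightarrow> q s \<le> q t" and "0 \<le> r" "r \<le> s"
  shows "inf_conv q r \<le> inf_conv q s"
proof (rule inf_conv_ge)
  fix t :: real assume t: "0 \<le> t"
  show "inf_conv q r \<le> q t + \<bar>s - t\<bar>"
  proof (cases "t \<le> r")
    case True
    then show ?thesis using inf_conv_le[of q t r, OF q(1) t] \<open>r \<le> s\<close> by simp
  next
    case False
    then have "q r \<le> q t" using \<open>0 \<le> r\<close> by (intro q(2)) auto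
    then show ?thesis using inf_conv_le_self[of q r, OF q(1) \<open>0 \<le> r\<close>] by simp
  qed
qed

text \<open>Half the supremum is itself admissible for a condition that is closed downwards; the cutoff
  \<open>c \<le> r\<close> keeps the supremum finite.\<close>
definition threshold :: "(real \<Rightarrow> real \<Rightarrow> bool) \<Rightarrow> real \<Rightarrow> real" where
  "threshold P r = Sup {c. 0 \<le> c \<and> c \<le> r \<and> (c = 0 \<or> P r c)} / 2"

lemma threshold_ge:
  assumes "0 \<le> c" "c \<le> r" "c = 0 \<or> P r c" shows "c / 2 \<le> threshold P r"
  unfolding threshold_def
proof (intro divide_right_mono cSup_upper)
  show "bdd_above {c. 0 \<le> c \<and> c \<le> r \<and> (c = 0 \<or> P r c)}" by (rule bdd_aboveI[of _ r]) simp
qed (use assms in auto)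

lemma threshold_nonneg: "0 \<le> r \<Longrightarrow> 0 \<le> threshold P r"
  using threshold_ge[of 0 r P] by simp

lemma threshold_0: "threshold P 0 = 0"
proof -
  have "{c::real. 0 \<le> c \<and> c \<le> 0 \<and> (c = 0 \<or> P 0 c)} = {0}" by auto
  then show ?thesis by (simp add: threshold_def)
qed

lemma threshold_pos:
  assumes down: "\<And>d. 0 < d \<Longrightarrow> d \<le> c \<Longrightarrow> P r d" and "0 < c" "0 < r"
  shows "0 < threshold P r"
proof -
  have "min c r / 2 \<le> threshold P r" using assms by (intro threshold_ge disjI2 down) auto
  then show ?thesis using assms by (auto simp: min_def split: if_splits)
qed

lemma threshold_satisfies:
  assumes down: "\<And>c d. P r c \<Longrightarrow> 0 < d \<Longrightarrow> d \<le> c \<Longrightarrow> P r d" and d: "0 \<le> r" "0 < d" "d \<le> threshold P r"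
  shows "P r d"
proof -
  let ?C = "{c. 0 \<le> c \<and> c \<le> r \<and> (c = 0 \<or> P r c)}"
  have "0 \<in> ?C" using d(1) by simp
  then have "?C \<noteq> {}" by blast
  moreover have "d < Sup ?C" using d by (simp add: threshold_def)
  ultimately obtain c where "c \<in> ?C" "d < c" by (meson less_cSupE)
  then show ?thesis using down[of c d] d(2) by simp
qed

lemma threshold_mono:
  assumes "\<And>c. P r c \<Longrightarrow> P s c" "0 \<le> r" "r \<le> s"
  shows "threshold P r \<le> threshold P s"
  unfolding threshold_def
proof (intro divide_right_mono cSup_subset_mono)
  show "bdd_above {c. 0 \<le> c \<and> c \<le> s \<and> (c = 0 \<or> P s c)}" by (rule bdd_aboveI[of _ s]) simp
qed (use assms in auto)

lemma ex_posdef_satisfying: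
  fixes P :: "real \<Rightarrow> real \<Rightarrow> bool"
  assumes down: "\<And>r c d. P r c \<Longrightarrow> 0 < d \<Longrightarrow> d \<le> c \<Longrightarrow> P r d"
    and loc: "\<And>a b. 0 < a \<Longrightarrow> a \<le> b \<Longrightarrow> \<exists>c>0. \<forall>r\<in>{a..b}. P r c"
  shows "\<exists>\<rho>. posdef \<rho> \<and> (\<forall>r>0. P r (\<rho> r)) \<and> (\<forall>r\<ge>0. \<rho> r \<le> r)"
proof (intro exI conjI allI impI)
  let ?q = "threshold P"
  have bounded: "inf_conv ?q r \<le> r" if "0 \<le> r" for r
    using inf_conv_le[of ?q 0 r, OF threshold_nonneg] that by (simp add: threshold_0)
  have pos: "0 < inf_conv ?q r" if r: "0 < r" for r
  proof -
    obtain c where c_pos: "0 < c" and P_c: "\<And>t. t \<in> {r/2..2*r} \<Longrightarrow> P t c"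
      using loc[of "r/2" "2*r"] r by auto
    have "min c (r/2) / 2 \<le> ?q t" if t: "\<bar>r - t\<bar> < r/2" for t
    proof (rule threshold_ge)
      have "t \<in> {r/2..2*r}" using t unfolding atLeastAtMost_iff by linarith
      then show "min c (r/2) = 0 \<or> P t (min c (r/2))" "min c (r/2) \<le> t"
        using down[OF P_c, of t "min c (r/2)"] c_pos r by auto
    qed (use c_pos r in simp)
    then have "min (min c (r/2) / 2) (r/2) \<le> inf_conv ?q r"
      by (intro inf_conv_ge_min) (auto intro: threshold_nonneg)
    then show ?thesis using c_pos r by (auto simp: min_def split: if_splits)
  qed
  have "0 \<le> inf_conv ?q 0" by (rule inf_conv_ge) (simp add: threshold_nonneg)
  then have "inf_conv ?q 0 = 0" using bounded[of 0] by simp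
  then show "posdef (inf_conv ?q)"
    using pos by (intro posdefI lipschitz_on_continuous_on[OF inf_conv_lipschitz] threshold_nonneg)
  show "P r (inf_conv ?q r)" if "0 < r" for r
  proof (rule threshold_satisfies)
    show "inf_conv ?q r \<le> ?q r" using that by (intro inf_conv_le_self threshold_nonneg) auto
    show "P r d" if "P r c" "0 < d" "d \<le> c" for c d using that by (rule down)
  qed (use that pos[OF that] in auto)
  show "inf_conv ?q r \<le> r" if "0 \<le> r" for r by (rule bounded[OF that])
qed

lemma classKinf_mult_saturation:
  assumes cont: "continuous_on {0..} h" and mono: "\<And>r s. 0 \<le> r \<Longrightarrow> r \<le> s \<Longrightarrow> h r \<le> h s"
    and pos: "\<And>r. 0 < r \<Longrightarrow> 0 < h r" and unbounded: "\<And>M. \<exists>r\<ge>1. M \<le> h r"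
  shows "classKinf (\<lambda>r. h r * (r / (1 + r)))"
proof (rule classKinfI, rule classKI)
  show "continuous_on {0..} (\<lambda>r. h r * (r / (1 + r)))"
    by (intro continuous_intros cont) auto
  show "h x * (x / (1 + x)) < h y * (y / (1 + y))" if xy: "0 \<le> x" "x < y" for x y
  proof -
    have "h x * (x / (1 + x)) \<le> h y * (x / (1 + x))"
      using xy mono[of x y] by (intro mult_right_mono) auto
    also have "\<dots> < h y * (y / (1 + y))"
      using xy pos[of y] by (intro mult_strict_left_mono) (auto simp: field_simps)
    finally show ?thesis .
  qed
  show "\<exists>x\<ge>0. M \<le> h x * (x / (1 + x))" for M
  proof -
    obtain r where r: "1 \<le> r" "2 * max 1 M \<le> h r" using unbounded by blast
    have "1 / 2 \<le> r / (1 + r)" using r(1) by (simp add: field_simps)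
    then have "2 * max 1 M * (1 / 2) \<le> h r * (r / (1 + r))"
      using r pos[of r] by (intro mult_mono) auto
    then show ?thesis using r(1) by (intro exI[of _ r]) auto
  qed
qed simp

lemma inf_conv_threshold_ge:
  assumes "\<And>r s c. P r c \<Longrightarrow> r \<le> s \<Longrightarrow> P s c" "0 \<le> r"
  shows "min (threshold P (r / 2)) (r / 2) \<le> inf_conv (threshold P) r"
proof (rule inf_conv_ge_min)
  show "threshold P (r / 2) \<le> threshold P t" if "\<bar>r - t\<bar> < r / 2" for t
  proof -
    have t: "0 \<le> r / 2" "r / 2 \<le> t" using that assms(2) by linarith+
    from assms(1)[OF _ t(2)] t show ?thesis by (rule threshold_mono)
  qed
qed (simp add: threshold_nonneg)

lemma inf_conv_threshold_unbounded:
  assumes mono: "\<And>r s c. P r c \<Longrightarrow> r \<le> s \<Longrightarrow> P s c" and large: "\<And>c. \<exists>r. P r c"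
  shows "\<exists>r\<ge>1. M \<le> inf_conv (threshold P) r"
proof -
  define c where "c = 2 * max 1 M"
  obtain s where "P s c" using large by blast
  define r where "r = 2 * max s c"
  have r: "1 \<le> r" "c \<le> r / 2" "s \<le> r / 2" "0 \<le> c" "M \<le> c / 2" by (auto simp: r_def c_def)
  have "c / 2 \<le> threshold P (r / 2)"
    using r mono[OF \<open>P s c\<close> r(3)] by (intro threshold_ge) auto
  moreover have "min (threshold P (r / 2)) (r / 2) \<le> inf_conv (threshold P) r"
    by (rule inf_conv_threshold_ge) (erule (1) mono, use r(1) in linarith)
  ultimately show ?thesis using r by (intro exI[of _ r]) auto
qed

lemma ex_classKinf_satisfying:
  fixes P :: "real \<Rightarrow> real \<Rightarrow> bool"
  assumes mono: "\<And>r s c d. P r c \<Longrightarrow> r \<le> s \<Longrightarrow> d \<le> c \<Longrightarrow> P s d"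
    and small: "\<And>r. 0 < r \<Longrightarrow> \<exists>c>0. P r c" and large: "\<And>c. \<exists>r. P r c"
  shows "\<exists>\<kappa>. classKinf \<kappa> \<and> (\<forall>r>0. P r (\<kappa> r))"
proof (intro exI conjI allI impI)
  let ?q = "threshold P"
  let ?h = "inf_conv ?q"
  let ?\<kappa> = "\<lambda>r. ?h r * (r / (1 + r))"
  have mono_arg: "P s c" if "P r c" "r \<le> s" for r s c using that order_refl by (rule mono)
  have down: "P r d" if "P r c" "d \<le> c" for r c d using that by (rule mono[OF _ order_refl])
  have h_pos: "0 < ?h r" if r: "0 < r" for r
  proof -
    obtain c where "0 < c" "P (r / 2) c" using small[of "r / 2"] r by auto
    have "0 < ?q (r / 2)"
      by (rule threshold_pos[of c P "r / 2", OF down[OF \<open>P (r / 2) c\<close>] \<open>0 < c\<close>]) (use r in simp_all)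
    moreover have "min (?q (r / 2)) (r / 2) \<le> ?h r"
      by (rule inf_conv_threshold_ge) (erule (1) mono_arg, use r in simp)
    ultimately show ?thesis using r by auto
  qed
  show "classKinf ?\<kappa>"
  proof (rule classKinf_mult_saturation)
    show "continuous_on {0..} ?h"
      by (intro lipschitz_on_continuous_on[OF inf_conv_lipschitz] threshold_nonneg)
    show "?h r \<le> ?h s" if "0 \<le> r" "r \<le> s" for r s
      using threshold_nonneg threshold_mono[OF mono_arg] that by (rule inf_conv_mono)
    show "\<exists>r\<ge>1. M \<le> ?h r" for M
      by (rule inf_conv_threshold_unbounded[OF _ large]) (erule (1) mono_arg)
  qed (rule h_pos)
  show "P r (?\<kappa> r)" if r: "0 < r" for r
  proof (rule threshold_satisfies[OF down])
    show "0 < ?\<kappa> r" using h_pos[OF r] r by simp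
    have "?\<kappa> r \<le> ?h r * 1" using h_pos[OF r] r by (intro mult_left_mono) auto
    also have "\<dots> \<le> ?q r" using inf_conv_le_self[of ?q r] threshold_nonneg r by simp
    finally show "?\<kappa> r \<le> ?q r" .
  qed (use r in simp_all)
qed

section \<open>The gain operator\<close>

lemma tendsto_Max_image:
  fixes f :: "'i \<Rightarrow> 'a \<Rightarrow> real"
  assumes "finite A" "A \<noteq> {}" "\<And>j. j \<in> A \<Longrightarrow> (f j \<longlongrightarrow> l j) F"
  shows "((\<lambda>x. Max ((\<lambda>j. f j x) ` A)) \<longlongrightarrow> Max (l ` A)) F"
  using assms
proof (induction A rule: finite_ne_induct)
  case (insert a A)
  then have "((\<lambda>x. max (f a x) (Max ((\<lambda>j. f j x) ` A))) \<longlongrightarrow> max (l a) (Max (l ` A))) F"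
    by (intro tendsto_max) auto
  then show ?case using insert.hyps by simp
qed simp

lemma Max_image_le_Max_image:
  assumes "finite A" "A \<noteq> {}" "\<And>j. j \<in> A \<Longrightarrow> f j \<le> (g j :: real)"
  shows "Max (f ` A) \<le> Max (g ` A)"
proof (rule Max.boundedI)
  fix x assume "x \<in> f ` A"
  then obtain j where j: "j \<in> A" "x = f j" by blast
  have "g j \<le> Max (g ` A)" using assms(1) j(1) by (intro Max_ge) auto
  then show "x \<le> Max (g ` A)" using assms(3)[OF j(1)] j(2) by simp
qed (use assms in auto)

lemma pointwise_bounded_imp_convergent_subsequence:
  fixes X :: "nat \<Rightarrow> 'i::countable \<Rightarrow> real"
  assumes "\<And>N i. \<bar>X N i\<bar> \<le> b i"
  obtains r l where "strict_mono (r :: nat \<Rightarrow> nat)" "\<And>i. (\<lambda>N. X (r N) i) \<longlonglongrightarrow> l i"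
proof -
  have "compact (\<Pi>\<^sub>E i\<in>UNIV. {- b i..b i})"
    unfolding compactin_euclidean_iff[symmetric] euclidean_product_topology[symmetric] compactin_PiE
    by simp
  then have "seq_compact (\<Pi>\<^sub>E i\<in>UNIV. {- b i..b i})" by (rule compact_imp_seq_compact)
  moreover have "X N \<in> (\<Pi>\<^sub>E i\<in>UNIV. {- b i..b i})" for N
    using assms[of N] by (auto simp: abs_le_iff minus_le_iff)
  ultimately obtain l r where r: "strict_mono (r :: nat \<Rightarrow> nat)" and l: "(X \<circ> r) \<longlonglongrightarrow> l"
    unfolding seq_compact_def by metis
  have "(\<lambda>N. (X \<circ> r) N i) \<longlonglongrightarrow> l i" for i
    by (rule continuous_on_tendsto_compose[OF continuous_on_product_coordinates l]) auto
  then show ?thesis using r by (intro that) (auto simp: o_def)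
qed

definition cutoff :: "real \<Rightarrow> (nat \<Rightarrow> real) \<Rightarrow> nat \<Rightarrow> real" where
  "cutoff \<theta> s j = (if \<theta> < s j then s j else 0)"

locale gain_operator =
  fixes n :: nat and Isum :: "nat set" and \<gamma> :: "nat \<Rightarrow> nat \<Rightarrow> real \<Rightarrow> real"
  assumes n_pos: "0 < n"
    and gains: "\<And>i j. i < n \<Longrightarrow> j < n \<Longrightarrow> classKinf (\<gamma> i j) \<or> (\<forall>s\<ge>0. \<gamma> i j s = 0)"
begin

lemma gain_mono: "i < n \<Longrightarrow> j < n \<Longrightarrow> 0 \<le> s \<Longrightarrow> s \<le> t \<Longrightarrow> \<gamma> i j s \<le> \<gamma> i j t"
  using gains[of i j] classK_mono[of "\<gamma> i j" s t] by (auto simp: classKinf_def)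

lemma gain_0: "i < n \<Longrightarrow> j < n \<Longrightarrow> \<gamma> i j 0 = 0"
  using gains[of i j] by (auto simp: classKinf_def classK_def)

lemma gain_nonneg: "i < n \<Longrightarrow> j < n \<Longrightarrow> 0 \<le> s \<Longrightarrow> 0 \<le> \<gamma> i j s"
  using gain_mono[of i j 0 s] gain_0[of i j] by simp

lemma gain_tendsto:
  assumes "i < n" "j < n" "(f \<longlongrightarrow> l) F" "0 \<le> l" "eventually (\<lambda>x. 0 \<le> f x) F"
  shows "((\<lambda>x. \<gamma> i j (f x)) \<longlongrightarrow> \<gamma> i j l) F"
proof (cases "classKinf (\<gamma> i j)")
  case True
  show ?thesis by (rule classK_tendsto[OF classKinfD[OF True] assms(3-5)])
next
  case False
  then have "\<forall>s\<ge>0. \<gamma> i j s = 0" using gains assms by blast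
  then have "eventually (\<lambda>x. \<gamma> i j (f x) = \<gamma> i j l) F"
    using assms(4,5) by (auto elim: eventually_mono)
  then show ?thesis by (rule tendsto_eventually)
qed

abbreviation \<Gamma> :: "(nat \<Rightarrow> real) \<Rightarrow> nat \<Rightarrow> real" where
  "\<Gamma> \<equiv> Gam n Isum \<gamma>"

text \<open>The gain operator with the same external gain in every row: its second argument is the gain
  itself, not the norm of an input.\<close>
abbreviation G :: "(nat \<Rightarrow> real) \<Rightarrow> real \<Rightarrow> nat \<Rightarrow> real" where
  "G \<equiv> Gambar n Isum \<gamma> (\<lambda>i r. r)"

lemma Gambar_eq_G: "Gambar n Isum \<gamma> \<gamma>u s r i = G s (\<gamma>u i r) i"
  by (simp add: Gambar_def)

lemma gain_le_Gam:
  assumes "i < n" "\<And>j. j < n \<Longrightarrow> 0 \<le> s j" "j < n"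
  shows "\<gamma> i j (s j) \<le> \<Gamma> s i"
proof (cases "i \<in> Isum")
  case True
  then show ?thesis
    using assms gain_nonneg by (auto simp: Gam_def intro!: member_le_sum)
next
  case False
  then show ?thesis using assms(3) by (auto simp: Gam_def intro!: Max_ge)
qed

lemma Gam_nonneg:
  assumes "i < n" "\<And>j. j < n \<Longrightarrow> 0 \<le> s j"
  shows "0 \<le> \<Gamma> s i"
  using gain_nonneg[OF assms(1) n_pos assms(2)[OF n_pos]] gain_le_Gam[where s=s, OF assms n_pos]
    by linarith

lemma G_eq_Gam:
  "G s c i = (if i \<in> Isum then \<Gamma> s i + c else max (\<Gamma> s i) c)"
  by (simp add: Gam_def Gambar_def)

lemma Gam_mono:
  assumes "i < n" "\<And>j. j < n \<Longrightarrow> 0 \<le> s j" "\<And>j. j < n \<Longrightarrow> s j \<le> t j"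
  shows "\<Gamma> s i \<le> \<Gamma> t i"
  using n_pos gain_mono[OF assms(1) _ assms(2,3)]
  by (auto simp: Gam_def intro!: sum_mono Max_image_le_Max_image)

lemma G_mono:
  assumes "i < n" "\<And>j. j < n \<Longrightarrow> 0 \<le> s j" "\<And>j. j < n \<Longrightarrow> s j \<le> t j" "c \<le> d"
  shows "G s c i \<le> G t d i"
  using Gam_mono[of i s t] assms by (auto simp: G_eq_Gam)

lemma G_ge:
  assumes "i < n" "\<And>j. j < n \<Longrightarrow> 0 \<le> s j"
  shows "c \<le> G s c i"
  using Gam_nonneg[OF assms] by (simp add: G_eq_Gam)

lemma Gam_le_G:
  assumes "0 \<le> c"
  shows "\<Gamma> s i \<le> G s c i"
  using assms by (simp add: G_eq_Gam)

lemma Gam_tendsto: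
  assumes i: "i < n" and s: "\<And>j. j < n \<Longrightarrow> ((\<lambda>x. s x j) \<longlongrightarrow> t j) F"
    and nonneg: "\<And>x j. j < n \<Longrightarrow> 0 \<le> s x j" and F: "F \<noteq> bot"
  shows "((\<lambda>x. \<Gamma> (s x) i) \<longlongrightarrow> \<Gamma> t i) F"
proof -
  have "0 \<le> t j" if "j < n" for j
    using tendsto_lowerbound[OF s[OF that] _ F] nonneg[OF that] by simp
  then have "((\<lambda>x. \<gamma> i j (s x j)) \<longlongrightarrow> \<gamma> i j (t j)) F" if "j < n" for j
    using gain_tendsto[OF i that s[OF that]] nonneg that by simp
  then show ?thesis
    unfolding Gam_def using n_pos by (cases "i \<in> Isum") (auto intro!: tendsto_sum tendsto_Max_image)
qed

lemma G_tendsto: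
  assumes "i < n" "\<And>j. j < n \<Longrightarrow> ((\<lambda>x. s x j) \<longlongrightarrow> t j) F" "\<And>x j. j < n \<Longrightarrow> 0 \<le> s x j"
    and "(c \<longlongrightarrow> d) F" "F \<noteq> bot"
  shows "((\<lambda>x. G (s x) (c x) i) \<longlongrightarrow> G t d i) F"
  unfolding G_eq_Gam using Gam_tendsto[OF assms(1-3,5)] assms(4)
  by (cases "i \<in> Isum") (auto intro: tendsto_add tendsto_max)

definition total_gain :: "real \<Rightarrow> real" where
  "total_gain b = (\<Sum>i<n. \<Sum>j<n. \<gamma> i j b)"

lemma row_sum_le_total_gain:
  assumes "0 \<le> b" "i < n" shows "(\<Sum>j<n. \<gamma> i j b) \<le> total_gain b"
  unfolding total_gain_def
  by (rule member_le_sum) (use assms in \<open>auto intro!: sum_nonneg gain_nonneg\<close>)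

lemma gain_le_total_gain:
  assumes "0 \<le> b" "i < n" "j < n" shows "\<gamma> i j b \<le> total_gain b"
proof -
  have "\<gamma> i j b \<le> (\<Sum>j<n. \<gamma> i j b)"
    by (rule member_le_sum) (use assms in \<open>auto intro!: gain_nonneg\<close>)
  then show ?thesis using row_sum_le_total_gain[OF assms(1,2)] by simp
qed

lemma total_gain_nonneg: "0 \<le> b \<Longrightarrow> 0 \<le> total_gain b"
  using gain_le_total_gain[OF _ n_pos n_pos, of b] gain_nonneg[OF n_pos n_pos, of b] by linarith

lemma G_le_cutoff:
  assumes i: "i < n" and b_nonneg: "0 \<le> b" and s: "\<And>j. j < n \<Longrightarrow> 0 \<le> s j"
    and gap: "\<And>j. j < n \<Longrightarrow> s j \<le> b \<or> \<theta> < s j"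
  shows "G s c i \<le> G (cutoff \<theta> s) (total_gain b + max c 0) i"
proof (cases "i \<in> Isum")
  case True
  have "\<gamma> i j (s j) \<le> \<gamma> i j (cutoff \<theta> s j) + \<gamma> i j b" if j: "j < n" for j
    using gap[OF j] gain_mono[OF i j s[OF j]] gain_nonneg[OF i j] b_nonneg
    by (auto simp: cutoff_def gain_0[OF i j])
  then have "(\<Sum>j<n. \<gamma> i j (s j)) \<le> (\<Sum>j<n. \<gamma> i j (cutoff \<theta> s j)) + (\<Sum>j<n. \<gamma> i j b)"
    unfolding sum.distrib[symmetric] by (intro sum_mono) auto
  then show ?thesis using True row_sum_le_total_gain[OF b_nonneg i] by (simp add: Gambar_def)
next
  case False
  have "\<gamma> i j (s j) \<le> G (cutoff \<theta> s) (total_gain b + max c 0) i" if j: "j < n" for j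
  proof (cases "\<theta> < s j")
    case True
    have "0 \<le> cutoff \<theta> s j" if "j < n" for j using s[OF that] by (simp add: cutoff_def)
    then have "\<gamma> i j (cutoff \<theta> s j) \<le> \<Gamma> (cutoff \<theta> s) i" by (intro gain_le_Gam i j)
    then show ?thesis using True \<open>i \<notin> Isum\<close> by (simp add: cutoff_def[of \<theta> s j] G_eq_Gam)
  next
    case False
    then have "\<gamma> i j (s j) \<le> \<gamma> i j b" using gap[OF j] by (intro gain_mono[OF i j s[OF j]]) auto
    also have "\<dots> \<le> total_gain b" by (rule gain_le_total_gain[OF b_nonneg i j])
    finally show ?thesis using \<open>i \<notin> Isum\<close> by (auto simp: G_eq_Gam)
  qed
  moreover have "c \<le> G (cutoff \<theta> s) (total_gain b + max c 0) i"
    using False total_gain_nonneg[OF b_nonneg] by (auto simp: G_eq_Gam)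
  ultimately have "max (Max ((\<lambda>j. \<gamma> i j (s j)) ` {..<n})) c \<le> G (cutoff \<theta> s) (total_gain b + max c 0) i"
    using n_pos by (intro max.boundedI Max.boundedI) auto
  then show ?thesis using False by (simp add: Gambar_def[of n Isum \<gamma> "\<lambda>i r. r" s])
qed

end

section \<open>Consequences of the small gain condition\<close>

lemma ex_gap_in_levels:
  fixes R :: "nat \<Rightarrow> real"
  assumes "incseq R"
  obtains k where "k \<le> n" "\<And>i. i < n \<Longrightarrow> s i \<le> R k \<or> R (Suc k) < s i"
proof -
  have "\<exists>k\<le>n. \<forall>i<n. s i \<le> R k \<or> R (Suc k) < s i"
  proof (rule ccontr)
    assume "\<not> ?thesis"
    then have "\<forall>k\<le>n. \<exists>i<n. R k < s i \<and> s i \<le> R (Suc k)" by (meson not_le not_less)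
    then obtain \<iota> where \<iota>: "\<And>k. k \<le> n \<Longrightarrow> \<iota> k < n \<and> R k < s (\<iota> k) \<and> s (\<iota> k) \<le> R (Suc k)"
      by metis
    have "s (\<iota> k) < s (\<iota> l)" if "k < l" "l \<le> n" for k l
      using \<iota>[of k] \<iota>[of l] incseqD[OF assms, of "Suc k" l] that by force
    then have "inj_on \<iota> {..n}" by (intro linorder_inj_onI) force+
    then have "card {..n} \<le> card {..<n}" using \<iota> by (intro card_inj_on_le[of \<iota>]) auto
    then show False by simp
  qed
  then show ?thesis using that by blast
qed

locale small_gain = gain_operator +
  fixes \<alpha> :: "real \<Rightarrow> real"
  assumes \<alpha>: "classKinf \<alpha>"
    and small_gain: "\<And>s. (\<forall>i<n. 0 \<le> s i) \<and> (\<exists>i<n. s i \<noteq> 0) \<Longrightarrow>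
            (\<exists>i<n. Gam n Isum \<gamma> (Dalpha Isum \<alpha> s) i < s i)"
begin

lemma \<alpha>_nonneg: "0 \<le> r \<Longrightarrow> 0 \<le> \<alpha> r"
  using classK_nonneg[OF classKinfD[OF \<alpha>]] .

lemma le_inflated_Gam_imp_0:
  assumes s: "\<And>j. j < n \<Longrightarrow> 0 \<le> s j"
    and s_le: "\<And>i. i < n \<Longrightarrow> s i \<le> Dalpha Isum \<alpha> (\<Gamma> s) i"
    and i: "i < n"
  shows "s i = 0"
proof (rule ccontr)
  assume "s i \<noteq> 0"
  have \<Gamma>s: "0 \<le> \<Gamma> s j" if "j < n" for j by (rule Gam_nonneg[OF that s])
  have "\<Gamma> s i \<noteq> 0"
    using s_le[OF i] s[OF i] \<open>s i \<noteq> 0\<close> classK_0[OF classKinfD[OF \<alpha>]]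
      by (auto simp: Dalpha_def split: if_splits)
  then obtain k where k: "k < n" "\<Gamma> (Dalpha Isum \<alpha> (\<Gamma> s)) k < \<Gamma> s k"
    using small_gain[of "\<Gamma> s"] \<Gamma>s i by blast
  have "\<Gamma> s k \<le> \<Gamma> (Dalpha Isum \<alpha> (\<Gamma> s)) k" by (rule Gam_mono[OF k(1) s s_le])
  then show False using k(2) by simp
qed

definition below :: "real \<Rightarrow> (nat \<Rightarrow> real) set" where
  "below c = {s. \<forall>i<n. 0 \<le> s i \<and> s i \<le> G s c i}"

lemma below_nonneg: "s \<in> below c \<Longrightarrow> i < n \<Longrightarrow> 0 \<le> s i"
  by (simp add: below_def)

lemma below_le_G: "s \<in> below c \<Longrightarrow> i < n \<Longrightarrow> s i \<le> G s c i"
  by (simp add: below_def)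

lemma below_mono: "c \<le> d \<Longrightarrow> s \<in> below c \<Longrightarrow> s \<in> below d"
  unfolding below_def using G_mono[of _ s s c d] by (auto intro: order_trans)

lemma below_0_eq_0:
  assumes s: "s \<in> below 0" and i: "i < n" shows "s i = 0"
proof (rule le_inflated_Gam_imp_0[OF below_nonneg[OF s] _ i])
  fix i assume i: "i < n"
  have "0 \<le> \<Gamma> s i" by (rule Gam_nonneg[OF i below_nonneg[OF s]])
  then show "s i \<le> Dalpha Isum \<alpha> (\<Gamma> s) i"
    using below_le_G[OF s i] \<alpha>_nonneg[of "\<Gamma> s i"]
      by (auto simp: G_eq_Gam Dalpha_def split: if_splits)
qed

text \<open>If no component of \<open>s\<close> lies between \<open>b\<close> and \<open>\<theta>\<close>, cut off those below \<open>b\<close>. The surplus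
  \<open>\<alpha>\<close> absorbs their contribution to the large components, so that the rest violates the small gain
  condition.\<close>
lemma below_gap:
  assumes c_nonneg: "0 \<le> c" and b_nonneg: "0 \<le> b"
  shows "\<exists>\<theta>\<ge>b. \<forall>s\<in>below c. (\<forall>i<n. s i \<le> b \<or> \<theta> < s i) \<longrightarrow> (\<forall>i<n. s i \<le> b)"
proof -
  define \<beta> where "\<beta> = total_gain b + c"
  have \<beta>: "0 \<le> \<beta>" "\<beta> = total_gain b + max c 0"
    using total_gain_nonneg[OF b_nonneg] c_nonneg by (auto simp: \<beta>_def)
  obtain y where y: "0 < y" "\<And>x. y \<le> x \<Longrightarrow> \<beta> < \<alpha> x" using classKinf_exceeds[OF \<alpha>] by blast
  define \<theta> where "\<theta> = b + \<beta> + y"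
  have "s i \<le> b" if s: "s \<in> below c" and gap: "\<forall>i<n. s i \<le> b \<or> \<theta> < s i" and i: "i < n" for s i
  proof -
    let ?t = "cutoff \<theta> s"
    have t: "0 \<le> ?t j" if "j < n" for j using below_nonneg[OF s that] by (simp add: cutoff_def)
    have "?t i = 0"
    proof (rule le_inflated_Gam_imp_0[OF t _ i])
      fix i assume i: "i < n"
      have \<Gamma>t: "0 \<le> \<Gamma> ?t i" by (rule Gam_nonneg[OF i t])
      show "?t i \<le> Dalpha Isum \<alpha> (\<Gamma> ?t) i"
      proof (cases "\<theta> < s i")
        case True
        have "s i \<le> G ?t \<beta> i"
          using below_le_G[OF s i] G_le_cutoff[where s=s and c=c, OF i b_nonneg below_nonneg[OF s], of \<theta>] gap
          by (simp add: \<beta>(2))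
        moreover have "\<beta> + y < s i" using True b_nonneg by (simp add: \<theta>_def)
        moreover have "\<beta> < \<alpha> (\<Gamma> ?t i)" if "y \<le> \<Gamma> ?t i" using y(2)[OF that] .
        ultimately show ?thesis
          using True y(1) by (auto simp: G_eq_Gam Dalpha_def cutoff_def[of \<theta> s i] split: if_splits)
      next
        case False
        then show ?thesis using \<Gamma>t \<alpha>_nonneg[OF \<Gamma>t] by (auto simp: cutoff_def[of \<theta> s i] Dalpha_def)
      qed
    qed
    then show ?thesis
      using gap i b_nonneg \<beta>(1) y(1) by (auto simp: cutoff_def \<theta>_def split: if_splits)
  qed
  then show ?thesis using \<beta>(1) y(1) by (intro exI[of _ \<theta>]) (auto simp: \<theta>_def)
qed

lemma below_bounded:
  assumes "0 \<le> c"
  obtains R where "\<And>s i. s \<in> below c \<Longrightarrow> i < n \<Longrightarrow> s i \<le> R"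
proof -
  obtain \<theta> where \<theta>: "\<And>b. 0 \<le> b \<Longrightarrow> b \<le> \<theta> b"
    "\<And>b s i. 0 \<le> b \<Longrightarrow> s \<in> below c \<Longrightarrow> \<forall>i<n. s i \<le> b \<or> \<theta> b < s i \<Longrightarrow> i < n \<Longrightarrow> s i \<le> b"
    using below_gap[OF assms] by metis
  define R where "R k = (\<theta> ^^ k) 0" for k
  have R_Suc: "R (Suc k) = \<theta> (R k)" for k by (simp add: R_def)
  have R_nonneg: "0 \<le> R k" for k
    by (induction k) (use \<theta>(1) in \<open>auto simp: R_def intro: order_trans\<close>)
  then have R_mono: "incseq R" by (intro incseq_SucI) (simp add: R_Suc \<theta>(1))
  show ?thesis
  proof (rule that)
    fix s i assume s: "s \<in> below c" and i: "i < n"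
    obtain k where k: "k \<le> n" "\<And>i. i < n \<Longrightarrow> s i \<le> R k \<or> R (Suc k) < s i"
      using ex_gap_in_levels[OF R_mono] by blast
    then have "s i \<le> R k" using \<theta>(2)[OF R_nonneg s _ i] by (simp add: R_Suc)
    then show "s i \<le> R n" using incseqD[OF R_mono k(1)] by simp
  qed
qed

lemma below_sum_bounded:
  assumes "0 \<le> c"
  obtains R where "\<And>s. s \<in> below c \<Longrightarrow> (\<Sum>i<n. s i) \<le> R"
proof -
  obtain R where "\<And>s i. s \<in> below c \<Longrightarrow> i < n \<Longrightarrow> s i \<le> R" using below_bounded[OF assms] by blast
  then have "(\<Sum>i<n. s i) \<le> real n * R" if "s \<in> below c" for s
    using sum_bounded_above[of "{..<n}" s R] that by simp
  then show ?thesis by (rule that)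
qed

lemma below_limit:
  assumes s: "\<And>k. s k \<in> below (c k)" and l: "\<And>i. i < n \<Longrightarrow> (\<lambda>k. s k i) \<longlonglongrightarrow> l i" and c_lim: "c \<longlonglongrightarrow> d"
  shows "l \<in> below d"
  unfolding below_def
proof (intro CollectI allI impI conjI)
  fix i assume i: "i < n"
  show "0 \<le> l i" using LIMSEQ_le_const[OF l[OF i]] below_nonneg[OF s i] by blast
  show "l i \<le> G l d i"
  proof (rule LIMSEQ_le[OF l[OF i]])
    show "(\<lambda>k. G (s k) (c k) i) \<longlonglongrightarrow> G l d i"
      using i l c_lim below_nonneg[OF s] by (intro G_tendsto) auto
  qed (use below_le_G[OF s i] in blast)
qed

lemma below_small:
  assumes a: "0 < a"
  shows "\<exists>c>0. \<forall>s\<in>below c. (\<Sum>i<n. s i) < a"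
proof (rule ccontr)
  assume not_small: "\<not> ?thesis"
  have "\<exists>s\<in>below c. a \<le> (\<Sum>i<n. s i)" if "0 < c" for c using not_small that by (meson not_le)
  then have "\<exists>s\<in>below (inverse (real (Suc k))). a \<le> (\<Sum>i<n. s i)" for k by simp
  then obtain s where s: "\<And>k. s k \<in> below (inverse (real (Suc k)))" and ge: "\<And>k. a \<le> (\<Sum>i<n. s k i)"
    by metis
  have s1: "s k \<in> below 1" for k
    using s[of k] by (rule below_mono[rotated]) (simp add: field_simps)
  obtain R where R: "\<And>t i. t \<in> below 1 \<Longrightarrow> i < n \<Longrightarrow> t i \<le> R" using below_bounded[of 1] by auto
  define s' where "s' k i = (if i < n then s k i else 0)" for k i
  have "\<bar>s' k i\<bar> \<le> \<bar>R\<bar>" for k i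
    using R[OF s1, of i k] below_nonneg[OF s1, of i k] by (auto simp: s'_def)
  then obtain r l where r: "strict_mono (r :: nat \<Rightarrow> nat)" and lim: "\<And>i. (\<lambda>k. s' (r k) i) \<longlonglongrightarrow> l i"
    using pointwise_bounded_imp_convergent_subsequence[of s' "\<lambda>_. \<bar>R\<bar>"] by blast
  have l: "(\<lambda>k. s (r k) i) \<longlonglongrightarrow> l i" if "i < n" for i
    using lim[of i] that by (simp add: s'_def)
  have "l \<in> below 0"
  proof (rule below_limit)
    show "s (r k) \<in> below (inverse (real (Suc (r k))))" for k by (rule s)
    show "(\<lambda>k. inverse (real (Suc (r k)))) \<longlonglongrightarrow> 0"
      using LIMSEQ_subseq_LIMSEQ[OF LIMSEQ_inverse_real_of_nat r] by (simp add: o_def)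
  qed (rule l)
  then have "(\<Sum>i<n. l i) = 0" using below_0_eq_0 by (intro sum.neutral) auto
  moreover have "(\<lambda>k. \<Sum>i<n. s (r k) i) \<longlonglongrightarrow> (\<Sum>i<n. l i)" by (intro tendsto_sum) (use l in auto)
  then have "a \<le> (\<Sum>i<n. l i)" by (rule LIMSEQ_le_const) (use ge in blast)
  ultimately show False using a by simp
qed

lemma ex_robustness_margin:
  obtains \<kappa> where "classKinf \<kappa>"
    "\<And>s i. s \<in> below (\<kappa> (\<Sum>j<n. s j)) \<Longrightarrow> i < n \<Longrightarrow> s i = 0"
proof -
  define P where "P r c \<longleftrightarrow> (\<forall>s\<in>below c. (\<Sum>i<n. s i) < r)" for r c
  have mono: "P r' c'" if "P r c" "r \<le> r'" "c' \<le> c" for r r' c c'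
    using that(1,2) below_mono[OF that(3)] unfolding P_def by force
  have "\<exists>\<kappa>. classKinf \<kappa> \<and> (\<forall>r>0. P r (\<kappa> r))"
  proof (rule ex_classKinf_satisfying)
    show "P r' c'" if "P r c" "r \<le> r'" "c' \<le> c" for r r' c c' using that by (rule mono)
    show "\<exists>c>0. P r c" if "0 < r" for r using below_small[OF that] by (simp add: P_def)
    show "\<exists>r. P r c" for c
    proof -
      obtain R where R: "\<And>s. s \<in> below (max c 0) \<Longrightarrow> (\<Sum>i<n. s i) \<le> R"
        using below_sum_bounded[of "max c 0"] by auto
      have "P (R + 1) (max c 0)" unfolding P_def using R by fastforce
      then show ?thesis using mono[OF _ order_refl, of "R + 1" "max c 0" c] by auto
    qed
  qed
  then obtain \<kappa> where \<kappa>: "classKinf \<kappa>" "\<And>r. 0 < r \<Longrightarrow> P r (\<kappa> r)" by blast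
  show ?thesis
  proof (rule that[OF \<kappa>(1)])
    fix s i assume s: "s \<in> below (\<kappa> (\<Sum>j<n. s j))" and i: "i < n"
    have "\<not> 0 < (\<Sum>j<n. s j)" using \<kappa>(2)[of "\<Sum>j<n. s j"] s by (auto simp: P_def)
    moreover have "s i \<le> (\<Sum>j<n. s j)" using below_nonneg[OF s] i by (intro member_le_sum) auto
    ultimately show "s i = 0" using below_nonneg[OF s i] by linarith
  qed
qed

end

section \<open>Decaying chains of a small gain operator\<close>

lemma componentwise_incseq_convergent:
  fixes X :: "nat \<Rightarrow> nat \<Rightarrow> real"
  assumes nonneg: "\<And>k j. j < n \<Longrightarrow> 0 \<le> X k j" and inc: "\<And>k j. j < n \<Longrightarrow> X k j \<le> X (Suc k) j"
    and bounded: "\<And>k. (\<Sum>j<n. X k j) \<le> c"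
  obtains l where "\<And>j. j < n \<Longrightarrow> (\<lambda>k. X k j) \<longlonglongrightarrow> l j"
proof -
  have "\<exists>l. (\<lambda>k. X k j) \<longlonglongrightarrow> l" if j: "j < n" for j
  proof -
    have "incseq (\<lambda>k. X k j)" using inc[OF j] by (rule incseq_SucI)
    moreover have "X k j \<le> c" for k
      using member_le_sum[of j "{..<n}" "X k"] nonneg bounded[of k] j by simp
    ultimately obtain l where "(\<lambda>k. X k j) \<longlonglongrightarrow> l" by (metis incseq_convergent)
    then show ?thesis by blast
  qed
  then show ?thesis using that by metis
qed

lemma ex_index_in_unit_interval:
  fixes S :: "nat \<Rightarrow> real"
  assumes lim: "S \<longlonglongrightarrow> 0" and le_double: "\<And>j. S j \<le> 2 * S (Suc j)" and large: "2 ^ Suc m \<le> S 0"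
  obtains p where "m < p" "1/2 \<le> S p" "S p \<le> 1" "\<And>d. d \<le> p \<Longrightarrow> S (p - d) \<le> 2 ^ d"
proof -
  have S_le: "S j \<le> 2 ^ d * S (j + d)" for j d
  proof (induction d)
    case (Suc d)
    also have "2 ^ d * S (j + d) \<le> 2 ^ d * (2 * S (Suc (j + d)))"
      by (intro mult_left_mono le_double) simp
    finally show ?case by (simp add: mult.assoc mult.commute[of 2])
  qed simp
  have "eventually (\<lambda>j. S j < 1) sequentially" using lim by (rule order_tendstoD) simp
  then have ex: "\<exists>j. S j \<le> 1" unfolding eventually_sequentially by (meson less_imp_le order_refl)
  define p where "p = (LEAST j. S j \<le> 1)"
  have p: "S p \<le> 1" unfolding p_def using ex by (rule LeastI_ex)
  have le_power: "S (p - d) \<le> 2 ^ d" if "d \<le> p" for d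
  proof -
    have "S (p - d) \<le> 2 ^ d * S p" using S_le[of "p - d" d] that by simp
    also have "\<dots> \<le> 2 ^ d * 1" by (intro mult_left_mono p) simp
    finally show ?thesis by simp
  qed
  have "2 ^ Suc m \<le> (2::real) ^ p" using large le_power[of p] by simp
  then have "Suc m \<le> p" by (rule power_le_imp_le_exp[rotated]) simp
  then have "m < p" by simp
  then obtain q where q: "p = Suc q" using Nat.lessE by blast
  then have "\<not> S q \<le> 1" using not_less_Least[of q "\<lambda>j. S j \<le> 1"] by (simp add: p_def)
  then have "1/2 \<le> S p" using le_double[of q] by (simp add: q)
  with \<open>m < p\<close> show ?thesis using p le_power by (rule that)
qed

text \<open>The hypothesis \<open>le_A_imp_0\<close> is the small gain condition \<open>A s \<ge> s \<Longrightarrow> s = 0\<close>. Vectors are functions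
  on the natural numbers of which only the first \<open>n\<close> values matter.\<close>
locale small_gain_operator =
  fixes n :: nat and A :: "(nat \<Rightarrow> real) \<Rightarrow> nat \<Rightarrow> real" and \<kappa> :: "real \<Rightarrow> real"
  assumes dim_pos: "0 < n" and \<kappa>: "classKinf \<kappa>"
    and A_mono: "\<lbrakk>\<And>j. j < n \<Longrightarrow> 0 \<le> s j; \<And>j. j < n \<Longrightarrow> s j \<le> t j; i < n\<rbrakk> \<Longrightarrow> A s i \<le> A t i"
    and A_ge: "\<lbrakk>\<And>j. j < n \<Longrightarrow> 0 \<le> s j; i < n\<rbrakk> \<Longrightarrow> \<kappa> (\<Sum>j<n. s j) \<le> A s i"
    and A_LIMSEQ: "\<lbrakk>\<And>j. j < n \<Longrightarrow> (\<lambda>k. X k j) \<longlonglongrightarrow> t j; \<And>k j. j < n \<Longrightarrow> 0 \<le> X k j; i < n\<rbrakk> \<Longrightarrow>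
      (\<lambda>k. A (X k) i) \<longlonglongrightarrow> A t i"
    and le_A_imp_0: "\<lbrakk>\<And>j. j < n \<Longrightarrow> 0 \<le> s j; \<And>j. j < n \<Longrightarrow> s j \<le> A s j; i < n\<rbrakk> \<Longrightarrow> s i = 0"
begin

lemma \<kappa>_nonneg: "0 \<le> r \<Longrightarrow> 0 \<le> \<kappa> r"
  using classK_nonneg[OF classKinfD[OF \<kappa>]] .

lemma A_nonneg:
  assumes "\<And>j. j < n \<Longrightarrow> 0 \<le> s j" "i < n" shows "0 \<le> A s i"
proof -
  have "0 \<le> \<kappa> (\<Sum>j<n. s j)" using assms(1) by (intro \<kappa>_nonneg sum_nonneg) auto
  then show ?thesis using A_ge[of s, OF assms] by simp
qed

definition decay_set :: "(nat \<Rightarrow> real) set" where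
  "decay_set = {s. \<forall>i<n. 0 \<le> s i \<and> A s i \<le> s i}"

definition avg :: "(nat \<Rightarrow> real) \<Rightarrow> nat \<Rightarrow> real" where
  "avg s i = (A s i + s i) / 2"

lemma decay_set_nonneg: "s \<in> decay_set \<Longrightarrow> i < n \<Longrightarrow> 0 \<le> s i"
  and A_le: "s \<in> decay_set \<Longrightarrow> i < n \<Longrightarrow> A s i \<le> s i"
  by (auto simp: decay_set_def)

lemma A_nonneg_decay_set: "s \<in> decay_set \<Longrightarrow> i < n \<Longrightarrow> 0 \<le> A s i"
  using decay_set_nonneg by (intro A_nonneg) auto

lemma decay_set_limit:
  assumes "\<And>k. X k \<in> decay_set" "\<And>i. i < n \<Longrightarrow> (\<lambda>k. X k i) \<longlonglongrightarrow> l i"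
  shows "l \<in> decay_set"
  unfolding decay_set_def
proof (intro CollectI allI impI conjI)
  fix i assume i: "i < n"
  show "0 \<le> l i" using LIMSEQ_le_const[OF assms(2)[OF i]] decay_set_nonneg[OF assms(1) i] by blast
  have "(\<lambda>k. A (X k) i) \<longlonglongrightarrow> A l i"
    using assms(2) decay_set_nonneg[OF assms(1)] i by (rule A_LIMSEQ)
  then show "A l i \<le> l i"
    by (rule LIMSEQ_le[OF _ assms(2)[OF i]]) (use A_le[OF assms(1) i] in blast)
qed

lemma avg_le: "s \<in> decay_set \<Longrightarrow> i < n \<Longrightarrow> avg s i \<le> s i"
  using A_le[of s i] by (simp add: avg_def)

lemma A_le_avg: "s \<in> decay_set \<Longrightarrow> i < n \<Longrightarrow> A s i \<le> avg s i"
  using A_le[of s i] by (simp add: avg_def)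

lemma le_2_avg: "s \<in> decay_set \<Longrightarrow> i < n \<Longrightarrow> s i \<le> 2 * avg s i"
  using A_nonneg_decay_set[of s i] by (simp add: avg_def)

lemma avg_in_decay_set:
  assumes s: "s \<in> decay_set" shows "avg s \<in> decay_set"
  unfolding decay_set_def
proof (intro CollectI allI impI conjI)
  have nonneg: "0 \<le> avg s i" if "i < n" for i
    using A_nonneg_decay_set[OF s that] decay_set_nonneg[OF s that] by (simp add: avg_def)
  fix i assume i: "i < n"
  show "0 \<le> avg s i" by (rule nonneg[OF i])
  have "A (avg s) i \<le> A s i" by (rule A_mono[OF nonneg avg_le[OF s] i])
  then show "A (avg s) i \<le> avg s i" using A_le_avg[OF s i] by simp
qed

lemma avg_LIMSEQ:
  assumes "\<And>j. j < n \<Longrightarrow> (\<lambda>k. X k j) \<longlonglongrightarrow> l j" "\<And>k. X k \<in> decay_set" "i < n"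
  shows "(\<lambda>k. avg (X k) i) \<longlonglongrightarrow> avg l i"
proof -
  have "(\<lambda>k. A (X k) i) \<longlonglongrightarrow> A l i"
    using assms(1) decay_set_nonneg[OF assms(2)] assms(3) by (rule A_LIMSEQ)
  then show ?thesis unfolding avg_def by (intro tendsto_intros assms) simp_all
qed

lemma avg_fixed_point_eq_0:
  assumes "l \<in> decay_set" "\<And>i. i < n \<Longrightarrow> avg l i = l i" "i < n" shows "l i = 0"
proof (rule le_A_imp_0[OF decay_set_nonneg[OF assms(1)] _ assms(3)])
  fix j assume "j < n"
  then show "l j \<le> A l j" using assms(2)[of j] by (simp add: avg_def field_simps)
qed

lemma avg_orbit_tendsto_0:
  assumes X: "\<And>k. X k \<in> decay_set" and step: "\<And>k i. i < n \<Longrightarrow> X (Suc k) i = avg (X k) i"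
    and i: "i < n"
  shows "(\<lambda>k. X k i) \<longlonglongrightarrow> 0"
proof -
  have "\<exists>l. (\<lambda>k. X k j) \<longlonglongrightarrow> l" if j: "j < n" for j
  proof -
    have "decseq (\<lambda>k. X k j)" using avg_le[OF X j] by (intro decseq_SucI) (simp add: step[OF j])
    moreover have "\<forall>k. 0 \<le> X k j" using decay_set_nonneg[OF X j] by blast
    ultimately obtain l where "(\<lambda>k. X k j) \<longlonglongrightarrow> l" by (rule decseq_convergent)
    then show ?thesis by blast
  qed
  then obtain l where l: "\<And>j. j < n \<Longrightarrow> (\<lambda>k. X k j) \<longlonglongrightarrow> l j" by metis
  have "avg l j = l j" if j: "j < n" for j
    using LIMSEQ_unique[OF avg_LIMSEQ[OF l X j]] LIMSEQ_Suc[OF l[OF j]] by (simp add: step[OF j])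
  from avg_fixed_point_eq_0[OF decay_set_limit[OF X l] this i] have "l i = 0" .
  then show ?thesis using l[OF i] by simp
qed

lemma ascending_orbit_unbounded:
  assumes X: "\<And>k. X k \<in> decay_set" and step: "\<And>k i. i < n \<Longrightarrow> avg (X (Suc k)) i = X k i"
    and pos: "0 < (\<Sum>i<n. X 0 i)"
  shows "\<exists>k. c < (\<Sum>i<n. X k i)"
proof (rule ccontr)
  assume "\<not> ?thesis"
  then have bounded: "(\<Sum>i<n. X k i) \<le> c" for k by (auto simp: not_less)
  have inc: "X k j \<le> X (Suc k) j" if "j < n" for k j
    using avg_le[OF X that, of "Suc k"] step[OF that] by simp
  obtain l where l: "\<And>j. j < n \<Longrightarrow> (\<lambda>k. X k j) \<longlonglongrightarrow> l j"
    using componentwise_incseq_convergent[of n X, OF decay_set_nonneg[OF X] inc bounded] by blast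
  have "avg l j = l j" if j: "j < n" for j
  proof (rule LIMSEQ_unique)
    show "(\<lambda>k. avg (X (Suc k)) j) \<longlonglongrightarrow> avg l j" using X j LIMSEQ_Suc[OF l] by (intro avg_LIMSEQ)
    show "(\<lambda>k. avg (X (Suc k)) j) \<longlonglongrightarrow> l j" using l[OF j] by (simp add: step[OF j])
  qed
  from avg_fixed_point_eq_0[OF decay_set_limit[OF X l] this] have "\<forall>i<n. l i = 0" by blast
  moreover have "(\<lambda>k. \<Sum>i<n. X k i) \<longlonglongrightarrow> (\<Sum>i<n. l i)" by (intro tendsto_sum l) simp
  ultimately have "(\<lambda>k. \<Sum>i<n. X k i) \<longlonglongrightarrow> 0" by (simp add: sum.neutral)
  moreover have "incseq (\<lambda>k. \<Sum>i<n. X k i)" by (intro incseq_SucI sum_mono inc) simp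
  ultimately have "(\<Sum>i<n. X 0 i) \<le> 0" using incseq_le by blast
  then show False using pos by simp
qed

text \<open>The limit of the increasing iterates of \<open>\<lambda>s. max (A s) N\<close>. They stay bounded: \<open>\<kappa> (\<Sum>s) > N\<close>
  would give \<open>s \<le> A s\<close>.\<close>
lemma ex_large_decay_point:
  assumes N: "0 \<le> N"
  obtains b where "b \<in> decay_set" "\<And>i. i < n \<Longrightarrow> N \<le> b i"
proof -
  define t where "t k = ((\<lambda>s i. max (A s i) N) ^^ k) (\<lambda>_. 0)" for k
  have t_0: "t 0 i = 0" and t_Suc: "t (Suc k) i = max (A (t k) i) N" for k i
    by (simp_all add: t_def)
  have nonneg: "0 \<le> t k i" for k i using N by (cases k) (simp_all add: t_0 t_Suc)
  have inc: "t k i \<le> t (Suc k) i" if "i < n" for k i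
    using that
  proof (induction k arbitrary: i)
    case (Suc k)
    have "A (t k) i \<le> A (t (Suc k)) i" by (rule A_mono[OF nonneg Suc.IH Suc.prems])
    then show ?case unfolding t_Suc[of "Suc k"] t_Suc[of k] by (rule max.mono) simp
  qed (simp add: t_0 nonneg)
  have "\<kappa> (\<Sum>j<n. t k j) \<le> N" for k
  proof (rule ccontr)
    assume large: "\<not> \<kappa> (\<Sum>j<n. t k j) \<le> N"
    have "t k i \<le> A (t k) i" if "i < n" for i
      using inc[OF that, of k] A_ge[of "t k", OF nonneg that] large by (auto simp: t_Suc)
    then have "(\<Sum>j<n. t k j) = 0" by (intro sum.neutral ballI le_A_imp_0[of "t k"] nonneg) auto
    then show False using large N classK_0[OF classKinfD[OF \<kappa>]] by simp
  qed
  then have "(\<Sum>j<n. t k j) \<le> sinv \<kappa> N" for k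
    using le_sinv_iff[OF \<kappa>] N nonneg by (simp add: sum_nonneg)
  then obtain l where l: "\<And>i. i < n \<Longrightarrow> (\<lambda>k. t k i) \<longlonglongrightarrow> l i"
    using componentwise_incseq_convergent[of n t, OF nonneg inc] by blast
  have "l i = max (A l i) N" if i: "i < n" for i
  proof (rule LIMSEQ_unique)
    show "(\<lambda>k. t (Suc k) i) \<longlonglongrightarrow> l i" using l[OF i] by (rule LIMSEQ_Suc)
    show "(\<lambda>k. t (Suc k) i) \<longlonglongrightarrow> max (A l i) N"
      unfolding t_Suc by (intro tendsto_max tendsto_const A_LIMSEQ l nonneg i)
  qed
  then have "N \<le> l i" "A l i \<le> l i" if "i < n" for i
    using that by (metis max.cobounded1 max.cobounded2)+
  then show ?thesis using N by (intro that[of l]) (auto simp: decay_set_def intro: order_trans)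
qed

lemma decay_set_sum_le:
  assumes "s \<in> decay_set"
  shows "(\<Sum>i<n. avg s i) \<le> (\<Sum>i<n. s i)" "(\<Sum>i<n. s i) \<le> 2 * (\<Sum>i<n. avg s i)"
  unfolding sum_distrib_left using avg_le[OF assms] le_2_avg[OF assms] by (auto intro!: sum_mono)

lemma ex_orbit_entering_unit_interval:
  obtains y p where "\<And>j. y j \<in> decay_set" "\<And>j. y (Suc j) = avg (y j)" "m < p" "1/2 \<le> (\<Sum>i<n. y p i)"
    "\<And>j. p \<le> j \<Longrightarrow> (\<Sum>i<n. y j i) \<le> 1" "\<And>d. d \<le> p \<Longrightarrow> (\<Sum>i<n. y (p - d) i) \<le> 2 ^ d"
proof -
  obtain b where b: "b \<in> decay_set" "\<And>i. i < n \<Longrightarrow> 2 ^ Suc m \<le> b i"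
    using ex_large_decay_point[of "2 ^ Suc m"] by auto
  define y where "y j = (avg ^^ j) b" for j
  define S where "S j = (\<Sum>i<n. y j i)" for j
  have y_Suc: "y (Suc j) = avg (y j)" for j by (simp add: y_def)
  have y: "y j \<in> decay_set" for j
    by (induction j) (simp_all add: y_def b(1) avg_in_decay_set)
  have "decseq S" using decay_set_sum_le(1)[OF y] by (intro decseq_SucI) (simp add: S_def y_Suc)
  have S_le_Suc: "S j \<le> 2 * S (Suc j)" for j
    using decay_set_sum_le(2)[OF y] by (simp add: S_def y_Suc)
  have "(\<lambda>j. y j i) \<longlonglongrightarrow> 0" if "i < n" for i
    using avg_orbit_tendsto_0[of y i] y y_Suc that by simp
  then have "S \<longlonglongrightarrow> (\<Sum>i<n. 0)" unfolding S_def by (intro tendsto_sum) simp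
  then have S_lim: "S \<longlonglongrightarrow> 0" by simp
  have "2 ^ Suc m \<le> b 0" using b(2) dim_pos by simp
  also have "\<dots> \<le> S 0"
    unfolding S_def y_def using dim_pos decay_set_nonneg[OF b(1)] by (auto intro!: member_le_sum)
  finally obtain p where p: "m < p" "1/2 \<le> S p" "S p \<le> 1" "\<And>d. d \<le> p \<Longrightarrow> S (p - d) \<le> 2 ^ d"
    using ex_index_in_unit_interval[OF S_lim S_le_Suc] by metis
  have "S j \<le> 1" if "p \<le> j" for j using decseqD[OF \<open>decseq S\<close> that] p(3) by simp
  then show ?thesis using y y_Suc p(1,2,4) unfolding S_def by (intro that[of y p])
qed

text \<open>The orbit is indexed backwards such that its sum enters \<open>[1/2, 1]\<close> at index \<open>0\<close>.\<close>
lemma ex_normalized_orbit: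
  "\<exists>w :: int \<Rightarrow> nat \<Rightarrow> real. (\<forall>k. w k \<in> decay_set) \<and> (\<forall>k i. k < int m \<longrightarrow> w k i = avg (w (k + 1)) i) \<and>
    (\<forall>k. (\<Sum>i<n. w k i) \<le> 2 ^ nat k) \<and> 1/2 \<le> (\<Sum>i<n. w 0 i)"
proof -
  obtain y p where y: "\<And>j. y j \<in> decay_set" and y_Suc: "\<And>j. y (Suc j) = avg (y j)"
    and p: "m < p" "1/2 \<le> (\<Sum>i<n. y p i)" "\<And>j. p \<le> j \<Longrightarrow> (\<Sum>i<n. y j i) \<le> 1"
      "\<And>d. d \<le> p \<Longrightarrow> (\<Sum>i<n. y (p - d) i) \<le> 2 ^ d"
    using ex_orbit_entering_unit_interval by blast
  define w where "w k = y (nat (int p - min k (int m)))" for k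
  have "(\<Sum>i<n. w k i) \<le> 2 ^ nat k" for k
  proof (cases "0 \<le> k")
    case True
    define d where "d = min (nat k) m"
    have "nat (int p - min k (int m)) = p - d" using True by (auto simp: d_def min_def)
    then have "w k = y (p - d)" by (simp add: w_def)
    then have "(\<Sum>i<n. w k i) \<le> 2 ^ d" using p(4)[of d] p(1) by (simp add: d_def)
    also have "(2::real) ^ d \<le> 2 ^ nat k" by (intro power_increasing) (auto simp: d_def)
    finally show ?thesis .
  next
    case False
    then have "nat (int p - k) = p + nat (- k)" by linarith
    then show ?thesis using p(3)[of "p + nat (- k)"] False by (simp add: w_def)
  qed
  moreover have "w k i = avg (w (k + 1)) i" if "k < int m" for k i
  proof -
    have "nat (int p - k) = Suc (nat (int p - (k + 1)))" using that p(1) by linarith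
    then show ?thesis using that by (simp add: w_def y_Suc)
  qed
  moreover have "1/2 \<le> (\<Sum>i<n. w 0 i)" using p(2) by (simp add: w_def)
  moreover have "w k \<in> decay_set" for k using y by (simp add: w_def)
  ultimately show ?thesis by blast
qed

lemma ex_bi_infinite_orbit:
  obtains z :: "int \<Rightarrow> nat \<Rightarrow> real" where "\<And>k. z k \<in> decay_set"
    "\<And>k i. i < n \<Longrightarrow> avg (z (k + 1)) i = z k i" "0 < (\<Sum>i<n. z 0 i)"
proof -
  obtain w :: "nat \<Rightarrow> int \<Rightarrow> nat \<Rightarrow> real" where w: "\<And>m k. w m k \<in> decay_set"
    and w_avg: "\<And>m k i. k < int m \<Longrightarrow> w m k i = avg (w m (k + 1)) i"
    and w_sum: "\<And>m k. (\<Sum>i<n. w m k i) \<le> 2 ^ nat k" and w_0: "\<And>m. 1/2 \<le> (\<Sum>i<n. w m 0 i)"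
    using ex_normalized_orbit by metis
  define X where "X m p = (if snd p < n then w m (fst p) (snd p) else 0)" for m p
  have "\<bar>X m p\<bar> \<le> 2 ^ nat (fst p)" for m p
    using member_le_sum[of "snd p" "{..<n}" "w m (fst p)"] decay_set_nonneg[OF w, of _ m "fst p"]
      w_sum[of m "fst p"] by (auto simp: X_def intro: order_trans)
  then obtain r l where r: "strict_mono (r :: nat \<Rightarrow> nat)" and l: "\<And>p. (\<lambda>m. X (r m) p) \<longlonglongrightarrow> l p"
    using pointwise_bounded_imp_convergent_subsequence[of X "\<lambda>p. 2 ^ nat (fst p)"] by blast
  define z where "z k i = l (k, i)" for k i
  have z: "(\<lambda>m. w (r m) k i) \<longlonglongrightarrow> z k i" if "i < n" for k i
    using l[of "(k, i)"] that by (simp add: X_def z_def)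
  have "z k \<in> decay_set" for k using w z by (rule decay_set_limit)
  moreover have "avg (z (k + 1)) i = z k i" if i: "i < n" for k i
  proof (rule LIMSEQ_unique)
    show "(\<lambda>m. avg (w (r m) (k + 1)) i) \<longlonglongrightarrow> avg (z (k + 1)) i" using z w i by (rule avg_LIMSEQ)
    have "eventually (\<lambda>m. nat k < r m) sequentially"
      using eventually_gt_at_top filterlim_subseq[OF r] by (rule eventually_compose_filterlim)
    then have "eventually (\<lambda>m. w (r m) k i = avg (w (r m) (k + 1)) i) sequentially"
      by eventually_elim (rule w_avg, linarith)
    then show "(\<lambda>m. avg (w (r m) (k + 1)) i) \<longlonglongrightarrow> z k i" by (rule Lim_transform_eventually[OF z[OF i]])
  qed
  moreover have "(\<lambda>m. \<Sum>i<n. w (r m) 0 i) \<longlonglongrightarrow> (\<Sum>i<n. z 0 i)" by (intro tendsto_sum z) simp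
  then have "1/2 \<le> (\<Sum>i<n. z 0 i)" by (rule LIMSEQ_le_const) (use w_0 in blast)
  ultimately show ?thesis by (intro that[of z]) auto
qed

end

locale decay_orbit = small_gain_operator +
  fixes z :: "int \<Rightarrow> nat \<Rightarrow> real"
  assumes z_decay: "z k \<in> decay_set" and z_avg: "i < n \<Longrightarrow> avg (z (k + 1)) i = z k i"
    and z_0: "0 < (\<Sum>i<n. z 0 i)"
begin

lemma z_mono: "i < n \<Longrightarrow> z k i \<le> z (k + 1) i"
  using avg_le[OF z_decay, of i "k + 1"] z_avg[of i k] by simp

lemma sum_z_pos: "0 < (\<Sum>i<n. z k i)"
proof (induction k rule: int_induct[of _ 0])
  case (step1 k)
  have "(\<Sum>i<n. z k i) \<le> (\<Sum>i<n. z (k + 1) i)" by (intro sum_mono z_mono) simp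
  then show ?case using step1 by simp
next
  case (step2 k)
  have "(\<Sum>i<n. avg (z k) i) = (\<Sum>i<n. z (k - 1) i)"
    using z_avg[of _ "k - 1"] by (intro sum.cong) auto
  then show ?case using step2 decay_set_sum_le(2)[OF z_decay, of k] by simp
qed (rule z_0)

lemma z_ge: "i < n \<Longrightarrow> \<kappa> (\<Sum>j<n. z k j) \<le> z k i"
  using A_ge[of "z k" i] decay_set_nonneg[OF z_decay] A_le[OF z_decay, of i k] by fastforce

lemma z_pos: "i < n \<Longrightarrow> 0 < z k i"
  using z_ge[of i k] classK_pos[OF classKinfD[OF \<kappa>] sum_z_pos[of k]] by linarith

lemma z_tendsto_0:
  assumes i: "i < n" shows "(\<lambda>k. z (- int k) i) \<longlonglongrightarrow> 0"
proof (rule avg_orbit_tendsto_0[OF z_decay _ i])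
  show "z (- int (Suc k)) j = avg (z (- int k)) j" if "j < n" for k j
    using z_avg[OF that, of "- int (Suc k)"] by simp
qed

lemma z_at_top:
  assumes i: "i < n" shows "filterlim (\<lambda>k. z (int k) i) at_top sequentially"
  unfolding filterlim_at_top
proof
  fix B
  obtain R where R: "\<And>x. R \<le> x \<Longrightarrow> B < \<kappa> x" using classKinf_exceeds[OF \<kappa>] by blast
  have "avg (z (int (Suc k))) j = z (int k) j" if "j < n" for k j
    using z_avg[OF that, of "int k"] by (simp add: add.commute)
  then obtain k where "R < (\<Sum>j<n. z (int k) j)"
    using ascending_orbit_unbounded[of "\<lambda>k. z (int k)" R] z_decay z_0 by auto
  then have k: "B \<le> z (int k) i" using R[of "\<Sum>j<n. z (int k) j"] z_ge[OF i, of "int k"] by simp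
  have "incseq (\<lambda>k. z (int k) i)"
    using z_mono[OF i, of "int _"] by (intro incseq_SucI) (simp add: add.commute)
  then show "eventually (\<lambda>k. B \<le> z (int k) i) sequentially"
    using k unfolding eventually_sequentially incseq_def by (meson order_trans)
qed

text \<open>Equality \<open>A (z k) i = z k i\<close> would persist for all larger \<open>k\<close> and make \<open>z k i\<close> constant.\<close>
lemma A_z_less:
  assumes i: "i < n" shows "A (z k) i < z k i"
proof (rule ccontr)
  assume "\<not> A (z k) i < z k i"
  then have eq: "A (z k) i = z k i" using A_le[OF z_decay i, of k] by simp
  have const: "A (z (k + int m)) i = z (k + int m) i \<and> z (k + int m) i = z k i" for m
  proof (induction m)
    case (Suc m)
    let ?k = "k + int m"
    have "A (z ?k) i \<le> A (z (?k + 1)) i" by (rule A_mono[OF decay_set_nonneg[OF z_decay] z_mono i])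
    then show ?case
      using Suc A_le[OF z_decay i, of "?k + 1"] z_avg[OF i, of ?k] by (simp add: avg_def ac_simps)
  qed (simp add: eq)
  have "eventually (\<lambda>m. z k i < z (int m) i) sequentially"
    using z_at_top[OF i] by (simp add: filterlim_at_top_dense)
  then obtain M where M: "\<And>m. M \<le> m \<Longrightarrow> z k i < z (int m) i"
    unfolding eventually_sequentially by blast
  define m where "m = max M (nat k)"
  have "nat k \<le> m" by (simp add: m_def)
  then have "k + int (nat (int m - k)) = int m" by linarith
  with const have "z (int m) i = z k i" by metis
  then show False using M[of m] by (simp add: m_def)
qed

lemma z_less: "i < n \<Longrightarrow> z k i < z (k + 1) i"
  and A_z_Suc_less: "i < n \<Longrightarrow> A (z (k + 1)) i < z k i"
  using A_z_less[of i "k + 1"] z_avg[of i k] by (simp_all add: avg_def)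

end

section \<open>Paths\<close>

lemma classKI_pos:
  assumes "g 0 = 0" and pos: "\<And>x. 0 < x \<Longrightarrow> 0 < g x" and less: "\<And>x y. 0 < x \<Longrightarrow> x < y \<Longrightarrow> g x < g y"
    and cont: "continuous_on {0<..} g" and small: "\<And>e. 0 < e \<Longrightarrow> \<exists>d>0. g d < e"
  shows "classK g"
proof (rule classKI)
  have "continuous (at x within {0..}) g" if "0 \<le> x" for x
  proof (cases "x = 0")
    case True
    have "\<exists>d>0. \<forall>y\<in>{0..}. dist y 0 < d \<longrightarrow> dist (g y) (g 0) < e" if e: "0 < e" for e
    proof -
      obtain d where "0 < d" "g d < e" using small[OF e] by blast
      then have "\<bar>g y\<bar> < e" if "0 \<le> y" "y < d" for y
        using that pos[of y] less[of y d] \<open>0 < e\<close> assms(1) by (cases "y = 0") auto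
      then show ?thesis using \<open>0 < d\<close> assms(1) by (intro exI[of _ d]) (simp add: dist_real_def)
    qed
    then show ?thesis using True by (simp add: continuous_within_eps_delta)
  next
    case False
    then have "isCont g x" using cont that by (simp add: continuous_on_eq_continuous_at)
    then show ?thesis by (rule continuous_at_imp_continuous_at_within)
  qed
  then show "continuous_on {0..} g" by (simp add: continuous_on_eq_continuous_within)
  show "g x < g y" if "0 \<le> x" "x < y" for x y
    using that less[of x y] pos[of y] assms(1) by (cases "x = 0") auto
qed (rule assms(1))

definition slopes_between :: "real \<Rightarrow> real \<Rightarrow> real set \<Rightarrow> (real \<Rightarrow> real) \<Rightarrow> bool" where
  "slopes_between m M S g \<longleftrightarrow>
     (\<forall>x\<in>S. \<forall>y\<in>S. x \<le> y \<longrightarrow> m * (y - x) \<le> g y - g x \<and> g y - g x \<le> M * (y - x))"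

lemma slopes_betweenI:
  assumes "\<And>x y. x \<in> S \<Longrightarrow> y \<in> S \<Longrightarrow> x \<le> y \<Longrightarrow> m * (y - x) \<le> g y - g x"
    "\<And>x y. x \<in> S \<Longrightarrow> y \<in> S \<Longrightarrow> x \<le> y \<Longrightarrow> g y - g x \<le> M * (y - x)"
  shows "slopes_between m M S g"
  using assms by (simp add: slopes_between_def)

lemma slopes_betweenD:
  assumes "slopes_between m M S g" "x \<in> S" "y \<in> S" "x \<le> y"
  shows "m * (y - x) \<le> g y - g x" "g y - g x \<le> M * (y - x)"
  using assms by (auto simp: slopes_between_def)

lemma slopes_between_imp_lipschitz_on:
  assumes "slopes_between m M S g" "0 \<le> m" "0 \<le> M" shows "M-lipschitz_on S g"
proof (rule lipschitz_on_leI)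
  fix x y assume xy: "x \<in> S" "y \<in> S" "x \<le> y"
  then have "0 \<le> m * (y - x)" using assms(2) by simp
  then show "dist (g x) (g y) \<le> M * dist x y"
    using slopes_betweenD[OF assms(1) xy] xy(3) by (simp add: dist_real_def)
qed (rule assms(3))

definition loc_bilip :: "(real \<Rightarrow> real) \<Rightarrow> bool" where
  "loc_bilip g \<longleftrightarrow> (\<forall>a b. 0 < a \<longrightarrow> a \<le> b \<longrightarrow> (\<exists>m M. 0 < m \<and> 0 < M \<and> slopes_between m M {a..b} g))"

lemma loc_bilipE:
  assumes "loc_bilip g" "0 < a" "a \<le> b"
  obtains m M where "0 < m" "0 < M" "slopes_between m M {a..b} g"
  using assms unfolding loc_bilip_def by blast

lemma loc_bilip_less:
  assumes "loc_bilip g" "0 < x" "x < y" shows "g x < g y"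
proof -
  obtain m M where "0 < m" and slopes: "slopes_between m M {x..y} g"
    by (rule loc_bilipE[OF assms(1,2), of y]) (use assms(3) in auto)
  have "0 < m * (y - x)" using \<open>0 < m\<close> assms(3) by simp
  also have "\<dots> \<le> g y - g x" using slopes assms(3) by (intro slopes_betweenD) auto
  finally show ?thesis by simp
qed

lemma loc_bilip_sinv:
  assumes g: "classKinf g" "loc_bilip g"
  shows "loc_bilip (sinv g)"
  unfolding loc_bilip_def
proof (intro allI impI)
  fix a b :: real assume ab: "0 < a" "a \<le> b"
  note sinvK = classKinfD[OF classKinf_sinv[OF g(1)]]
  have "0 < sinv g a" "sinv g a \<le> sinv g b"
    using classK_pos[OF sinvK ab(1)] classK_mono[OF sinvK _ ab(2)] ab by auto
  then obtain m M where m: "0 < m" "0 < M" and slopes: "slopes_between m M {sinv g a..sinv g b} g"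
    by (rule loc_bilipE[OF g(2)])
  have "m * (sinv g y - sinv g x) \<le> y - x" "y - x \<le> M * (sinv g y - sinv g x)"
    if "x \<in> {a..b}" "y \<in> {a..b}" "x \<le> y" for x y
    using slopes_betweenD[OF slopes, of "sinv g x" "sinv g y"] that ab
    by (auto simp: apply_sinv[OF g(1)] classK_le_iff[OF sinvK])
  then have "slopes_between (inverse M) (inverse m) {a..b} (sinv g)"
    using m by (intro slopes_betweenI) (auto simp: divide_inverse[symmetric] field_simps)
  then show "\<exists>m M. 0 < m \<and> 0 < M \<and> slopes_between m M {a..b} (sinv g)"
    using m by (intro exI[of _ "inverse M"] exI[of _ "inverse m"]) auto
qed

lemma loc_bilip_imp_loc_lipschitz_on:
  assumes "loc_bilip g" shows "loc_lipschitz_on {0<..} g"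
  unfolding loc_lipschitz_on_def
proof
  fix x :: real assume x: "x \<in> {0<..}"
  then obtain m M where "0 < m" "0 < M" "slopes_between m M {x/2..2*x} g"
    using loc_bilipE[OF assms, of "x/2" "2*x"] by auto
  then have "M-lipschitz_on {x/2..2*x} g" by (intro slopes_between_imp_lipschitz_on) auto
  moreover have "cball x (x/2) \<inter> {0<..} \<subseteq> {x/2..2*x}"
  proof
    fix y assume "y \<in> cball x (x/2) \<inter> {0<..}"
    then have "\<bar>x - y\<bar> \<le> x/2" by (simp only: Int_iff mem_cball dist_real_def)
    then have "x/2 \<le> y" "y \<le> 2*x" using x unfolding greaterThan_iff by linarith+
    then show "y \<in> {x/2..2*x}" by simp
  qed
  ultimately have "M-lipschitz_on (cball x (x/2) \<inter> {0<..}) g" by (rule lipschitz_on_subset)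
  then show "\<exists>r>0. \<exists>L. L-lipschitz_on (cball x r \<inter> {0<..}) g"
    using x by (intro exI[of _ "x/2"]) auto
qed

lemma loc_lipschitz_on_imp_continuous_on:
  assumes "loc_lipschitz_on S g" shows "continuous_on S g"
  unfolding continuous_on_eq_continuous_within
proof
  fix x assume x: "x \<in> S"
  then obtain r L where r: "r > 0" "L-lipschitz_on (cball x r \<inter> S) g"
    using assms unfolding loc_lipschitz_on_def by blast
  then have "continuous (at x within cball x r \<inter> S) g"
    using x by (intro lipschitz_on_continuous_within[OF r(2)]) auto
  moreover have "at x within cball x r \<inter> S = at x within S"
    using r(1) by (intro at_within_nhd[of x "ball x r"]) auto
  ultimately show "continuous (at x within S) g" by simp
qed

lemma slopes_between_imp_deriv_between:
  assumes slopes: "slopes_between m M {a..b} g" and r: "a \<le> r" "r < b"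
    and d: "(g has_real_derivative d) (at r)"
  shows "m \<le> d \<and> d \<le> M"
proof
  have lim: "((\<lambda>h. (g (r + h) - g r) / h) \<longlongrightarrow> d) (at_right 0)"
    using d unfolding DERIV_def by (rule tendsto_mono[rotated]) (simp add: at_le)
  have "m * h \<le> g (r + h) - g r \<and> g (r + h) - g r \<le> M * h" if "0 < h" "h < b - r" for h
    using slopes_betweenD[OF slopes, of r "r + h"] r that by simp
  then have bounds: "eventually (\<lambda>h. m \<le> (g (r + h) - g r) / h \<and> (g (r + h) - g r) / h \<le> M) (at_right 0)"
    unfolding eventually_at_right_field
      using r by (intro exI[of _ "b - r"]) (auto simp: field_simps)
  show "m \<le> d" by (rule tendsto_lowerbound[OF lim eventually_mono[OF bounds]]) auto
  show "d \<le> M" by (rule tendsto_upperbound[OF lim eventually_mono[OF bounds]]) auto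
qed

lemma loc_bilip_deriv_bounds:
  assumes g: "loc_bilip g" and P: "compact P" "P \<subseteq> {0<..}"
  obtains c C where "0 < c" "c \<le> C"
    "\<And>r d. r \<in> P \<Longrightarrow> (g has_real_derivative d) (at r) \<Longrightarrow> c \<le> d \<and> d \<le> C"
proof (cases "P = {}")
  case False
  then obtain p q where pq: "p \<in> P" "q \<in> P" "\<And>x. x \<in> P \<Longrightarrow> p \<le> x \<and> x \<le> q"
    using compact_attains_inf[OF P(1)] compact_attains_sup[OF P(1)] by metis
  have "0 < p" "p \<le> q + 1" using pq(1) pq(3)[OF pq(2)] P(2) by auto
  then obtain m M where m: "0 < m" and slopes: "slopes_between m M {p..q + 1} g"
    by (rule loc_bilipE[OF g])
  have "m \<le> d \<and> d \<le> M" if "r \<in> P" "(g has_real_derivative d) (at r)" for r d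
    by (rule slopes_between_imp_deriv_between[OF slopes _ _ that(2)]) (use pq(3)[OF that(1)] in auto)
  then have "m \<le> d \<and> d \<le> max m M" if "r \<in> P" "(g has_real_derivative d) (at r)" for r d
    using that by (auto simp: le_max_iff_disj)
  then show ?thesis using m by (intro that[of m "max m M"]) auto
qed (rule that[of 1 1], auto)

lemma finite_loc_bilip_deriv_bounds:
  assumes "finite A" "\<And>i. i \<in> A \<Longrightarrow> loc_bilip (g i)" "compact P" "P \<subseteq> {0<..}"
  shows "\<exists>c C. 0 < c \<and> c \<le> C \<and>
    (\<forall>i\<in>A. \<forall>r\<in>P. \<forall>d. (g i has_real_derivative d) (at r) \<longrightarrow> c \<le> d \<and> d \<le> C)"
  using assms(1,2)
proof (induction A rule: finite_induct)
  case empty then show ?case by (intro exI[of _ 1]) auto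
next
  case (insert i A)
  then obtain c C where cC: "0 < c" "c \<le> C"
    "\<And>j r d. j \<in> A \<Longrightarrow> r \<in> P \<Longrightarrow> (g j has_real_derivative d) (at r) \<Longrightarrow> c \<le> d \<and> d \<le> C" by auto
  obtain m M where mM: "0 < m" "m \<le> M"
    "\<And>r d. r \<in> P \<Longrightarrow> (g i has_real_derivative d) (at r) \<Longrightarrow> m \<le> d \<and> d \<le> M"
    using loc_bilip_deriv_bounds[OF insert.prems assms(3,4), of i] by auto
  show ?case
  proof (intro exI conjI ballI allI impI)
    fix j r d assume j: "j \<in> insert i A" and r: "r \<in> P" and d: "(g j has_real_derivative d) (at r)"
    show "min c m \<le> d" "d \<le> max C M"
      using j mM(3)[OF r] cC(3)[OF _ r d] d by (auto simp: min_le_iff_disj le_max_iff_disj)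
  qed (use cC mM in auto)
qed

definition lin_interp :: "(int \<Rightarrow> real) \<Rightarrow> real \<Rightarrow> real" where
  "lin_interp a x = a \<lfloor>x\<rfloor> + (x - \<lfloor>x\<rfloor>) * (a (\<lfloor>x\<rfloor> + 1) - a \<lfloor>x\<rfloor>)"

lemma lin_interp_eq:
  assumes "of_int k \<le> x" "x \<le> of_int k + 1"
  shows "lin_interp a x = a k + (x - of_int k) * (a (k + 1) - a k)"
proof (cases "x = of_int k + 1")
  case True
  then have "\<lfloor>x\<rfloor> = k + 1" by linarith
  then show ?thesis using True by (simp add: lin_interp_def)
next
  case False
  then have "\<lfloor>x\<rfloor> = k" using assms by (intro floor_unique) auto
  then show ?thesis by (simp add: lin_interp_def)
qed

lemma slopes_between_concat:
  assumes "slopes_between m M {a..b} g" "slopes_between m M {b..c} g"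
  shows "slopes_between m M {a..c} g"
proof -
  have "m * (y - x) \<le> g y - g x \<and> g y - g x \<le> M * (y - x)"
    if xy: "x \<in> {a..c}" "y \<in> {a..c}" "x \<le> y" for x y
  proof -
    consider "y \<le> b" | "b \<le> x" | "x < b" "b < y" by linarith
    then show ?thesis
    proof cases
      case 1
      then show ?thesis using slopes_betweenD[OF assms(1), of x y] xy by simp
    next
      case 2
      then show ?thesis using slopes_betweenD[OF assms(2), of x y] xy by simp
    next
      case 3
      then have "m * (b - x) \<le> g b - g x" "g b - g x \<le> M * (b - x)"
        "m * (y - b) \<le> g y - g b" "g y - g b \<le> M * (y - b)"
        using slopes_betweenD[OF assms(1), of x b] slopes_betweenD[OF assms(2), of b y] xy by auto
      moreover have "c * (y - x) = c * (y - b) + c * (b - x)" for c by (simp add: algebra_simps)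
      ultimately show ?thesis by (intro conjI) (smt (verit))+
    qed
  qed
  then show ?thesis by (intro slopes_betweenI) auto
qed

lemma slopes_between_lin_interp:
  assumes "p \<le> q" "\<And>k. p \<le> k \<Longrightarrow> k < q \<Longrightarrow> m \<le> a (k + 1) - a k \<and> a (k + 1) - a k \<le> M"
  shows "slopes_between m M {of_int p..of_int q} (lin_interp a)"
  using assms
proof (induction q rule: int_ge_induct)
  case base
  then show ?case by (auto simp: slopes_between_def)
next
  case (step q)
  have "lin_interp a y - lin_interp a x = (a (q + 1) - a q) * (y - x)"
    if "x \<in> {of_int q..of_int q + 1}" "y \<in> {of_int q..of_int q + 1}" for x y
    using that by (simp add: lin_interp_eq[of q] algebra_simps)
  then have last: "slopes_between m M {of_int q..of_int (q + 1)} (lin_interp a)"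
    using step.prems[of q] step.hyps by (intro slopes_betweenI) (auto intro!: mult_right_mono)
  have "slopes_between m M {of_int p..of_int q} (lin_interp a)"
    using step.prems by (intro step.IH) auto
  then show ?case using last by (rule slopes_between_concat)
qed

lemma log2_diff_bounds:
  assumes "0 < a" "a \<le> x" "x \<le> y" "y \<le> b"
  shows "(y - x) / (b * ln 2) \<le> log 2 y - log 2 x" "log 2 y - log 2 x \<le> (y - x) / (a * ln 2)"
proof -
  have "ln (y / x) \<le> y / x - 1" "ln (x / y) \<le> x / y - 1"
    using assms by (auto intro!: ln_le_minus_one)
  then have "ln y - ln x \<le> (y - x) / x" "(y - x) / y \<le> ln y - ln x"
    using assms by (auto simp: ln_div field_simps)
  moreover have "(y - x) / x \<le> (y - x) / a" "(y - x) / b \<le> (y - x) / y"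
    using assms by (auto intro!: divide_left_mono)
  ultimately have upper: "ln y - ln x \<le> (y - x) / a" and lower: "(y - x) / b \<le> ln y - ln x"
    by linarith+
  have ln2: "0 \<le> ln (2::real)" by simp
  show "(y - x) / (b * ln 2) \<le> log 2 y - log 2 x"
    using divide_right_mono[OF lower ln2]
    by (simp only: log_def diff_divide_distrib[symmetric] divide_divide_eq_left)
  show "log 2 y - log 2 x \<le> (y - x) / (a * ln 2)"
    using divide_right_mono[OF upper ln2]
    by (simp only: log_def diff_divide_distrib[symmetric] divide_divide_eq_left)
qed

definition dyadic_interp :: "(int \<Rightarrow> real) \<Rightarrow> real \<Rightarrow> real" where
  "dyadic_interp a r = (if 0 < r then lin_interp a (log 2 r) else 0)"

lemma loc_bilip_dyadic_interp:
  assumes inc: "\<And>k. a k < a (k + 1)"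
  shows "loc_bilip (dyadic_interp a)"
  unfolding loc_bilip_def
proof (intro allI impI)
  fix u v :: real assume uv: "0 < u" "u \<le> v"
  define p q where "p = \<lfloor>log 2 u\<rfloor>" and "q = \<lfloor>log 2 v\<rfloor> + 1"
  have "log 2 u \<le> log 2 v" using uv by simp
  then have pq: "p < q" unfolding p_def q_def by linarith
  define steps where "steps = (\<lambda>k. a (k + 1) - a k) ` {p..<q}"
  define m M where "m = Min steps" and "M = Max steps"
  have steps: "finite steps" "steps \<noteq> {}" using pq by (auto simp: steps_def)
  have step: "m \<le> a (k + 1) - a k \<and> a (k + 1) - a k \<le> M" if "p \<le> k" "k < q" for k
    unfolding m_def M_def using that steps(1) by (auto intro!: Min_le Max_ge simp: steps_def)
  have m: "0 < m" unfolding m_def using steps inc by (auto simp: steps_def)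
  then have M: "0 < M" using step[of p] pq by linarith
  have slopes: "slopes_between m M {of_int p..of_int q} (lin_interp a)"
    using pq step by (intro slopes_between_lin_interp) auto
  have "slopes_between (m / (v * ln 2)) (M / (u * ln 2)) {u..v} (dyadic_interp a)"
  proof -
    have "m / (v * ln 2) * (y - x) \<le> dyadic_interp a y - dyadic_interp a x \<and>
        dyadic_interp a y - dyadic_interp a x \<le> M / (u * ln 2) * (y - x)"
      if xy: "u \<le> x" "x \<le> y" "y \<le> v" for x y
    proof -
      have "log 2 u \<le> log 2 x" "log 2 x \<le> log 2 y" "log 2 y \<le> log 2 v" using xy uv by auto
      then have "of_int p \<le> log 2 x" "log 2 x \<le> log 2 y" "log 2 y \<le> of_int q"
        unfolding p_def q_def by linarith+
      then have "m * (log 2 y - log 2 x) \<le> dyadic_interp a y - dyadic_interp a x"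
        "dyadic_interp a y - dyadic_interp a x \<le> M * (log 2 y - log 2 x)"
        using slopes_betweenD[OF slopes, of "log 2 x" "log 2 y"] xy uv
          by (auto simp: dyadic_interp_def)
      moreover have "m * ((y - x) / (v * ln 2)) \<le> m * (log 2 y - log 2 x)"
        "M * (log 2 y - log 2 x) \<le> M * ((y - x) / (u * ln 2))"
        using mult_left_mono[OF log2_diff_bounds(1)[OF uv(1) xy], of m]
          mult_left_mono[OF log2_diff_bounds(2)[OF uv(1) xy], of M] m M by auto
      ultimately show ?thesis by simp
    qed
    then show ?thesis by (intro slopes_betweenI) auto
  qed
  then show "\<exists>m M. 0 < m \<and> 0 < M \<and> slopes_between m M {u..v} (dyadic_interp a)"
    using m M uv by (intro exI[of _ "m / (v * ln 2)"] exI[of _ "M / (u * ln 2)"]) auto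
qed

lemma dyadic_interp_between:
  assumes inc: "\<And>k. a k < a (k + 1)" and r: "0 < r" and k: "k = \<lfloor>log 2 r\<rfloor>"
  shows "a k \<le> dyadic_interp a r" "dyadic_interp a r \<le> a (k + 1)"
proof -
  define t where "t = log 2 r - of_int k"
  have t: "0 \<le> t" "t \<le> 1" unfolding t_def k by linarith+
  have e: "dyadic_interp a r = a k + t * (a (k + 1) - a k)"
    using r by (simp add: dyadic_interp_def lin_interp_def k t_def)
  have d: "0 \<le> a (k + 1) - a k" using inc[of k] by simp
  show "a k \<le> dyadic_interp a r" unfolding e using t d by simp
  have "t * (a (k + 1) - a k) \<le> 1 * (a (k + 1) - a k)" using t d by (intro mult_right_mono) auto
  then show "dyadic_interp a r \<le> a (k + 1)" unfolding e by simp
qed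

lemma dyadic_interp_powr: "dyadic_interp a (2 powr of_int k) = a k"
  by (simp add: dyadic_interp_def lin_interp_eq[of k])

lemma classKinf_dyadic_interp:
  assumes pos: "\<And>k. 0 < a k" and inc: "\<And>k. a k < a (k + 1)"
    and up: "filterlim (\<lambda>k. a (int k)) at_top sequentially" and down: "(\<lambda>k. a (- int k)) \<longlonglongrightarrow> 0"
  shows "classKinf (dyadic_interp a)"
proof (rule classKinfI, rule classKI_pos)
  have bilip: "loc_bilip (dyadic_interp a)" using inc by (rule loc_bilip_dyadic_interp)
  show "dyadic_interp a 0 = 0" by (simp add: dyadic_interp_def)
  show "0 < dyadic_interp a x" if "0 < x" for x
    using dyadic_interp_between(1)[of a, OF inc that refl] pos[of "\<lfloor>log 2 x\<rfloor>"] by linarith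
  show "dyadic_interp a x < dyadic_interp a y" if "0 < x" "x < y" for x y
    using bilip that by (rule loc_bilip_less)
  show "continuous_on {0<..} (dyadic_interp a)"
    by (intro loc_lipschitz_on_imp_continuous_on loc_bilip_imp_loc_lipschitz_on bilip)
  show "\<exists>d>0. dyadic_interp a d < e" if "0 < e" for e
  proof -
    have "eventually (\<lambda>k. a (- int k) < e) sequentially" using down that by (rule order_tendstoD)
    then obtain k where "a (- int k) < e" unfolding eventually_sequentially by blast
    then show ?thesis
      using dyadic_interp_powr[of a "- int k"] by (intro exI[of _ "2 powr of_int (- int k)"]) auto
  qed
  show "\<exists>x\<ge>0. M \<le> dyadic_interp a x" for M
  proof -
    have "eventually (\<lambda>k. M \<le> a (int k)) sequentially" using up by (simp add: filterlim_at_top)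
    then obtain k where "M \<le> a (int k)" unfolding eventually_sequentially by blast
    then show ?thesis
      using dyadic_interp_powr[of a "int k"] by (intro exI[of _ "2 powr of_int (int k)"]) auto
  qed
qed

lemma omega_pathI:
  assumes \<sigma>: "\<And>i. i < n \<Longrightarrow> classKinf (\<sigma> i)" "\<And>i. i < n \<Longrightarrow> loc_bilip (\<sigma> i)"
    and less: "\<And>r i. 0 < r \<Longrightarrow> i < n \<Longrightarrow> Gam n Isum \<gamma> (\<lambda>j. \<sigma> j r) i < \<sigma> i r"
  shows "omega_path n Isum \<gamma> \<sigma>"
  unfolding omega_path_def
proof (intro conjI allI impI)
  have bilip: "loc_bilip (sinv (\<sigma> i))" if "i < n" for i using \<sigma>[OF that] by (rule loc_bilip_sinv)
  show "loc_lipschitz_on {0<..} (sinv (\<sigma> i))" if "i < n" for i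
    using bilip[OF that] by (rule loc_bilip_imp_loc_lipschitz_on)
  show "\<exists>c C. 0 < c \<and> c \<le> C \<and>
      (\<forall>i<n. \<forall>r\<in>P. \<forall>d. (sinv (\<sigma> i) has_real_derivative d) (at r) \<longrightarrow> c \<le> d \<and> d \<le> C)"
    if "compact P \<and> P \<subseteq> {0<..}" for P
    using finite_loc_bilip_deriv_bounds[of "{..<n}" "\<lambda>i. sinv (\<sigma> i)" P] bilip that
    by (simp only: Ball_def lessThan_iff finite_lessThan)
qed (use \<sigma>(1) less in auto)

context small_gain
begin

lemma small_gain_operatorI:
  assumes \<kappa>: "classKinf \<kappa>" and margin: "\<And>s i. s \<in> below (\<kappa> (\<Sum>j<n. s j)) \<Longrightarrow> i < n \<Longrightarrow> s i = 0"
  shows "small_gain_operator n (\<lambda>s. G s (\<kappa> (\<Sum>j<n. s j))) \<kappa>"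
proof
  fix s t :: "nat \<Rightarrow> real" and i
  assume s: "\<And>j. j < n \<Longrightarrow> 0 \<le> s j" and i: "i < n"
  have sum_s: "0 \<le> (\<Sum>j<n. s j)" by (intro sum_nonneg s) simp
  show "\<kappa> (\<Sum>j<n. s j) \<le> G s (\<kappa> (\<Sum>j<n. s j)) i" by (rule G_ge[OF i s])
  show "G s (\<kappa> (\<Sum>j<n. s j)) i \<le> G t (\<kappa> (\<Sum>j<n. t j)) i" if st: "\<And>j. j < n \<Longrightarrow> s j \<le> t j"
  proof -
    have "(\<Sum>j<n. s j) \<le> (\<Sum>j<n. t j)" by (intro sum_mono st) simp
    then have "\<kappa> (\<Sum>j<n. s j) \<le> \<kappa> (\<Sum>j<n. t j)" by (rule classK_mono[OF classKinfD[OF \<kappa>] sum_s])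
    then show ?thesis by (intro G_mono i s st)
  qed
  show "s i = 0" if "\<And>j. j < n \<Longrightarrow> s j \<le> G s (\<kappa> (\<Sum>j<n. s j)) j"
    using s that by (intro margin i) (simp add: below_def)
next
  fix X :: "nat \<Rightarrow> nat \<Rightarrow> real" and t i
  assume X: "\<And>j. j < n \<Longrightarrow> (\<lambda>k. X k j) \<longlonglongrightarrow> t j" "\<And>k j. j < n \<Longrightarrow> 0 \<le> X k j" and i: "i < n"
  have sum_X: "0 \<le> (\<Sum>j<n. X k j)" for k by (intro sum_nonneg X) simp
  have lim: "(\<lambda>k. \<Sum>j<n. X k j) \<longlonglongrightarrow> (\<Sum>j<n. t j)" by (intro tendsto_sum X) simp
  have "0 \<le> (\<Sum>j<n. t j)" using LIMSEQ_le_const[OF lim] sum_X by blast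
  then have "(\<lambda>k. \<kappa> (\<Sum>j<n. X k j)) \<longlonglongrightarrow> \<kappa> (\<Sum>j<n. t j)"
    using sum_X by (intro classK_tendsto[OF classKinfD[OF \<kappa>] lim]) auto
  then show "(\<lambda>k. G (X k) (\<kappa> (\<Sum>j<n. X k j)) i) \<longlonglongrightarrow> G t (\<kappa> (\<Sum>j<n. t j)) i"
    using i X by (intro G_tendsto) auto
qed (rule n_pos, rule \<kappa>)

lemma ex_path:
  obtains \<sigma> \<xi> where "\<And>i. i < n \<Longrightarrow> classKinf (\<sigma> i)" "\<And>i. i < n \<Longrightarrow> loc_bilip (\<sigma> i)" "classKinf \<xi>"
    "\<And>r i. 0 < r \<Longrightarrow> i < n \<Longrightarrow> G (\<lambda>j. \<sigma> j r) (\<xi> r) i < \<sigma> i r"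
proof -
  obtain \<kappa> where \<kappa>: "classKinf \<kappa>" "\<And>s i. s \<in> below (\<kappa> (\<Sum>j<n. s j)) \<Longrightarrow> i < n \<Longrightarrow> s i = 0"
    using ex_robustness_margin by blast
  define A where "A s = G s (\<kappa> (\<Sum>j<n. s j))" for s
  interpret A: small_gain_operator n A \<kappa>
    unfolding A_def using \<kappa> by (rule small_gain_operatorI)
  obtain z :: "int \<Rightarrow> nat \<Rightarrow> real"
    where z: "\<And>k. z k \<in> A.decay_set" "\<And>k i. i < n \<Longrightarrow> A.avg (z (k + 1)) i = z k i" "0 < (\<Sum>i<n. z 0 i)"
    using A.ex_bi_infinite_orbit by blast
  interpret z: decay_orbit n A \<kappa> z by unfold_locales (use z in auto)
  define \<sigma> where "\<sigma> i = dyadic_interp (\<lambda>k. z k i)" for i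
  define \<xi> where "\<xi> r = \<kappa> (\<Sum>j<n. \<sigma> j r)" for r
  have \<sigma>: "classKinf (\<sigma> i)" if "i < n" for i
    unfolding \<sigma>_def
      using z.z_pos z.z_less z.z_at_top z.z_tendsto_0 that by (intro classKinf_dyadic_interp)
  have "G (\<lambda>j. \<sigma> j r) (\<xi> r) i < \<sigma> i r" if r: "0 < r" and i: "i < n" for r i
  proof -
    define k where "k = \<lfloor>log 2 r\<rfloor>"
    have between: "z k j \<le> \<sigma> j r" "\<sigma> j r \<le> z (k + 1) j" if "j < n" for j
      unfolding \<sigma>_def
        using dyadic_interp_between[of "\<lambda>k. z k j", OF z.z_less[OF that] r k_def] by auto
    have "G (\<lambda>j. \<sigma> j r) (\<xi> r) i = A (\<lambda>j. \<sigma> j r) i" by (simp add: A_def \<xi>_def)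
    also have "\<dots> \<le> A (z (k + 1)) i"
      using classK_nonneg[OF classKinfD[OF \<sigma>]] r i between(2) by (intro A.A_mono) auto
    also have "\<dots> < z k i" by (rule z.A_z_Suc_less[OF i])
    also have "\<dots> \<le> \<sigma> i r" by (rule between(1)[OF i])
    finally show ?thesis .
  qed
  moreover have "classKinf \<xi>"
    unfolding \<xi>_def by (rule classKinf_compose[OF \<kappa>(1) classKinf_sum]) (use \<sigma> n_pos in auto)
  moreover have "loc_bilip (\<sigma> i)" if "i < n" for i
    unfolding \<sigma>_def using z.z_less[OF that] by (rule loc_bilip_dyadic_interp)
  ultimately show ?thesis using \<sigma> by (intro that)
qed

lemma ex_path_with_inputs:
  assumes \<gamma>u: "\<And>i. i < n \<Longrightarrow> classK (\<gamma>u i)"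
  obtains \<sigma> \<phi> where "\<And>i. i < n \<Longrightarrow> classKinf (\<sigma> i)" "\<And>i. i < n \<Longrightarrow> loc_bilip (\<sigma> i)" "classKinf \<phi>"
    "\<And>r i. 0 < r \<Longrightarrow> i < n \<Longrightarrow> Gambar n Isum \<gamma> \<gamma>u (\<lambda>j. \<sigma> j r) (\<phi> r) i < \<sigma> i r"
proof -
  obtain \<sigma> \<xi> where \<sigma>: "\<And>i. i < n \<Longrightarrow> classKinf (\<sigma> i)" "\<And>i. i < n \<Longrightarrow> loc_bilip (\<sigma> i)"
    and \<xi>: "classKinf \<xi>"
    and path: "\<And>r i. 0 < r \<Longrightarrow> i < n \<Longrightarrow> G (\<lambda>j. \<sigma> j r) (\<xi> r) i < \<sigma> i r"
    using ex_path by blast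
  define g where "g r = r + (\<Sum>i<n. \<gamma>u i r)" for r
  have g: "classKinf g"
    unfolding g_def by (rule classKinf_add[OF classKinf_id classK_sum]) (use \<gamma>u n_pos in auto)
  define \<phi> where "\<phi> r = sinv g (\<xi> r)" for r
  have \<phi>: "classKinf \<phi>" unfolding \<phi>_def by (rule classKinf_compose[OF classKinf_sinv[OF g] \<xi>])
  have "Gambar n Isum \<gamma> \<gamma>u (\<lambda>j. \<sigma> j r) (\<phi> r) i < \<sigma> i r" if r: "0 < r" and i: "i < n" for r i
  proof -
    have nonneg: "0 \<le> \<xi> r" "0 \<le> \<phi> r" using classK_nonneg[OF classKinfD] \<xi> \<phi> r by auto
    have "\<gamma>u i (\<phi> r) \<le> (\<Sum>i<n. \<gamma>u i (\<phi> r))"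
      by (rule member_le_sum) (use i classK_nonneg[OF \<gamma>u nonneg(2)] in auto)
    also have "\<dots> \<le> g (\<phi> r)" using nonneg(2) by (simp add: g_def)
    also have "\<dots> = \<xi> r" unfolding \<phi>_def by (rule apply_sinv[OF g nonneg(1)])
    finally have "Gambar n Isum \<gamma> \<gamma>u (\<lambda>j. \<sigma> j r) (\<phi> r) i \<le> G (\<lambda>j. \<sigma> j r) (\<xi> r) i"
      unfolding Gambar_eq_G[of \<gamma>u]
        using classK_nonneg[OF classKinfD[OF \<sigma>(1)]] r by (intro G_mono i) auto
    then show ?thesis using path[OF r i] by simp
  qed
  then show ?thesis using \<sigma> \<phi> by (intro that)
qed

end

section \<open>Almost everywhere differentiability of Lipschitz functions\<close>

subsection \<open>Null sets\<close>

lemma AE_lborelE: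
  assumes "AE x in lborel. P x" obtains N where "{x. \<not> P x} \<subseteq> N" "N \<in> null_sets lborel"
proof (rule AE_E3[OF assms])
  fix N assume N: "\<And>x. x \<in> space lborel - N \<Longrightarrow> P x" "N \<in> null_sets lborel"
  have "{x. \<not> P x} \<subseteq> N" using N(1) by fastforce
  then show ?thesis using N(2) by (rule that)
qed

lemma AE_lborel_iff_negligible:
  fixes P :: "'a::euclidean_space \<Rightarrow> bool"
  shows "(AE x in lborel. P x) \<longleftrightarrow> negligible {x. \<not> P x}"
proof
  assume "AE x in lborel. P x"
  then obtain N where "{x. \<not> P x} \<subseteq> N" "N \<in> null_sets lborel"
    by (rule AE_lborelE)
  then show "negligible {x. \<not> P x}"
    using negligible_subset[of N] by (simp add: negligible_iff_null_sets null_sets_completionI)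
next
  assume "negligible {x. \<not> P x}"
  then have "AE x in completion lborel. x \<notin> {x. \<not> P x}"
    unfolding negligible_iff_null_sets by (rule AE_not_in)
  then show "AE x in lborel. P x" by (simp add: AE_completion_iff)
qed

lemma ex_in_open_if_AE_lborel:
  fixes P :: "'a::euclidean_space \<Rightarrow> bool"
  assumes "AE x in lborel. P x" "open U" "U \<noteq> {}"
  obtains x where "x \<in> U" "P x"
proof -
  have "\<not> U \<subseteq> {x. \<not> P x}"
    using assms open_not_negligible[of U] negligible_subset by (auto simp: AE_lborel_iff_negligible)
  then show ?thesis using that by blast
qed

lemma AE_lborel_translate:
  fixes P :: "'a::euclidean_space \<Rightarrow> bool"
  assumes "AE x in lborel. P x" shows "AE x in lborel. P (x + a)"
proof -
  have "negligible ((+) (- a) ` {x. \<not> P x})"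
    using assms by (intro negligible_translation) (simp add: AE_lborel_iff_negligible)
  moreover have "{x. \<not> P (x + a)} \<subseteq> (+) (- a) ` {x. \<not> P x}"
    by (auto simp: image_iff intro!: exI[of _ "_ + a"])
  ultimately show ?thesis unfolding AE_lborel_iff_negligible by (rule negligible_subset)
qed

lemma AE_AE_on_lines_commute:
  fixes P :: "'a::euclidean_space \<Rightarrow> bool" and v :: 'a
  assumes [measurable]: "Measurable.pred borel P"
  shows "(AE x in lborel. AE t::real in lborel. t \<in> {0<..<1} \<longrightarrow> P (x + t *\<^sub>R v)) \<longleftrightarrow>
    (AE t::real in lborel. AE x in lborel. t \<in> {0<..<1} \<longrightarrow> P (x + t *\<^sub>R v))"
proof (rule lborel_pair.AE_commute)
  have line: "(\<lambda>p :: 'a \<times> real. fst p + snd p *\<^sub>R v) \<in> (lborel \<Otimes>\<^sub>M lborel) \<rightarrow>\<^sub>M borel" by measurable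
  have "Measurable.pred (lborel \<Otimes>\<^sub>M lborel)
      (\<lambda>p :: 'a \<times> real. snd p \<in> {0<..<1} \<longrightarrow> P (fst p + snd p *\<^sub>R v))"
    using measurable_compose[OF line assms] by measurable
  then show "{p \<in> space (lborel \<Otimes>\<^sub>M lborel). snd p \<in> {0<..<1::real} \<longrightarrow> P (fst p + snd p *\<^sub>R v)}
      \<in> sets (lborel \<Otimes>\<^sub>M lborel)"
    by (rule predE)
qed

lemma AE_lborel_imp_AE_on_lines:
  fixes P :: "'a::euclidean_space \<Rightarrow> bool"
  assumes "AE x in lborel. P x"
  shows "AE x in lborel. AE t::real in lborel. t \<in> {0<..<1} \<longrightarrow> P (x + t *\<^sub>R v)"
proof -
  obtain N where N: "{x. \<not> P x} \<subseteq> N" "N \<in> null_sets lborel"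
    using assms by (rule AE_lborelE)
  then have [measurable]: "N \<in> sets borel" by auto
  have "AE x in lborel. t \<in> {0<..<1} \<longrightarrow> x + t *\<^sub>R v \<notin> N" for t :: real
    using AE_lborel_translate[OF AE_not_in[OF N(2)], of "t *\<^sub>R v"] by eventually_elim simp
  then have "AE x in lborel. AE t::real in lborel. t \<in> {0<..<1} \<longrightarrow> x + t *\<^sub>R v \<notin> N"
    by (subst AE_AE_on_lines_commute) (auto intro: AE_I2)
  then show ?thesis
  proof eventually_elim
    case (elim x)
    then show ?case by eventually_elim (use N(1) in blast)
  qed
qed

lemma AE_lborel_if_AE_on_lines:
  fixes P :: "'a::euclidean_space \<Rightarrow> bool"
  assumes "Measurable.pred borel P"
    and "\<And>x. AE t::real in lborel. t \<in> {0<..<1} \<longrightarrow> P (x + t *\<^sub>R v)"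
  shows "AE x in lborel. P x"
proof -
  have "AE t::real in lborel. AE x in lborel. t \<in> {0<..<1} \<longrightarrow> P (x + t *\<^sub>R v)"
    unfolding AE_AE_on_lines_commute[OF assms(1), symmetric] by (rule AE_I2) (rule assms(2))
  then obtain t :: real where "t \<in> {0<..<1}" "AE x in lborel. t \<in> {0<..<1} \<longrightarrow> P (x + t *\<^sub>R v)"
    by (rule ex_in_open_if_AE_lborel[of _ "{0<..<1}"]) auto
  then have "AE x in lborel. P (x + t *\<^sub>R v)" by simp
  from AE_lborel_translate[OF this, of "- (t *\<^sub>R v)"] show ?thesis by simp
qed

subsection \<open>Lipschitz functions on an interval\<close>

lemma lebesgue_differentiation_AE:
  fixes f :: "'a::euclidean_space \<Rightarrow> 'b::euclidean_space"
  assumes "\<And>a b. f integrable_on cbox a b"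
  shows "AE x in lborel. ((\<lambda>h. integral (cbox x (x + h *\<^sub>R One)) f /\<^sub>R h ^ DIM('a)) \<longlongrightarrow> f x) (at_right 0)"
proof -
  obtain N where N: "negligible N" "\<And>x e. x \<notin> N \<Longrightarrow> 0 < e \<Longrightarrow> \<exists>d>0. \<forall>h. 0 < h \<and> h < d \<longrightarrow>
      norm (integral (cbox x (x + h *\<^sub>R One)) f /\<^sub>R h ^ DIM('a) - f x) < e"
    using integrable_ccontinuous_explicit[OF assms] by blast
  have "((\<lambda>h. integral (cbox x (x + h *\<^sub>R One)) f /\<^sub>R h ^ DIM('a)) \<longlongrightarrow> f x) (at_right 0)"
    if x: "x \<notin> N" for x
  proof (rule tendstoI)
    fix e :: real assume "0 < e"
    then obtain d where "d > 0" "\<forall>h. 0 < h \<and> h < d \<longrightarrow>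
        norm (integral (cbox x (x + h *\<^sub>R One)) f /\<^sub>R h ^ DIM('a) - f x) < e"
      using N(2)[OF x] by blast
    then show "eventually (\<lambda>h. dist (integral (cbox x (x + h *\<^sub>R One)) f /\<^sub>R h ^ DIM('a)) (f x) < e) (at_right 0)"
      unfolding eventually_at_right_field dist_norm by blast
  qed
  then show ?thesis
    unfolding AE_lborel_iff_negligible by (intro negligible_subset[OF N(1)]) blast
qed

lemma has_vector_derivative_at_right_iff:
  fixes f :: "real \<Rightarrow> 'a::real_normed_vector"
  shows "(f has_vector_derivative d) (at_right t) \<longleftrightarrow> ((\<lambda>h. (f (t + h) - f t) /\<^sub>R h) \<longlongrightarrow> d) (at_right 0)"
proof -
  have "(f has_vector_derivative d) (at_right t) \<longleftrightarrow>
      ((\<lambda>y. norm ((f y - f t) - (y - t) *\<^sub>R d) / norm (y - t)) \<longlongrightarrow> 0) (at_right t)"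
    by (simp add: has_vector_derivative_def has_derivative_iff_norm bounded_linear_scaleR_left)
  also have "\<dots> \<longleftrightarrow> ((\<lambda>h. norm ((f (t + h) - f t) /\<^sub>R h - d)) \<longlongrightarrow> 0) (at_right 0)"
    unfolding filterlim_at_right_to_0[of _ _ t]
  proof (rule filterlim_cong[OF refl refl])
    have "norm ((f (h + t) - f t) - (h + t - t) *\<^sub>R d) / norm (h + t - t) = norm ((f (t + h) - f t) /\<^sub>R h - d)"
      if "0 < h" for h
    proof -
      have "(f (t + h) - f t) /\<^sub>R h - d = (f (t + h) - f t - h *\<^sub>R d) /\<^sub>R h"
        using that by (simp add: scaleR_diff_right)
      then show ?thesis using that by (simp add: add.commute divide_inverse mult.commute)
    qed
    then show "eventually (\<lambda>h. norm ((f (h + t) - f t) - (h + t - t) *\<^sub>R d) / norm (h + t - t) =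
        norm ((f (t + h) - f t) /\<^sub>R h - d)) (at_right 0)"
      using eventually_at_right_less by (rule eventually_mono[rotated])
  qed
  finally show ?thesis by (simp only: tendsto_norm_zero_iff LIM_zero_iff)
qed

lemma has_real_derivative_at_right_iff:
  "(f has_real_derivative d) (at_right t) \<longleftrightarrow> ((\<lambda>h. (f (t + h) - f t) / h) \<longlongrightarrow> d) (at_right 0)"
  by (simp add: has_real_derivative_iff_has_vector_derivative has_vector_derivative_at_right_iff
      divide_inverse mult.commute)

definition indefinite_integral_on :: "real set \<Rightarrow> (real \<Rightarrow> 'a::banach) \<Rightarrow> (real \<Rightarrow> 'a) \<Rightarrow> bool" where
  "indefinite_integral_on S k F \<longleftrightarrow> (\<forall>s t. s \<le> t \<longrightarrow> {s..t} \<subseteq> S \<longrightarrow> (k has_integral F t - F s) {s..t})"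

lemma indefinite_integral_onD:
  "indefinite_integral_on S k F \<Longrightarrow> s \<le> t \<Longrightarrow> {s..t} \<subseteq> S \<Longrightarrow> (k has_integral F t - F s) {s..t}"
  by (simp add: indefinite_integral_on_def)

lemma indefinite_integral_on_imp_right_derivative_AE:
  fixes F :: "real \<Rightarrow> 'a::euclidean_space"
  assumes k: "indefinite_integral_on {a..b} k F"
  shows "AE t in lborel. t \<in> {a..<b} \<longrightarrow> (F has_vector_derivative k t) (at_right t)"
proof (cases "a \<le> b")
  case True
  define k' where "k' t = (if t \<in> {a..b} then k t else 0)" for t
  have "k' integrable_on UNIV"
    unfolding k'_def integrable_restrict_UNIV
      using indefinite_integral_onD[OF k True order_refl] by (rule has_integral_integrable)
  then have "k' integrable_on cbox s t" for s t by (rule integrable_on_subcbox) simp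
  from lebesgue_differentiation_AE[OF this]
  have "AE t in lborel. ((\<lambda>h. integral {t..t + h} k' /\<^sub>R h) \<longlongrightarrow> k' t) (at_right 0)" by simp
  then show ?thesis
  proof eventually_elim
    case (elim t)
    show ?case
    proof
      assume t: "t \<in> {a..<b}"
      have "integral {t..t + h} k' = F (t + h) - F t" if h: "0 < h" "h < b - t" for h
      proof -
        have "integral {t..t + h} k' = integral {t..t + h} k"
          using t h by (intro integral_cong) (auto simp: k'_def)
        also have "\<dots> = F (t + h) - F t"
          using t h by (intro integral_unique indefinite_integral_onD[OF k]) auto
        finally show ?thesis .
      qed
      then have "eventually (\<lambda>h. integral {t..t + h} k' /\<^sub>R h = (F (t + h) - F t) /\<^sub>R h) (at_right 0)"
        unfolding eventually_at_right_field using t by (intro exI[of _ "b - t"]) auto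
      then have "((\<lambda>h. (F (t + h) - F t) /\<^sub>R h) \<longlongrightarrow> k' t) (at_right 0)"
        using elim by (rule Lim_transform_eventually[rotated])
      then show "(F has_vector_derivative k t) (at_right t)"
        unfolding has_vector_derivative_at_right_iff using t by (simp add: k'_def)
    qed
  qed
qed auto

lemma ex_density_if_absolutely_continuous:
  fixes F :: "real \<Rightarrow> real"
  assumes ac: "absolutely_continuous lborel \<mu>" and sets: "sets \<mu> = sets borel" and F: "mono F"
    and \<mu>: "\<And>a b. a \<le> b \<Longrightarrow> emeasure \<mu> {a..b} = ennreal (F b - F a)"
  shows "\<exists>k. indefinite_integral_on UNIV k F"
proof -
  have "\<exists>h\<in>borel_measurable lborel. density lborel h = \<mu>"
    by (rule sigma_finite_measure.Radon_Nikodym[OF lborel.sigma_finite_measure_axioms ac]) (simp add: sets)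
  then obtain h where h[measurable]: "h \<in> borel_measurable lborel"
    and density: "density lborel h = \<mu>"
    by blast
  have int_h: "(\<integral>\<^sup>+x. h x * indicator {a..b} x \<partial>lborel) = ennreal (F b - F a)" if "a \<le> b" for a b
  proof -
    have "(\<integral>\<^sup>+x. h x * indicator {a..b} x \<partial>lborel) = emeasure (density lborel h) {a..b}"
      by (subst emeasure_density) auto
    then show ?thesis by (simp add: density \<mu>[OF that])
  qed
  have "AE x in lborel. h x * indicator {-real m..real m} x \<noteq> \<infinity>" for m :: nat
    by (rule nn_integral_noteq_infinite) (auto simp: int_h)
  then have "AE x in lborel. \<forall>m::nat. h x * indicator {-real m..real m} x \<noteq> \<infinity>"
    by (simp add: AE_all_countable)
  then have finite: "AE x in lborel. h x \<noteq> \<infinity>"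
  proof eventually_elim
    case (elim x)
    obtain m where "\<bar>x\<bar> \<le> real m" using real_arch_simple by blast
    then show ?case
      using spec[OF elim, of m] by (auto simp: indicator_def abs_le_iff split: if_splits)
  qed
  have "((\<lambda>x. enn2real (h x)) has_integral F b - F a) {a..b}" if ab: "a \<le> b" for a b
  proof -
    have "((\<lambda>x. indicator {a..b} x * enn2real (h x)) has_integral F b - F a) UNIV"
    proof (rule nn_integral_has_integral)
      show "(\<lambda>x. indicator {a..b} x * enn2real (h x)) \<in> borel_measurable borel" by measurable
      have "(\<integral>\<^sup>+x. ennreal (indicator {a..b} x * enn2real (h x)) \<partial>lborel) = (\<integral>\<^sup>+x. h x * indicator {a..b} x \<partial>lborel)"
        using finite
          by (intro nn_integral_cong_AE) (auto simp: indicator_def less_top[symmetric] elim!: eventually_mono)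
      then show "(\<integral>\<^sup>+x. ennreal (indicator {a..b} x * enn2real (h x)) \<partial>lborel) = ennreal (F b - F a)"
        using int_h[OF ab] by simp
    qed (use monoD[OF F ab] in auto)
    then have "((\<lambda>x. if x \<in> {a..b} then enn2real (h x) else 0) has_integral F b - F a) UNIV"
      by (rule has_integral_eq[rotated]) (auto simp: indicator_def)
    then show ?thesis by (simp only: has_integral_restrict_UNIV)
  qed
  then show ?thesis unfolding indefinite_integral_on_def by blast
qed

lemma expanding_real_map:
  fixes F :: "real \<Rightarrow> real"
  assumes expand: "\<And>x y. x \<le> y \<Longrightarrow> y - x \<le> F y - F x" and cont: "continuous_on UNIV F"
  shows "bij F" "F x \<le> F y \<longleftrightarrow> x \<le> y" "1-lipschitz_on UNIV (inv F)"
proof -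
  have le_iff: "F x \<le> F y \<longleftrightarrow> x \<le> y" for x y using expand[of x y] expand[of y x] by linarith
  then show "F x \<le> F y \<longleftrightarrow> x \<le> y" .
  have "y \<in> range F" for y
  proof -
    define t where "t = \<bar>y\<bar> + \<bar>F 0\<bar>"
    have "0 \<le> t" by (simp add: t_def)
    then have "F (- t) \<le> y" "y \<le> F t" using expand[of 0 t] expand[of "-t" 0] t_def by linarith+
    moreover have "- t \<le> t" using \<open>0 \<le> t\<close> by simp
    ultimately obtain x where "F x = y"
      using IVT'[of F "-t" y t] continuous_on_subset[OF cont] by blast
    then show ?thesis by blast
  qed
  then have "surj F" by blast
  moreover have "inj F" by (rule injI) (metis le_iff antisym order_refl)
  ultimately show bij: "bij F" by (intro bijI)
  show "1-lipschitz_on UNIV (inv F)"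
  proof (rule lipschitz_onI)
    fix u v
    have "\<bar>inv F u - inv F v\<bar> \<le> \<bar>F (inv F u) - F (inv F v)\<bar>"
      using expand[of "inv F u" "inv F v"] expand[of "inv F v" "inv F u"] by linarith
    then show "dist (inv F u) (inv F v) \<le> 1 * dist u v"
      by (simp add: dist_real_def surj_f_inv_f[OF bij_is_surj[OF bij]])
  qed simp
qed

text \<open>Since \<open>F\<close> is bi-Lipschitz, the image of Lebesgue measure under its inverse is absolutely
  continuous; its density is the derivative of \<open>F\<close>.\<close>
lemma expanding_lipschitz_ex_density:
  fixes F :: "real \<Rightarrow> real"
  assumes lip: "M-lipschitz_on UNIV F" and expand: "\<And>x y. x \<le> y \<Longrightarrow> y - x \<le> F y - F x"
  shows "\<exists>k. indefinite_integral_on UNIV k F"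
proof -
  note F = expanding_real_map[OF expand lipschitz_on_continuous_on[OF lip]]
  have F_inv: "F (inv F y) = y" and inv_F: "inv F (F x) = x" for x y
    using F(1) by (auto simp: bij_is_surj surj_f_inv_f bij_is_inj)
  have inv_meas[measurable]: "inv F \<in> borel_measurable borel"
    by (rule borel_measurable_continuous_onI[OF lipschitz_on_continuous_on[OF F(3)]])
  have vimage: "inv F -` A = F ` A" for A
    by (force simp: F_inv inv_F image_iff intro: F_inv[symmetric])
  define \<mu> where "\<mu> = distr lborel borel (inv F)"
  have \<mu>: "emeasure \<mu> A = emeasure lborel (F ` A)" if [measurable]: "A \<in> sets borel" for A
    unfolding \<mu>_def by (subst emeasure_distr) (simp_all add: vimage)
  have Icc: "F ` {a..b} = {F a..F b}" for a b
  proof (intro equalityI subsetI)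
    fix y assume "y \<in> {F a..F b}"
    then have "inv F y \<in> {a..b}"
      using F(2)[of a "inv F y"] F(2)[of "inv F y" b] by (simp add: F_inv)
    then show "y \<in> F ` {a..b}" by (metis F_inv image_eqI)
  qed (auto simp: F(2))
  show ?thesis
  proof (rule ex_density_if_absolutely_continuous)
    show "mono F" by (intro monoI) (simp add: F(2))
    show "emeasure \<mu> {a..b} = ennreal (F b - F a)" if "a \<le> b" for a b
      using that by (simp add: \<mu> Icc F(2))
    show "absolutely_continuous lborel \<mu>"
      unfolding absolutely_continuous_def
    proof
      fix A :: "real set" assume A: "A \<in> null_sets lborel"
      then have A_borel: "A \<in> sets borel" by auto
      have "norm (F y - F x) \<le> M * norm (y - x)" for x y
        using lipschitz_onD[OF lip, of y x] by (simp add: dist_norm)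
      then have "negligible (F ` A)"
        using A
          by (intro negligible_locally_Lipschitz_image) (auto simp: negligible_iff_null_sets null_sets_completionI)
      moreover have "F ` A \<in> sets lborel"
        using measurable_sets_borel[OF inv_meas A_borel] by (simp add: vimage)
      ultimately have "emeasure lborel (F ` A) = 0"
        by (simp add: negligible_iff_null_sets null_sets_completion_iff null_setsD1)
      then show "A \<in> null_sets \<mu>" using \<mu>[OF A_borel] A_borel by (auto simp: null_sets_def \<mu>_def)
    qed
  qed (simp_all add: \<mu>_def)
qed

lemma lipschitz_ex_density:
  fixes g :: "real \<Rightarrow> real"
  assumes lip: "L-lipschitz_on UNIV g"
  obtains k where "indefinite_integral_on UNIV k g"
proof -
  have L: "0 \<le> L" using lip by (rule lipschitz_on_nonneg)
  define F where "F t = g t + (L + 1) * t" for t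
  have "\<exists>k. indefinite_integral_on UNIV k F"
  proof (rule expanding_lipschitz_ex_density)
    show "t - s \<le> F t - F s" if "s \<le> t" for s t
      using lipschitz_onD[OF lip, of t s] that
        by (simp add: F_def dist_real_def algebra_simps abs_le_iff)
    show "(L + (L + 1))-lipschitz_on UNIV F"
      unfolding F_def using L
      by (intro lipschitz_on_add lip lipschitz_onI)
        (auto simp: dist_real_def abs_mult right_diff_distrib[symmetric])
  qed
  then obtain k where k: "indefinite_integral_on UNIV k F" by blast
  have "((\<lambda>t. k t - (L + 1)) has_integral g t - g s) {s..t}" if "s \<le> t" for s t
  proof -
    have "((\<lambda>t. k t - (L + 1)) has_integral (F t - F s) - (t - s) *\<^sub>R (L + 1)) {s..t}"
      using indefinite_integral_onD[OF k that] has_integral_const_real[of "L + 1" s t] that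
      by (intro has_integral_diff) auto
    then show ?thesis by (simp add: F_def algebra_simps)
  qed
  then show ?thesis by (intro that[of "\<lambda>t. k t - (L + 1)"]) (simp add: indefinite_integral_on_def)
qed

lemma lipschitz_on_ex_right_derivative:
  fixes f :: "real \<Rightarrow> real"
  assumes lip: "L-lipschitz_on {a..b} f"
  obtains f' where "indefinite_integral_on {a..b} f' f"
    "AE t in lborel. t \<in> {a..<b} \<longrightarrow> (f has_real_derivative f' t) (at_right t)"
proof (cases "a \<le> b")
  case True
  define g where "g t = f (clamp a b t)" for t
  have "L-lipschitz_on UNIV g"
  proof (rule lipschitz_onI[OF _ lipschitz_on_nonneg[OF lip]])
    fix s t :: real
    have "dist (g s) (g t) \<le> L * dist (clamp a b s) (clamp a b t)"
      unfolding g_def using True clamp_in_interval[of a b] by (intro lipschitz_onD[OF lip]) auto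
    also have "\<dots> \<le> L * dist s t"
      by (intro mult_left_mono dist_clamps_le_dist_args lipschitz_on_nonneg[OF lip])
    finally show "dist (g s) (g t) \<le> L * dist s t" .
  qed
  then obtain k where k: "indefinite_integral_on UNIV k g" by (rule lipschitz_ex_density)
  have g_eq: "g t = f t" if "t \<in> {a..b}" for t
    using that clamp_cancel_cbox[of t a b] by (simp add: g_def)
  have "(k has_integral f t - f s) {s..t}" if "s \<le> t" "{s..t} \<subseteq> {a..b}" for s t
    using indefinite_integral_onD[OF k that(1)] that by (simp add: g_eq)
  then have k: "indefinite_integral_on {a..b} k f" by (simp add: indefinite_integral_on_def)
  show ?thesis
  proof (rule that[OF k])
    show "AE t in lborel. t \<in> {a..<b} \<longrightarrow> (f has_real_derivative k t) (at_right t)"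
      unfolding has_real_derivative_iff_has_vector_derivative
      by (rule indefinite_integral_on_imp_right_derivative_AE[OF k])
  qed
next
  case False
  then show ?thesis by (intro that) (auto simp: indefinite_integral_on_def)
qed

lemma lipschitz_on_right_derivative_le:
  fixes f :: "real \<Rightarrow> real"
  assumes lip: "L-lipschitz_on {a..b} f" and ab: "a \<le> b"
    and deriv_le: "AE t in lborel. t \<in> {a<..<b} \<longrightarrow> (\<forall>d. (f has_real_derivative d) (at_right t) \<longrightarrow> d \<le> c)"
  shows "f b - f a \<le> c * (b - a)"
proof -
  obtain f' where f': "indefinite_integral_on {a..b} f' f"
    and deriv: "AE t in lborel. t \<in> {a..<b} \<longrightarrow> (f has_real_derivative f' t) (at_right t)"
    using lipschitz_on_ex_right_derivative[OF lip] by blast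
  have "AE t in lborel. t \<in> {a<..<b} \<longrightarrow> f' t \<le> c"
    using deriv_le deriv by eventually_elim auto
  then have null: "negligible ({a, b} \<union> {t. \<not> (t \<in> {a<..<b} \<longrightarrow> f' t \<le> c)})"
    unfolding AE_lborel_iff_negligible by (intro negligible_Un) auto
  have "((\<lambda>t. min c (f' t)) has_integral f b - f a) {a..b}"
    by (rule has_integral_spike[OF null _ indefinite_integral_onD[OF f' ab order_refl]]) auto
  moreover have "((\<lambda>t. c) has_integral c * (b - a)) {a..b}"
    using has_integral_const_real[of c a b] ab by (simp add: mult.commute)
  ultimately show ?thesis by (rule has_integral_le) simp
qed

subsection \<open>Rademacher's theorem\<close>

definition right_deriv_along :: "('a::real_normed_vector \<Rightarrow> real) \<Rightarrow> 'a \<Rightarrow> 'a \<Rightarrow> real \<Rightarrow> bool" where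
  "right_deriv_along g v x d \<longleftrightarrow> ((\<lambda>t. g (x + t *\<^sub>R v)) has_real_derivative d) (at_right 0)"

lemma right_deriv_along_iff:
  "right_deriv_along g v x d \<longleftrightarrow> ((\<lambda>h. (g (x + h *\<^sub>R v) - g x) / h) \<longlongrightarrow> d) (at_right 0)"
  by (simp add: right_deriv_along_def has_real_derivative_at_right_iff)

lemma right_deriv_along_shift:
  "((\<lambda>s. g (x + s *\<^sub>R v)) has_real_derivative d) (at_right t) \<longleftrightarrow> right_deriv_along g v (x + t *\<^sub>R v) d"
  by (simp add: right_deriv_along_iff has_real_derivative_at_right_iff scaleR_left_distrib add.assoc)

lemma has_derivative_imp_right_deriv_along:
  assumes "(g has_derivative D) (at x)" shows "right_deriv_along g v x (D v)"
proof -
  have D: "linear D" using assms has_derivative_linear by blast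
  have "((\<lambda>h. g (x + h *\<^sub>R v)) has_derivative (\<lambda>h. D (h *\<^sub>R v))) (at 0)"
    by (rule has_derivative_compose[of "\<lambda>h. x + h *\<^sub>R v" "\<lambda>h. h *\<^sub>R v", simplified])
      (use assms in \<open>auto intro!: derivative_eq_intros\<close>)
  then have "((\<lambda>h. g (x + h *\<^sub>R v)) has_real_derivative D v) (at 0)"
    unfolding has_field_derivative_def by (simp add: linear_scale[OF D] mult.commute[of _ "D v"])
  then show ?thesis unfolding right_deriv_along_def by (rule has_field_derivative_at_within)
qed

lemma right_deriv_along_scale:
  assumes "right_deriv_along g v x d" "0 < c" shows "right_deriv_along g (c *\<^sub>R v) x (c * d)"
proof -
  have "filterlim (\<lambda>h. h * c) (at_right 0) (at_right 0)"
    unfolding filterlim_at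
  proof
    show "eventually (\<lambda>h. h * c \<in> {0<..} \<and> h * c \<noteq> 0) (at_right 0)"
      using eventually_at_right_less by eventually_elim (use assms(2) in auto)
    have "((\<lambda>h. h * c) \<longlongrightarrow> 0 * c) (at_right 0)" by (intro tendsto_intros)
    then show "((\<lambda>h. h * c) \<longlongrightarrow> 0) (at_right 0)" by simp
  qed
  from tendsto_mult_left[OF filterlim_compose[OF assms(1)[unfolded right_deriv_along_iff] this], of c]
  show ?thesis using assms(2) by (simp add: right_deriv_along_iff)
qed

definition dquot :: "('a::real_normed_vector \<Rightarrow> real) \<Rightarrow> 'a \<Rightarrow> nat \<Rightarrow> 'a \<Rightarrow> real" where
  "dquot g v k x = (g (x + inverse (real (Suc k)) *\<^sub>R v) - g x) * real (Suc k)"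

definition rderiv :: "('a::real_normed_vector \<Rightarrow> real) \<Rightarrow> 'a \<Rightarrow> 'a \<Rightarrow> real" where
  "rderiv g v x = lim (\<lambda>k. dquot g v k x)"

lemma dquot_tendsto:
  assumes "right_deriv_along g v x d" shows "(\<lambda>k. dquot g v k x) \<longlonglongrightarrow> d"
proof -
  have "filterlim (\<lambda>k. inverse (real (Suc k))) (at_right 0) sequentially"
    unfolding filterlim_at using LIMSEQ_inverse_real_of_nat by simp
  from filterlim_compose[OF assms[unfolded right_deriv_along_iff] this] show ?thesis
    by (simp add: dquot_def divide_inverse)
qed

lemma rderiv_eqI: "right_deriv_along g v x d \<Longrightarrow> rderiv g v x = d"
  unfolding rderiv_def by (intro limI dquot_tendsto)

lemma rderiv_scale:
  assumes "right_deriv_along g v x (rderiv g v x)" "0 \<le> c"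
  shows "rderiv g (c *\<^sub>R v) x = c * rderiv g v x"
proof (cases "c = 0")
  case True
  have "right_deriv_along g 0 x 0" by (simp add: right_deriv_along_iff)
  then show ?thesis using True by (simp add: rderiv_eqI)
next
  case False
  then show ?thesis using assms by (intro rderiv_eqI right_deriv_along_scale) auto
qed

lemma lipschitz_quotient_diff_le:
  fixes \<phi> :: "real \<Rightarrow> real"
  assumes \<phi>: "\<And>s t. \<bar>\<phi> s - \<phi> t\<bar> \<le> K * \<bar>s - t\<bar>" and \<phi>_0: "\<phi> 0 = 0"
    and N: "1 \<le> N" "N \<le> 1 / h" "1 / h \<le> N + 1" and h: "0 < h"
  shows "\<bar>\<phi> h / h - \<phi> (inverse N) * N\<bar> \<le> 2 * K * inverse N"
proof -
  have K: "0 \<le> K" using order_trans[OF abs_ge_zero \<phi>[of 1 0]] by simp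
  have "\<phi> h / h - \<phi> (inverse N) * N = (\<phi> h - \<phi> (inverse N)) / h + \<phi> (inverse N) * (1 / h - N)"
    by (simp add: diff_divide_distrib algebra_simps)
  also have "\<bar>\<dots>\<bar> \<le> K * \<bar>h - inverse N\<bar> / h + K * inverse N * (1 / h - N)"
    using \<phi>[of h "inverse N"] \<phi>[of "inverse N" 0] \<phi>_0 N h
    by (intro order_trans[OF abs_triangle_ineq] add_mono)
      (auto simp: abs_mult intro!: divide_right_mono mult_right_mono)
  also have "K * \<bar>h - inverse N\<bar> / h = K * inverse N * (1 / h - N)"
  proof -
    have "h \<le> inverse N" using N h by (simp add: field_simps)
    then show ?thesis using N h by (simp add: field_simps)
  qed
  also have "\<dots> + K * inverse N * (1 / h - N) \<le> K * inverse N * 1 + K * inverse N * 1"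
    using N K by (intro add_mono mult_left_mono) auto
  finally show ?thesis by simp
qed

lemma filterlim_floor_inverse_at_right_0: "filterlim (\<lambda>h::real. nat \<lfloor>1 / h\<rfloor> - 1) at_top (at_right 0)"
  unfolding filterlim_at_top
proof
  fix Z
  have "Z \<le> nat \<lfloor>1 / h\<rfloor> - 1" if "0 < h" "h < inverse (real (Z + 2))" for h :: real
  proof -
    have "real (Z + 2) < 1 / h" using that by (simp add: field_simps)
    then have "int (Z + 2) \<le> \<lfloor>1 / h\<rfloor>" by (simp add: le_floor_iff)
    then show ?thesis by linarith
  qed
  then show "eventually (\<lambda>h::real. Z \<le> nat \<lfloor>1 / h\<rfloor> - 1) (at_right 0)"
    unfolding eventually_at_right_field by (intro exI[of _ "inverse (real (Z + 2))"]) simp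
qed

context
  fixes g :: "'a::euclidean_space \<Rightarrow> real" and L
  assumes lip: "L-lipschitz_on UNIV g"
begin

lemma lipschitz_along_line: "(L * norm v)-lipschitz_on S (\<lambda>t. g (x + t *\<^sub>R v))"
proof (rule lipschitz_onI)
  fix s t :: real
  have "dist (g (x + s *\<^sub>R v)) (g (x + t *\<^sub>R v)) \<le> L * dist (x + s *\<^sub>R v) (x + t *\<^sub>R v)"
    by (rule lipschitz_onD[OF lip]) auto
  then show "dist (g (x + s *\<^sub>R v)) (g (x + t *\<^sub>R v)) \<le> L * norm v * dist s t"
    by (simp add: dist_norm scaleR_left_diff_distrib[symmetric] mult_ac)
qed (use lipschitz_on_nonneg[OF lip] in simp)

lemma dquot_bound: "\<bar>dquot g v k x\<bar> \<le> L * norm v"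
proof -
  have "\<bar>g (x + inverse (real (Suc k)) *\<^sub>R v) - g x\<bar> \<le> L * norm v * inverse (real (Suc k))"
    using lipschitz_onD[OF lipschitz_along_line, of "inverse (real (Suc k))" UNIV 0 x v]
    by (simp add: dist_real_def)
  then have "\<bar>dquot g v k x\<bar> \<le> L * norm v * inverse (real (Suc k)) * real (Suc k)"
    unfolding dquot_def abs_mult abs_of_nat by (rule mult_right_mono) simp
  then show ?thesis by (simp add: mult.assoc del: of_nat_Suc)
qed

lemma right_deriv_along_if_dquot_tendsto:
  assumes lim: "(\<lambda>k. dquot g v k x) \<longlonglongrightarrow> d"
  shows "right_deriv_along g v x d"
proof -
  define \<phi> where "\<phi> h = g (x + h *\<^sub>R v) - g x" for h
  define K where "K = L * norm v"
  define k where "k h = nat \<lfloor>1 / h\<rfloor> - 1" for h :: real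
  have \<phi>: "\<bar>\<phi> s - \<phi> t\<bar> \<le> K * \<bar>s - t\<bar>" for s t
    using lipschitz_onD[OF lipschitz_along_line, of s UNIV t x v]
      by (simp add: \<phi>_def K_def dist_real_def)
  have "\<bar>\<phi> h / h - dquot g v (k h) x\<bar> \<le> 2 * K * inverse (real (Suc (k h)))"
    if h: "0 < h" "h < 1" for h
  proof -
    have "1 \<le> 1 / h" using h by simp
    then have "1 \<le> \<lfloor>1 / h\<rfloor>" by linarith
    then have "real (Suc (k h)) \<le> 1 / h" "1 / h \<le> real (Suc (k h)) + 1" unfolding k_def by linarith+
    then have "\<bar>\<phi> h / h - \<phi> (inverse (real (Suc (k h)))) * real (Suc (k h))\<bar> \<le> 2 * K * inverse (real (Suc (k h)))"
      using h by (intro lipschitz_quotient_diff_le \<phi>) (auto simp: \<phi>_def)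
    then show ?thesis by (simp add: \<phi>_def dquot_def)
  qed
  then have close: "eventually (\<lambda>h. norm (\<phi> h / h - dquot g v (k h) x) \<le> 2 * K * inverse (real (Suc (k h)))) (at_right 0)"
    unfolding eventually_at_right_field by (intro exI[of _ 1]) simp
  have k_at_top: "filterlim k at_top (at_right 0)"
    unfolding k_def by (rule filterlim_floor_inverse_at_right_0)
  have "((\<lambda>h. 2 * K * inverse (real (Suc (k h)))) \<longlongrightarrow> 2 * K * 0) (at_right 0)"
    by (intro tendsto_mult_left filterlim_compose[OF LIMSEQ_inverse_real_of_nat k_at_top])
  then have "((\<lambda>h. \<phi> h / h - dquot g v (k h) x) \<longlongrightarrow> 0) (at_right 0)"
    using Lim_null_comparison[OF close] by simp
  from tendsto_add[OF this filterlim_compose[OF lim k_at_top]]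
  show ?thesis by (simp add: right_deriv_along_iff \<phi>_def)
qed

lemma continuous_on_lipschitz: "continuous_on S g"
  using lipschitz_on_continuous_on[OF lip] continuous_on_subset by blast

lemma borel_measurable_lipschitz: "g \<in> borel_measurable borel"
  by (rule borel_measurable_continuous_onI[OF continuous_on_lipschitz])

lemma borel_measurable_dquot: "dquot g v k \<in> borel_measurable borel"
proof -
  note borel_measurable_lipschitz[measurable]
  show ?thesis unfolding dquot_def by measurable
qed

lemma borel_measurable_rderiv: "rderiv g v \<in> borel_measurable borel"
  unfolding rderiv_def by (rule borel_measurable_lim_metric) (rule borel_measurable_dquot)

lemma right_deriv_along_AE: "AE x in lborel. right_deriv_along g v x (rderiv g v x)"
proof -
  have "AE x in lborel. convergent (\<lambda>k. dquot g v k x)"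
  proof (rule AE_lborel_if_AE_on_lines[where v = v])
    note borel_measurable_dquot[measurable]
    show "Measurable.pred borel (\<lambda>x. convergent (\<lambda>k. dquot g v k x))"
      unfolding Cauchy_convergent_iff[symmetric] by measurable
    fix x
    obtain f'
      where "AE t in lborel. t \<in> {0..<1} \<longrightarrow> ((\<lambda>t. g (x + t *\<^sub>R v)) has_real_derivative f' t) (at_right t)"
      using lipschitz_on_ex_right_derivative[OF lipschitz_along_line] by blast
    then show "AE t in lborel. t \<in> {0<..<1} \<longrightarrow> convergent (\<lambda>k. dquot g v k (x + t *\<^sub>R v))"
      unfolding right_deriv_along_shift by eventually_elim (auto intro: convergentI dquot_tendsto)
  qed
  then show ?thesis
    by eventually_elim (simp add: rderiv_def convergent_LIMSEQ_iff right_deriv_along_if_dquot_tendsto)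
qed

end

lemma tendsto_indicator_if_notin_frontier:
  assumes X: "(X \<longlongrightarrow> y) F" and y: "y \<notin> frontier S"
  shows "((\<lambda>k. indicator S (X k) :: real) \<longlongrightarrow> indicator S y) F"
proof (cases "y \<in> S")
  case True
  then have "y \<in> interior S" using y closure_subset by (auto simp: frontier_def)
  then have "eventually (\<lambda>k. X k \<in> interior S) F" using X by (intro topological_tendstoD) auto
  then have "eventually (\<lambda>k. indicator S (X k) = (indicator S y :: real)) F"
    by eventually_elim (use True interior_subset in \<open>auto simp: indicator_def\<close>)
  then show ?thesis by (rule tendsto_eventually)
next
  case False
  then have "y \<in> - closure S" using y interior_subset by (auto simp: frontier_def)
  then have "eventually (\<lambda>k. X k \<in> - closure S) F" using X by (intro topological_tendstoD) auto
  then have "eventually (\<lambda>k. indicator S (X k) = (indicator S y :: real)) F"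
    by eventually_elim (use False closure_subset in \<open>auto simp: indicator_def\<close>)
  then show ?thesis by (rule tendsto_eventually)
qed

lemma integrable_indicator_bounded_mult:
  fixes h :: "'a::euclidean_space \<Rightarrow> real"
  assumes S[measurable]: "S \<in> sets borel" and "bounded S"
    and h[measurable]: "h \<in> borel_measurable borel" and bound: "\<And>y. \<bar>h y\<bar> \<le> B"
  shows "integrable lborel (\<lambda>y. indicator S y * h y)"
proof (rule Bochner_Integration.integrable_bound[of _ "\<lambda>y. B * indicator S y"])
  show "integrable lborel (\<lambda>y. B * indicator S y :: real)"
    using emeasure_bounded_finite[OF assms(2)]
    by (intro integrable_mult_right integrable_real_indicator) auto
  have "0 \<le> B" using bound[of 0] by linarith
  then show "AE y in lborel. norm (indicator S y * h y) \<le> norm (B * indicator S y)"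
    using bound by (auto simp: indicator_def)
qed measurable

lemma integral_lborel_translate:
  fixes h :: "'a::euclidean_space \<Rightarrow> real"
  assumes [measurable]: "h \<in> borel_measurable borel"
  shows "(\<integral>y. h (a + y) \<partial>lborel) = (\<integral>y. h y \<partial>lborel)"
proof -
  have "(\<integral>y. h y \<partial>lborel) = (\<integral>y. h y \<partial>distr lborel borel ((+) a))" by (simp add: lborel_distr_plus)
  also have "\<dots> = (\<integral>y. h (a + y) \<partial>lborel)" by (subst integral_distr) auto
  finally show ?thesis by simp
qed

lemma eq_0_AE_if_box_integrals_0:
  fixes e :: "'a::euclidean_space \<Rightarrow> real"
  assumes "\<And>a b. (e has_integral 0) (cbox a b)"
  shows "AE x in lborel. e x = 0"
proof -
  have "AE x in lborel. ((\<lambda>h. integral (cbox x (x + h *\<^sub>R One)) e /\<^sub>R h ^ DIM('a)) \<longlongrightarrow> e x) (at_right 0)"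
    using assms by (intro lebesgue_differentiation_AE has_integral_integrable)
  then show ?thesis
  proof eventually_elim
    case (elim x)
    then have "((\<lambda>h. 0) \<longlongrightarrow> e x) (at_right (0::real))" by (simp add: integral_unique[OF assms])
    then show ?case by (simp add: tendsto_const_iff)
  qed
qed

context
  fixes g :: "'a::euclidean_space \<Rightarrow> real" and L
  assumes lip: "L-lipschitz_on UNIV g"
begin

lemma box_integral_dquot_tendsto:
  "(\<lambda>k. \<integral>y. indicator (cbox c d) (y - inverse (real (Suc k)) *\<^sub>R w) * dquot g v k y \<partial>lborel)
      \<longlonglongrightarrow> (\<integral>y. indicator (cbox c d) y * rderiv g v y \<partial>lborel)" (is ?lim)
  and integrable_indicator_cbox_rderiv:
  "integrable lborel (\<lambda>y. indicator (cbox c d) y * rderiv g v y)" (is ?int)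
proof -
  note [measurable] = borel_measurable_dquot[OF lip] borel_measurable_rderiv[OF lip]
  let ?f = "\<lambda>k y. indicator (cbox c d) (y - inverse (real (Suc k)) *\<^sub>R w) * dquot g v k y"
  let ?f\<^sub>0 = "\<lambda>y. indicator (cbox c d) y * rderiv g v y"
  obtain R where R: "\<And>x. x \<in> cbox c d \<Longrightarrow> norm x \<le> R"
    using bounded_cbox[of c d] unfolding bounded_iff by blast
  let ?D = "\<lambda>y::'a. indicator (cball 0 (R + norm w)) y * (L * norm v) :: real"
  have D: "integrable lborel ?D" by (rule integrable_indicator_bounded_mult) auto
  have bound: "norm (?f k y) \<le> ?D y" for k y
  proof (cases "y - inverse (real (Suc k)) *\<^sub>R w \<in> cbox c d")
    case True
    have "norm (inverse (real (Suc k)) *\<^sub>R w) \<le> 1 * norm w"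
      unfolding norm_scaleR by (intro mult_right_mono) (auto simp: field_simps)
    then have "norm y \<le> R + norm w"
      using R[OF True] norm_triangle_ineq2[of y "inverse (real (Suc k)) *\<^sub>R w"] by linarith
    then show ?thesis using dquot_bound[OF lip, of v k y] True by (simp add: indicator_def)
  qed (use lipschitz_on_nonneg[OF lip] in \<open>simp add: indicator_def\<close>)
  have "AE y in lborel. y \<notin> frontier (cbox c d)"
    unfolding AE_lborel_iff_negligible
      using negligible_frontier_interval[of c d] by (simp add: frontier_cbox set_diff_eq)
  then have lim: "AE y in lborel. (\<lambda>k. ?f k y) \<longlonglongrightarrow> ?f\<^sub>0 y"
    using right_deriv_along_AE[OF lip, of v]
  proof eventually_elim
    case (elim y)
    have "(\<lambda>k. y - inverse (real (Suc k)) *\<^sub>R w) \<longlonglongrightarrow> y - 0 *\<^sub>R w"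
      by (intro tendsto_intros LIMSEQ_inverse_real_of_nat)
    then show ?case
      using elim by (intro tendsto_mult tendsto_indicator_if_notin_frontier dquot_tendsto) auto
  qed
  have "?f\<^sub>0 \<in> borel_measurable lborel" "\<And>k. ?f k \<in> borel_measurable lborel" by measurable
  note dominated = this D lim AE_I2[OF bound]
  show ?lim by (rule integral_dominated_convergence[OF dominated])
  show ?int by (rule integrable_dominated_convergence[OF dominated])
qed

text \<open>The difference quotient in direction \<open>a + b\<close> is the one in direction \<open>a\<close> plus a translate of
  the one in direction \<open>b\<close>. Under the integral the translation moves to the box.\<close>
lemma box_integral_dquot_add:
  "(\<integral>y. indicator (cbox c d) y * dquot g (a + b) k y \<partial>lborel) =
   (\<integral>y. indicator (cbox c d) y * dquot g a k y \<partial>lborel) +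
   (\<integral>y. indicator (cbox c d) (y - inverse (real (Suc k)) *\<^sub>R a) * dquot g b k y \<partial>lborel)"
proof -
  note [measurable] = borel_measurable_dquot[OF lip]
  let ?a = "inverse (real (Suc k)) *\<^sub>R a"
  have int: "integrable lborel (\<lambda>y. indicator (cbox c d) y * dquot g a k y)"
    "integrable lborel (\<lambda>y. indicator (cbox c d) y * dquot g b k (?a + y))"
    using dquot_bound[OF lip] by (intro integrable_indicator_bounded_mult; auto)+
  have "(\<integral>y. indicator (cbox c d) y * dquot g (a + b) k y \<partial>lborel) =
      (\<integral>y. indicator (cbox c d) y * dquot g a k y + indicator (cbox c d) y * dquot g b k (?a + y) \<partial>lborel)"
    by (intro Bochner_Integration.integral_cong) (auto simp: dquot_def algebra_simps)
  also have "\<dots> = (\<integral>y. indicator (cbox c d) y * dquot g a k y \<partial>lborel) +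
      (\<integral>y. indicator (cbox c d) y * dquot g b k (?a + y) \<partial>lborel)"
    by (rule Bochner_Integration.integral_add[OF int])
  also have "(\<integral>y. indicator (cbox c d) y * dquot g b k (?a + y) \<partial>lborel) =
      (\<integral>y. indicator (cbox c d) (y - ?a) * dquot g b k y \<partial>lborel)"
    using integral_lborel_translate[of "\<lambda>y. indicator (cbox c d) (y - ?a) * dquot g b k y" ?a]
      by simp
  finally show ?thesis .
qed

lemma rderiv_add_AE: "AE x in lborel. rderiv g (a + b) x = rderiv g a x + rderiv g b x"
proof -
  let ?I = "\<lambda>v c d. \<integral>y. indicator (cbox c d) y * rderiv g v y \<partial>lborel"
  have add: "?I (a + b) c d = ?I a c d + ?I b c d" for c d
  proof (rule LIMSEQ_unique)
    have lim: "(\<lambda>k. \<integral>y. indicator (cbox c d) y * dquot g v k y \<partial>lborel) \<longlonglongrightarrow> ?I v c d" for v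
      using box_integral_dquot_tendsto[of c d 0 v] by simp
    show "(\<lambda>k. \<integral>y. indicator (cbox c d) y * dquot g (a + b) k y \<partial>lborel) \<longlonglongrightarrow> ?I (a + b) c d"
      by (rule lim)
    show "(\<lambda>k. \<integral>y. indicator (cbox c d) y * dquot g (a + b) k y \<partial>lborel) \<longlonglongrightarrow> ?I a c d + ?I b c d"
      unfolding box_integral_dquot_add[of c d a b]
        by (intro tendsto_add lim box_integral_dquot_tendsto)
  qed
  have int: "(rderiv g v has_integral ?I v c d) (cbox c d)" for v c d
  proof -
    have "set_integrable lborel (cbox c d) (rderiv g v)"
      unfolding set_integrable_def using integrable_indicator_cbox_rderiv by simp
    from set_borel_integral_eq_integral[OF this] integrable_integral show ?thesis
      by (simp add: set_lebesgue_integral_def)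
  qed
  have "((\<lambda>x. rderiv g (a + b) x - rderiv g a x - rderiv g b x) has_integral 0) (cbox c d)" for c d
    using has_integral_diff[OF has_integral_diff[OF int[of "a + b"] int[of a]] int[of b]]
      by (simp add: add)
  from eq_0_AE_if_box_integrals_0[OF this] show ?thesis by eventually_elim simp
qed

lemma rderiv_scale_AE: "AE x in lborel. rderiv g (c *\<^sub>R v) x = c * rderiv g v x"
proof (cases "0 \<le> c")
  case True
  show ?thesis
    using right_deriv_along_AE[OF lip, of v] by eventually_elim (rule rderiv_scale[OF _ True])
next
  case False
  then have "0 \<le> - c" by simp
  show ?thesis
    using right_deriv_along_AE[OF lip, of v] rderiv_add_AE[of "c *\<^sub>R v" "(- c) *\<^sub>R v"]
  proof eventually_elim
    case (elim x)
    have "rderiv g (c *\<^sub>R v) x + - c * rderiv g v x = rderiv g (0 *\<^sub>R v) x"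
      using elim(2) rderiv_scale[OF elim(1) \<open>0 \<le> - c\<close>] by simp
    also have "\<dots> = 0" using rderiv_scale[OF elim(1), of 0] by simp
    finally show ?case by simp
  qed
qed

lemma rderiv_sum_AE:
  assumes "finite S"
  shows "AE x in lborel. rderiv g (\<Sum>b\<in>S. c b *\<^sub>R b) x = (\<Sum>b\<in>S. c b * rderiv g b x)"
  using assms
proof (induction S)
  case empty
  show ?case using rderiv_scale_AE[of 0 0] by simp
next
  case (insert b S)
  from insert.IH rderiv_scale_AE[of "c b" b] rderiv_add_AE[of "c b *\<^sub>R b" "\<Sum>b\<in>S. c b *\<^sub>R b"]
  show ?case by eventually_elim (simp add: insert.hyps)
qed

lemma right_deriv_along_linear_AE:
  "AE x in lborel. right_deriv_along g v x (\<Sum>b\<in>Basis. (v \<bullet> b) * rderiv g b x)"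
  using right_deriv_along_AE[OF lip, of v] rderiv_sum_AE[OF finite_Basis, of "\<lambda>b. v \<bullet> b"]
  by eventually_elim (simp add: euclidean_representation)

lemma linear_approx_perturb_direction:
  assumes T: "bounded_linear T" and K: "\<And>w. \<bar>T w\<bar> \<le> norm w * K" "0 \<le> K"
    and approx: "\<bar>(g (x + h *\<^sub>R w) - g x) / h - T w\<bar> \<le> \<eta>" and w: "norm (u - w) \<le> \<eta>" and h: "0 < h"
  shows "\<bar>g (x + h *\<^sub>R u) - g x - T (h *\<^sub>R u)\<bar> \<le> \<eta> * (L + K + 1) * h"
proof -
  have "\<bar>g (x + h *\<^sub>R w) - g x - h * T w\<bar> \<le> \<eta> * h"
    using approx h by (simp add: field_simps abs_le_iff)
  moreover have "\<bar>g (x + h *\<^sub>R u) - g (x + h *\<^sub>R w)\<bar> \<le> L * (\<eta> * h)"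
  proof -
    have "\<bar>g (x + h *\<^sub>R u) - g (x + h *\<^sub>R w)\<bar> \<le> L * norm (h *\<^sub>R (u - w))"
      using lipschitz_onD[OF lip, of "x + h *\<^sub>R u" "x + h *\<^sub>R w"]
        by (simp add: dist_norm scaleR_diff_right)
    also have "\<dots> \<le> L * (\<eta> * h)"
      using w h lipschitz_on_nonneg[OF lip] by (auto simp: mult.commute intro!: mult_left_mono)
    finally show ?thesis .
  qed
  moreover have "\<bar>h * T w - T (h *\<^sub>R u)\<bar> \<le> K * (\<eta> * h)"
  proof -
    have "\<bar>T (w - u)\<bar> \<le> norm (w - u) * K" by (rule K(1))
    also have "\<dots> \<le> \<eta> * K" using w K(2) by (intro mult_right_mono) (auto simp: norm_minus_commute)
    finally have "\<bar>h * T (w - u)\<bar> \<le> h * (\<eta> * K)" using h by (simp add: abs_mult)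
    then show ?thesis
      using bounded_linear.linear[OF T]
        by (simp add: linear_scale linear_diff right_diff_distrib mult_ac)
  qed
  ultimately have "\<bar>g (x + h *\<^sub>R u) - g x - T (h *\<^sub>R u)\<bar> \<le> \<eta> * h + L * (\<eta> * h) + K * (\<eta> * h)"
    by linarith
  also have "\<dots> = \<eta> * (L + K + 1) * h" by (simp add: algebra_simps)
  finally show ?thesis .
qed

lemma has_derivative_if_right_deriv_along_dense:
  assumes T: "bounded_linear T" and dense: "\<And>U. open U \<Longrightarrow> U \<noteq> {} \<Longrightarrow> \<exists>v\<in>D. v \<in> U"
    and deriv: "\<And>v. v \<in> D \<Longrightarrow> right_deriv_along g v x (T v)"
  shows "(g has_derivative T) (at x)"
  unfolding has_derivative_at_alt
proof (intro conjI T allI impI)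
  fix e :: real assume e: "0 < e"
  have L: "0 \<le> L" using lip by (rule lipschitz_on_nonneg)
  obtain K where K: "0 < K" "\<And>w. \<bar>T w\<bar> \<le> norm w * K" using bounded_linear.pos_bounded[OF T] by force
  define \<eta> where "\<eta> = e / (L + K + 1)"
  have \<eta>: "0 < \<eta>" "\<eta> * (L + K + 1) = e" using e L K(1) by (auto simp: \<eta>_def)
  have "\<exists>w\<in>D. u \<in> ball w \<eta>" for u
    using dense[of "ball u \<eta>"] \<eta>(1) by (auto simp: dist_commute)
  then have "sphere (0::'a) 1 \<subseteq> (\<Union>w\<in>D. ball w \<eta>)" by blast
  then obtain W where W: "W \<subseteq> D" "finite W" "sphere (0::'a) 1 \<subseteq> (\<Union>w\<in>W. ball w \<eta>)"
    using compactE_image[OF compact_sphere[of "0::'a" 1], of D "\<lambda>w. ball w \<eta>"] by auto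
  have "eventually (\<lambda>h. \<forall>w\<in>W. dist ((g (x + h *\<^sub>R w) - g x) / h) (T w) < \<eta>) (at_right 0)"
    using W \<eta>(1) deriv
      unfolding right_deriv_along_iff by (intro eventually_ball_finite ballI tendstoD) auto
  then obtain d where d: "d > 0"
    "\<And>h w. 0 < h \<Longrightarrow> h < d \<Longrightarrow> w \<in> W \<Longrightarrow> dist ((g (x + h *\<^sub>R w) - g x) / h) (T w) < \<eta>"
    unfolding eventually_at_right_field by blast
  have along_unit: "\<bar>g (x + h *\<^sub>R u) - g x - T (h *\<^sub>R u)\<bar> \<le> e * h" if u: "norm u = 1"
    and h: "0 < h" "h < d" for u h
  proof -
    obtain w where w: "w \<in> W" "norm (u - w) < \<eta>"
      using W(3) u by (force simp: dist_norm norm_minus_commute)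
    have "\<bar>(g (x + h *\<^sub>R w) - g x) / h - T w\<bar> \<le> \<eta>"
      using d(2)[OF h w(1)] by (simp add: dist_real_def)
    then show ?thesis
      using linear_approx_perturb_direction[OF T K(2), of x h w \<eta> u] K(1) w(2) h(1)
        by (simp add: \<eta>(2))
  qed
  show "\<exists>d>0. \<forall>y. norm (y - x) < d \<longrightarrow> norm (g y - g x - T (y - x)) \<le> e * norm (y - x)"
  proof (intro exI[of _ d] conjI allI impI d(1))
    fix y assume y: "norm (y - x) < d"
    show "norm (g y - g x - T (y - x)) \<le> e * norm (y - x)"
    proof (cases "y = x")
      case True
      then show ?thesis using linear_0[OF bounded_linear.linear[OF T]] by simp
    next
      case False
      then show ?thesis using along_unit[of "(y - x) /\<^sub>R norm (y - x)" "norm (y - x)"] y by simp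
    qed
  qed
qed

theorem rademacher: "AE x in lborel. g differentiable (at x)"
proof -
  obtain D :: "'a set" where D: "countable D" "\<And>U. open U \<Longrightarrow> U \<noteq> {} \<Longrightarrow> \<exists>v\<in>D. v \<in> U"
    using countable_dense_setE by blast
  have "AE x in lborel. \<forall>v\<in>D. right_deriv_along g v x (\<Sum>b\<in>Basis. (v \<bullet> b) * rderiv g b x)"
    using D(1) by (simp add: AE_ball_countable right_deriv_along_linear_AE)
  then show ?thesis
  proof eventually_elim
    case (elim x)
    have "(g has_derivative (\<lambda>v. \<Sum>b\<in>Basis. (v \<bullet> b) * rderiv g b x)) (at x)"
    proof (rule has_derivative_if_right_deriv_along_dense)
      show "bounded_linear (\<lambda>v. \<Sum>b\<in>Basis. (v \<bullet> b) * rderiv g b x)"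
        by (intro bounded_linear_sum bounded_linear_mult_const bounded_linear_inner_left)
    qed (use D(2) elim in auto)
    then show ?case by (auto simp: differentiable_def)
  qed
qed

end

subsection \<open>Increments of Lipschitz functions\<close>

lemma lipschitz_increment_le_AE_line:
  fixes g :: "'a::euclidean_space \<Rightarrow> real"
  assumes lip: "L-lipschitz_on UNIV g"
    and deriv_le: "AE t::real in lborel. t \<in> {0<..<1} \<longrightarrow> (\<exists>D. (g has_derivative D) (at (z + t *\<^sub>R v)) \<and> D v \<le> c)"
  shows "g (z + v) - g z \<le> c"
proof -
  have "AE t in lborel. t \<in> {0<..<1} \<longrightarrow> (\<forall>d. ((\<lambda>t. g (z + t *\<^sub>R v)) has_real_derivative d) (at_right t) \<longrightarrow> d \<le> c)"
    using deriv_le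
  proof eventually_elim
    case (elim t)
    show ?case
    proof (intro impI allI)
      fix d
      assume "t \<in> {0<..<1}" and d: "((\<lambda>t. g (z + t *\<^sub>R v)) has_real_derivative d) (at_right t)"
      then obtain D where D: "(g has_derivative D) (at (z + t *\<^sub>R v))" "D v \<le> c" using elim by blast
      have "d = D v"
        using rderiv_eqI[OF has_derivative_imp_right_deriv_along[OF D(1)]]
          rderiv_eqI[OF d[unfolded right_deriv_along_shift]] by simp
      then show "d \<le> c" using D(2) by simp
    qed
  qed
  from lipschitz_on_right_derivative_le[OF lipschitz_along_line[OF lip] _ this] show ?thesis by simp
qed

lemma lipschitz_increment_le:
  fixes g :: "'a::euclidean_space \<Rightarrow> real"
  assumes lip: "L-lipschitz_on UNIV g" and seg: "closed_segment z (z + v) \<subseteq> S" and S: "open S"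
    and deriv_le: "\<And>y D. y \<in> S \<Longrightarrow> (g has_derivative D) (at y) \<Longrightarrow> D v \<le> c"
  shows "g (z + v) - g z \<le> c"
proof -
  obtain r where r: "r > 0" "(\<Union>x\<in>closed_segment z (z + v). ball x r) \<subseteq> S"
    using compact_subset_open_imp_ball_epsilon_subset[OF compact_segment S seg] by blast
  have good: "AE y in lborel. AE t::real in lborel. t \<in> {0<..<1} \<longrightarrow> g differentiable (at (y + t *\<^sub>R v))"
    by (rule AE_lborel_imp_AE_on_lines[OF rademacher[OF lip]])
  have "\<exists>y. dist y z < inverse (real (Suc k)) \<and> g (y + v) - g y \<le> c" for k
  proof -
    have "z \<in> ball z (min r (inverse (real (Suc k))))" using r(1) by (simp del: of_nat_Suc)
    then have "ball z (min r (inverse (real (Suc k)))) \<noteq> {}" by blast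
    then obtain y where y: "y \<in> ball z (min r (inverse (real (Suc k))))"
      and diff: "AE t::real in lborel. t \<in> {0<..<1} \<longrightarrow> g differentiable (at (y + t *\<^sub>R v))"
      using ex_in_open_if_AE_lborel[OF good open_ball] by blast
    have in_S: "y + t *\<^sub>R v \<in> S" if "t \<in> {0<..<1}" for t
    proof -
      have "z + t *\<^sub>R v \<in> closed_segment z (z + v)"
        unfolding in_segment using that by (intro exI[of _ t]) (auto simp: algebra_simps)
      moreover have "y + t *\<^sub>R v \<in> ball (z + t *\<^sub>R v) r" using y by (simp add: dist_norm)
      ultimately show ?thesis using r(2) by blast
    qed
    have "AE t::real in lborel. t \<in> {0<..<1} \<longrightarrow> (\<exists>D. (g has_derivative D) (at (y + t *\<^sub>R v)) \<and> D v \<le> c)"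
      using diff by eventually_elim (use deriv_le in_S in \<open>auto simp: differentiable_def\<close>)
    from lipschitz_increment_le_AE_line[OF lip this] show ?thesis
      using y by (auto simp: dist_commute)
  qed
  then obtain y where y: "\<And>k. dist (y k) z < inverse (real (Suc k))" "\<And>k. g (y k + v) - g (y k) \<le> c"
    by metis
  have "(\<lambda>k. dist (y k) z) \<longlonglongrightarrow> 0"
    by (rule tendsto_sandwich[OF _ _ tendsto_const LIMSEQ_inverse_real_of_nat])
      (use y(1) in \<open>auto intro: always_eventually less_imp_le\<close>)
  then have "y \<longlonglongrightarrow> z" by (subst tendsto_dist_iff)
  then have "(\<lambda>k. g (y k + v) - g (y k)) \<longlonglongrightarrow> g (z + v) - g z"
    by (intro tendsto_diff continuous_on_tendsto_compose[OF continuous_on_lipschitz[OF lip, of UNIV]]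
      tendsto_add tendsto_const) auto
  then show ?thesis by (rule LIMSEQ_le_const2) (use y(2) in blast)
qed

lemma lipschitz_on_cball_increment_le:
  fixes g :: "'a::euclidean_space \<Rightarrow> real"
  assumes lip: "L-lipschitz_on (cball x r) g" and z: "z \<in> ball x r" "z + v \<in> ball x r"
    and deriv_le: "\<And>y D. y \<in> ball x r \<Longrightarrow> (g has_derivative D) (at y) \<Longrightarrow> D v \<le> c"
  shows "g (z + v) - g z \<le> c"
proof -
  let ?c = "closest_point (cball x r)"
  have ne: "cball x r \<noteq> {}" using z(1) ball_subset_cball by blast
  define G where "G y = g (?c y)" for y
  have G_lip: "L-lipschitz_on UNIV G"
  proof (rule lipschitz_onI)
    fix p q
    have "dist (G p) (G q) \<le> L * dist (?c p) (?c q)"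
      unfolding G_def
        using closest_point_in_set[OF closed_cball ne] by (intro lipschitz_onD[OF lip]) auto
    also have "\<dots> \<le> L * dist p q"
      by (intro mult_left_mono closest_point_lipschitz[OF convex_cball closed_cball ne] lipschitz_on_nonneg[OF lip])
    finally show "dist (G p) (G q) \<le> L * dist p q" .
  qed (rule lipschitz_on_nonneg[OF lip])
  have G_eq: "G y = g y" if "y \<in> ball x r" for y
    using that closest_point_self[of y "cball x r"] by (auto simp: G_def)
  have "G (z + v) - G z \<le> c"
  proof (rule lipschitz_increment_le[OF G_lip])
    show "closed_segment z (z + v) \<subseteq> ball x r" using z by (rule closed_segment_subset) auto
    show "D v \<le> c" if "y \<in> ball x r" "(G has_derivative D) (at y)" for y D
      using deriv_le[OF that(1)] has_derivative_transform_within_open[OF that(2) open_ball that(1) G_eq]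
        by blast
  qed auto
  then show ?thesis using G_eq z by simp
qed

lemma lipschitz_derivative_bound:
  fixes g :: "'a::real_normed_vector \<Rightarrow> real"
  assumes lip: "K-lipschitz_on S g" and S: "open S" "y \<in> S" and D: "(g has_derivative D) (at y)"
  shows "\<bar>D v\<bar> \<le> K * norm v"
proof (rule tendsto_upperbound[OF tendsto_rabs])
  show "((\<lambda>h. (g (y + h *\<^sub>R v) - g y) / h) \<longlongrightarrow> D v) (at_right 0)"
    using has_derivative_imp_right_deriv_along[OF D] by (simp add: right_deriv_along_iff)
  have "((\<lambda>h. y + h *\<^sub>R v) \<longlongrightarrow> y + 0 *\<^sub>R v) (at_right 0)" by (intro tendsto_intros)
  then have "eventually (\<lambda>h. y + h *\<^sub>R v \<in> S) (at_right 0)"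
    using S by (intro topological_tendstoD) auto
  then show "eventually (\<lambda>h. \<bar>(g (y + h *\<^sub>R v) - g y) / h\<bar> \<le> K * norm v) (at_right 0)"
    using eventually_at_right_less
  proof eventually_elim
    case (elim h)
    then show ?case using lipschitz_onD[OF lip elim(1) S(2)] by (simp add: dist_norm field_simps)
  qed
qed simp

text \<open>Freezing the direction costs \<open>D (\<Phi> y - \<Phi> z)\<close>, which is small near \<open>y\<close> because \<open>K\<close> bounds the
  norm of every derivative \<open>D\<close>.\<close>
lemma increment_along_field:
  fixes g :: "'a::euclidean_space \<Rightarrow> real" and \<Phi> :: "'a \<Rightarrow> 'a"
  assumes lip: "K-lipschitz_on (cball y r) g" and r: "0 < r"
    and \<Phi>: "isCont \<Phi> y" and \<beta>: "isCont \<beta> y"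
    and decay: "\<And>z D. z \<in> ball y r \<Longrightarrow> (g has_derivative D) (at z) \<Longrightarrow> D (\<Phi> z) \<le> - \<beta> z"
    and \<epsilon>: "0 < \<epsilon>"
  obtains \<delta> where "0 < \<delta>" "\<And>z h. 0 \<le> h \<Longrightarrow> z \<in> ball y \<delta> \<Longrightarrow> z + h *\<^sub>R \<Phi> y \<in> ball y \<delta> \<Longrightarrow>
    g (z + h *\<^sub>R \<Phi> y) \<le> g z + h * (\<epsilon> - \<beta> y)"
proof -
  have "eventually (\<lambda>z. K * norm (\<Phi> y - \<Phi> z) - (\<beta> z - \<beta> y) < \<epsilon>) (nhds y)"
  proof (rule order_tendstoD(2))
    have "((\<lambda>z. K * norm (\<Phi> y - \<Phi> z) - (\<beta> z - \<beta> y)) \<longlongrightarrow> K * norm (\<Phi> y - \<Phi> y) - (\<beta> y - \<beta> y)) (nhds y)"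
      using \<Phi> \<beta> by (intro tendsto_intros) (auto simp: isCont_def tendsto_at_iff_tendsto_nhds)
    then show "((\<lambda>z. K * norm (\<Phi> y - \<Phi> z) - (\<beta> z - \<beta> y)) \<longlongrightarrow> 0) (nhds y)" by simp
  qed (rule \<epsilon>)
  then obtain d where d: "d > 0" "\<And>z. dist z y < d \<Longrightarrow> K * norm (\<Phi> y - \<Phi> z) - (\<beta> z - \<beta> y) < \<epsilon>"
    unfolding eventually_nhds_metric by blast
  define \<delta> where "\<delta> = min r d"
  have \<delta>: "0 < \<delta>" "\<delta> \<le> r" "\<delta> \<le> d" using r d by (auto simp: \<delta>_def)
  have "g (z + h *\<^sub>R \<Phi> y) - g z \<le> h * (\<epsilon> - \<beta> y)"
    if h: "0 \<le> h" and z: "z \<in> ball y \<delta>" "z + h *\<^sub>R \<Phi> y \<in> ball y \<delta>" for z h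
  proof (rule lipschitz_on_cball_increment_le[OF _ z])
    show "K-lipschitz_on (cball y \<delta>) g"
      using lip \<delta>(2) by (rule lipschitz_on_subset[OF _ subset_cball])
    fix p D assume p: "p \<in> ball y \<delta>" and D: "(g has_derivative D) (at p)"
    have linear: "linear D" using D has_derivative_linear by blast
    have p': "p \<in> ball y r" "dist p y < d" using p \<delta> by (auto simp: dist_commute)
    have "\<bar>D (\<Phi> y - \<Phi> p)\<bar> \<le> K * norm (\<Phi> y - \<Phi> p)"
      by (rule lipschitz_derivative_bound[OF lipschitz_on_subset[OF lip ball_subset_cball] open_ball p'(1) D])
    moreover have "D (\<Phi> y) = D (\<Phi> y - \<Phi> p) + D (\<Phi> p)" using linear_diff[OF linear] by simp
    ultimately have "D (\<Phi> y) \<le> \<epsilon> - \<beta> y" using decay[OF p'(1) D] d(2)[OF p'(2)] by linarith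
    then show "D (h *\<^sub>R \<Phi> y) \<le> h * (\<epsilon> - \<beta> y)"
      using h by (simp add: linear_scale[OF linear] mult_left_mono)
  qed
  then show ?thesis using \<delta>(1) by (intro that[of \<delta>]) (auto simp: algebra_simps)
qed

lemma eventually_add_scaleR_in_ball:
  fixes y v :: "'a::real_normed_vector"
  assumes "0 < \<delta>" shows "eventually (\<lambda>h. y + h *\<^sub>R v \<in> ball y \<delta>) (at_right 0)"
proof -
  have "((\<lambda>h. y + h *\<^sub>R v) \<longlongrightarrow> y + 0 *\<^sub>R v) (at_right 0)" by (intro tendsto_intros)
  then show ?thesis using assms by (intro topological_tendstoD) auto
qed

section \<open>Input-to-state stability from a Lyapunov function\<close>

subsection \<open>Proper positive definite functions\<close>

lemma proper_posdef_nonneg: "proper_posdef S V \<Longrightarrow> x \<in> S \<Longrightarrow> 0 \<le> V x"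
  unfolding proper_posdef_def by (meson classKinfD classK_nonneg norm_ge_zero order_trans)

lemma proper_posdef_0: "proper_posdef S V \<Longrightarrow> 0 \<in> S \<Longrightarrow> V 0 = 0"
  unfolding proper_posdef_def by (metis antisym classKinfD classK_0 norm_zero)

lemma proper_posdef_value_bounds:
  assumes V: "proper_posdef S V" and p: "0 < p"
  obtains c d where "0 < c" "\<And>y. y \<in> S \<Longrightarrow> norm y \<in> {p..q} \<Longrightarrow> V y \<in> {c..d}"
proof -
  obtain \<psi>\<^sub>1 \<psi>\<^sub>2 where \<psi>: "classK \<psi>\<^sub>1" "classK \<psi>\<^sub>2"
    and bounds: "\<And>y. y \<in> S \<Longrightarrow> \<psi>\<^sub>1 (norm y) \<le> V y" "\<And>y. y \<in> S \<Longrightarrow> V y \<le> \<psi>\<^sub>2 (norm y)"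
    using V classKinfD unfolding proper_posdef_def by blast
  have "V y \<in> {\<psi>\<^sub>1 p..\<psi>\<^sub>2 q}" if "y \<in> S" "norm y \<in> {p..q}" for y
    using bounds[OF that(1)] classK_mono[OF \<psi>(1), of p "norm y"] classK_mono[OF \<psi>(2), of "norm y" q] that(2) p
      by auto
  moreover have "0 < \<psi>\<^sub>1 p" by (rule classK_pos[OF \<psi>(1) p])
  ultimately show ?thesis by (rule that[rotated])
qed

lemma proper_posdef_pos:
  assumes "proper_posdef S V" "x \<in> S" "x \<noteq> 0" shows "0 < V x"
proof -
  obtain c d where "0 < c" "\<And>y. y \<in> S \<Longrightarrow> norm y \<in> {norm x..norm x} \<Longrightarrow> V y \<in> {c..d}"
    using proper_posdef_value_bounds[OF assms(1)] assms(3) by (metis zero_less_norm_iff)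
  from this(1) this(2)[OF assms(2)] show ?thesis by simp
qed

lemma proper_posdef_norm_bounds:
  assumes V: "proper_posdef S V" and p: "0 < p"
  obtains c d where "0 < c" "\<And>y. y \<in> S \<Longrightarrow> V y \<in> {p..q} \<Longrightarrow> norm y \<in> {c..d}"
proof -
  obtain \<psi>\<^sub>1 \<psi>\<^sub>2 where \<psi>: "classKinf \<psi>\<^sub>1" "classKinf \<psi>\<^sub>2"
    and bounds: "\<And>y. y \<in> S \<Longrightarrow> \<psi>\<^sub>1 (norm y) \<le> V y" "\<And>y. y \<in> S \<Longrightarrow> V y \<le> \<psi>\<^sub>2 (norm y)"
    using V unfolding proper_posdef_def by blast
  have "norm y \<in> {sinv \<psi>\<^sub>2 p..sinv \<psi>\<^sub>1 q}" if "y \<in> S" "V y \<in> {p..q}" for y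
  proof -
    have "p \<le> \<psi>\<^sub>2 (norm y)" "\<psi>\<^sub>1 (norm y) \<le> q" "0 \<le> q" using bounds[OF that(1)] that(2) p by auto
    then show ?thesis using p by (simp add: sinv_le_iff[OF \<psi>(2)] le_sinv_iff[OF \<psi>(1)])
  qed
  moreover have "0 < sinv \<psi>\<^sub>2 p" by (rule classK_pos[OF classKinfD[OF classKinf_sinv[OF \<psi>(2)]] p])
  ultimately show ?thesis by (rule that[rotated])
qed

lemma ex_posdef_lower_bound_on_level_band:
  assumes "proper_posdef S V" "posdef \<alpha>" "0 < p"
  shows "\<exists>\<mu>>0. \<forall>y\<in>S. V y \<in> {p..q} \<longrightarrow> \<mu> \<le> \<alpha> (norm y)"
proof -
  obtain c d where "0 < c" and norm_in: "\<And>y. y \<in> S \<Longrightarrow> V y \<in> {p..q} \<Longrightarrow> norm y \<in> {c..d}"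
    using proper_posdef_norm_bounds[OF assms(1,3)] by metis
  obtain \<mu> where "0 < \<mu>" "\<And>r. r \<in> {c..d} \<Longrightarrow> \<mu> \<le> \<alpha> r"
    using posdef_lower_bound_on_interval[OF assms(2) \<open>0 < c\<close>] by metis
  then show ?thesis using norm_in by blast
qed

lemma ex_posdef_minorant_along_levels:
  assumes "proper_posdef S V" "posdef \<alpha>"
  shows "\<exists>a. posdef a \<and> (\<forall>y\<in>S. 0 < V y \<longrightarrow> a (V y) \<le> \<alpha> (norm y)) \<and> (\<forall>r\<ge>0. a r \<le> r)"
proof -
  have "\<exists>a. posdef a \<and> (\<forall>r>0. \<forall>y\<in>S. V y = r \<longrightarrow> a r \<le> \<alpha> (norm y)) \<and> (\<forall>r\<ge>0. a r \<le> r)"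
  proof (rule ex_posdef_satisfying[of "\<lambda>r c. \<forall>y\<in>S. V y = r \<longrightarrow> c \<le> \<alpha> (norm y)"])
    show "\<exists>c>0. \<forall>r\<in>{p..q}. \<forall>y\<in>S. V y = r \<longrightarrow> c \<le> \<alpha> (norm y)" if "0 < p" for p q
      using ex_posdef_lower_bound_on_level_band[OF assms that, of q] by blast
  qed fastforce
  then show ?thesis by blast
qed

subsection \<open>Exponential gauges\<close>

lemma classKL_exp_decay:
  assumes g: "classKinf g" and h: "classKinf h"
  shows "classKL (\<lambda>s t. g (exp (- t) * h s))"
  unfolding classKL_def
proof (intro conjI allI impI)
  note gK = classKinfD[OF g] and hK = classKinfD[OF h]
  have "continuous_on ({0..} \<times> {0..}) (\<lambda>p::real \<times> real. g (exp (- snd p) * h (fst p)))"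
  proof (rule continuous_on_compose2[OF classK_cont[OF gK]])
    show "continuous_on ({0..} \<times> {0..}) (\<lambda>p::real \<times> real. exp (- snd p) * h (fst p))"
      by (intro continuous_intros continuous_on_compose2[OF classK_cont[OF hK]]) auto
  qed (auto simp: classK_nonneg[OF hK])
  then show "continuous_on ({0..} \<times> {0..}) (\<lambda>(s, t). g (exp (- t) * h s))"
    by (simp add: case_prod_beta')
  show "classK (\<lambda>s. g (exp (- t) * h s))" for t
  proof (rule classK_compose[OF gK])
    show "classK (\<lambda>s. exp (- t) * h s)"
      by (rule classKI) (auto simp: classK_0[OF hK] classK_less[OF hK] intro!: continuous_intros classK_cont[OF hK])
  qed
  fix s :: real assume s: "0 \<le> s"
  show "g (exp (- t2) * h s) \<le> g (exp (- t1) * h s)" if "t1 \<le> t2" for t1 t2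
    by (rule classK_mono[OF gK]) (use that classK_nonneg[OF hK s] in \<open>auto intro!: mult_right_mono\<close>)
  have exp_lim: "((\<lambda>t. exp (- t)) \<longlongrightarrow> (0::real)) at_top"
    by (rule filterlim_compose[OF exp_at_bot filterlim_uminus_at_bot_at_top])
  have "((\<lambda>t. exp (- t) * h s) \<longlongrightarrow> 0 * h s) at_top" by (intro tendsto_intros exp_lim)
  then have "((\<lambda>t. g (exp (- t) * h s)) \<longlongrightarrow> g 0) at_top"
    by (intro classK_tendsto[OF gK]) (use classK_nonneg[OF hK s] in auto)
  then show "((\<lambda>t. g (exp (- t) * h s)) \<longlongrightarrow> 0) at_top" by (simp add: classK_0[OF gK])
qed

text \<open>\<open>E s - E r\<close> is the time that the solution of \<open>w' = - a w\<close> takes from \<open>s\<close> down to \<open>r\<close>.\<close>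
definition decay_clock :: "(real \<Rightarrow> real) \<Rightarrow> (real \<Rightarrow> real) \<Rightarrow> bool" where
  "decay_clock a E \<longleftrightarrow> (\<forall>r>0. (E has_real_derivative inverse (a r)) (at r))"

lemma ex_decay_clock:
  assumes "posdef a" shows "\<exists>E. decay_clock a E"
proof -
  have "\<exists>E. \<forall>x::real. (0::ereal) < x \<longrightarrow> x < \<infinity> \<longrightarrow> (E has_vector_derivative inverse (a x)) (at x)"
  proof (rule einterval_antiderivative)
    fix x :: real assume "(0::ereal) < x"
    then have x: "x \<in> {0<..}" by simp
    have "continuous_on {0<..} a" using posdef_cont[OF assms] by (rule continuous_on_subset) auto
    then have "isCont a x" using x by (simp add: continuous_on_eq_continuous_at)
    then show "isCont (\<lambda>x. inverse (a x)) x"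
      using posdef_pos[OF assms, of x] x by (intro continuous_intros) auto
  qed simp
  then show ?thesis by (auto simp: decay_clock_def has_real_derivative_iff_has_vector_derivative)
qed

lemma decay_clock_less:
  assumes E: "decay_clock a E" and a: "posdef a" and "0 < x" "x < y"
  shows "E x < E y"
proof (rule DERIV_pos_imp_increasing[OF \<open>x < y\<close>])
  fix z assume "x \<le> z" "z \<le> y"
  then have "0 < z" using assms by simp
  then show "\<exists>d. DERIV E z :> d \<and> d > 0"
    using E posdef_pos[OF a] by (intro exI[of _ "inverse (a z)"]) (simp add: decay_clock_def)
qed

lemma decay_clock_lipschitz_on:
  assumes E: "decay_clock a E" and a: "posdef a" and c_pos: "0 < c"
  obtains L where "L-lipschitz_on {c..d} E"
proof -
  obtain \<mu> where \<mu>: "0 < \<mu>" "\<And>r. r \<in> {c..d} \<Longrightarrow> \<mu> \<le> a r"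
    using posdef_lower_bound_on_interval[OF a c_pos] by metis
  have "\<bar>E x - E y\<bar> \<le> inverse \<mu> * \<bar>x - y\<bar>" if "x \<in> {c..d}" "y \<in> {c..d}" for x y
  proof (rule field_differentiable_bound[of "{c..d}" E "\<lambda>r. inverse (a r)", unfolded real_norm_def, OF _ _ _ that])
    fix r assume r: "r \<in> {c..d}"
    show "(E has_real_derivative inverse (a r)) (at r within {c..d})"
      using E r c_pos by (simp add: decay_clock_def has_field_derivative_at_within)
    show "\<bar>inverse (a r)\<bar> \<le> inverse \<mu>" using \<mu>(1) \<mu>(2)[OF r] by (simp add: le_imp_inverse_le)
  qed simp
  then have "(inverse \<mu>)-lipschitz_on {c..d} E"
    using \<mu>(1) by (intro lipschitz_onI) (auto simp: dist_real_def)
  then show ?thesis by (rule that)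
qed

lemma decay_clock_minus_ln_mono:
  assumes E: "decay_clock a E" and a: "posdef a" and a_le: "\<And>r. 0 \<le> r \<Longrightarrow> a r \<le> r" and "0 < x" "x \<le> y"
  shows "E x - ln x \<le> E y - ln y"
proof (rule DERIV_nonneg_imp_nondecreasing[OF \<open>x \<le> y\<close>])
  fix z assume "x \<le> z" "z \<le> y"
  then have z: "0 < z" using assms by simp
  have "((\<lambda>z. E z - ln z) has_real_derivative inverse (a z) - inverse z) (at z)"
    using z E by (auto intro!: derivative_eq_intros simp: decay_clock_def divide_inverse)
  moreover have "inverse z \<le> inverse (a z)"
    using a_le[of z] posdef_pos[OF a z] z by (intro le_imp_inverse_le) auto
  ultimately show "\<exists>d. DERIV (\<lambda>z. E z - ln z) z :> d \<and> 0 \<le> d" by (intro exI conjI) auto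
qed

definition exp_gauge :: "(real \<Rightarrow> real) \<Rightarrow> real \<Rightarrow> real" where
  "exp_gauge E r = (if 0 < r then exp (E r) else 0)"

text \<open>The bound \<open>a r \<le> r\<close> makes \<open>1 / a\<close> non-integrable both at \<open>0\<close> and at infinity.\<close>
lemma classKinf_exp_gauge:
  assumes E: "decay_clock a E" and a: "posdef a" and a_le: "\<And>r. 0 \<le> r \<Longrightarrow> a r \<le> r"
  shows "classKinf (exp_gauge E)"
proof (rule classKinfI, rule classKI_pos)
  note ln_mono = decay_clock_minus_ln_mono[OF E a a_le]
  show "exp_gauge E x < exp_gauge E y" if "0 < x" "x < y" for x y
    using decay_clock_less[OF E a that] that by (simp add: exp_gauge_def)
  have "isCont E x" if "0 < x" for x
    using E that DERIV_isCont[of E] by (auto simp: decay_clock_def)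
  then have "continuous_on {0<..} (\<lambda>x. exp (E x))"
    by (intro continuous_intros continuous_at_imp_continuous_on) auto
  then show "continuous_on {0<..} (exp_gauge E)"
    by (rule continuous_on_eq) (simp add: exp_gauge_def)
  show "\<exists>d>0. exp_gauge E d < e" if e: "0 < e" for e
  proof (intro exI conjI)
    let ?d = "min 1 (e / (2 * exp (E 1)))"
    show d: "0 < ?d" using e by simp
    have "E ?d \<le> E 1 + ln ?d" using ln_mono[of ?d 1] d by simp
    then have "exp (E ?d) \<le> exp (E 1 + ln ?d)" by simp
    also have "\<dots> = exp (E 1) * ?d" using d by (simp add: exp_add)
    also have "\<dots> \<le> exp (E 1) * (e / (2 * exp (E 1)))" by (intro mult_left_mono) auto
    also have "\<dots> < e" using e by simp
    finally show "exp_gauge E ?d < e" using d by (simp add: exp_gauge_def)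
  qed
  show "\<exists>x\<ge>0. M \<le> exp_gauge E x" for M
  proof -
    define x where "x = max 1 (M / exp (E 1))"
    have x: "1 \<le> x" "M / exp (E 1) \<le> x" by (auto simp: x_def)
    have "M \<le> exp (E 1) * x" using x(2) by (simp add: field_simps)
    also have "\<dots> = exp (E 1 + ln x)" using x by (simp add: exp_add)
    also have "\<dots> \<le> exp_gauge E x" using ln_mono[of 1 x] x by (simp add: exp_gauge_def)
    finally show ?thesis using x by (intro exI[of _ x]) auto
  qed
qed (auto simp: exp_gauge_def)

lemma decay_clock_comparison:
  assumes E: "decay_clock a E" and a: "posdef a"
    and lip: "L-lipschitz_on {s..t} w" and st: "s \<le> t" and pos: "\<And>\<tau>. \<tau> \<in> {s..t} \<Longrightarrow> 0 < w \<tau>"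
    and decay: "AE \<tau> in lborel. \<tau> \<in> {s<..<t} \<longrightarrow>
      (\<forall>d. (w has_real_derivative d) (at_right \<tau>) \<longrightarrow> d \<le> - a (w \<tau>))"
  shows "E (w t) + t \<le> E (w s) + s"
proof -
  have w_cont: "continuous_on {s..t} w" using lip by (rule lipschitz_on_continuous_on)
  obtain p where p: "p \<in> {s..t}" "\<And>\<tau>. \<tau> \<in> {s..t} \<Longrightarrow> w p \<le> w \<tau>"
    using continuous_attains_inf[OF _ _ w_cont] st by auto
  obtain q where q: "\<And>\<tau>. \<tau> \<in> {s..t} \<Longrightarrow> w \<tau> \<le> w q"
    using continuous_attains_sup[OF _ _ w_cont] st by (auto simp del: atLeastAtMost_iff)
  obtain K where "K-lipschitz_on {w p..w q} E" using decay_clock_lipschitz_on[OF E a pos[OF p(1)]] .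
  then have "K-lipschitz_on (w ` {s..t}) E" by (rule lipschitz_on_subset) (use p q in auto)
  then have Ew_lip: "(K * L)-lipschitz_on {s..t} (\<lambda>\<tau>. E (w \<tau>))"
    by (rule lipschitz_on_compose2[OF lip])
  obtain w' where w': "AE \<tau> in lborel. \<tau> \<in> {s..<t} \<longrightarrow> (w has_real_derivative w' \<tau>) (at_right \<tau>)"
    using lipschitz_on_ex_right_derivative[OF lip] by blast
  have "E (w t) - E (w s) \<le> - 1 * (t - s)"
  proof (rule lipschitz_on_right_derivative_le[OF Ew_lip st])
    show "AE \<tau> in lborel. \<tau> \<in> {s<..<t} \<longrightarrow>
        (\<forall>d. ((\<lambda>\<tau>. E (w \<tau>)) has_real_derivative d) (at_right \<tau>) \<longrightarrow> d \<le> - 1)"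
      using w' decay
    proof eventually_elim
      case (elim \<tau>)
      show ?case
      proof (intro impI allI)
        fix d assume \<tau>: "\<tau> \<in> {s<..<t}" and d: "((\<lambda>\<tau>. E (w \<tau>)) has_real_derivative d) (at_right \<tau>)"
        have w\<tau>: "0 < w \<tau>" using pos \<tau> by simp
        have deriv: "(w has_real_derivative w' \<tau>) (at_right \<tau>)" and w'_le: "w' \<tau> \<le> - a (w \<tau>)"
          using elim \<tau> by auto
        have "((\<lambda>\<tau>. E (w \<tau>)) has_real_derivative inverse (a (w \<tau>)) * w' \<tau>) (at_right \<tau>)"
          using DERIV_chain[OF _ deriv] E w\<tau> by (simp add: decay_clock_def o_def)
        with d have "d = inverse (a (w \<tau>)) * w' \<tau>"
          unfolding has_real_derivative_at_right_iff by (rule tendsto_unique[rotated]) simp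
        also have "\<dots> \<le> inverse (a (w \<tau>)) * - a (w \<tau>)"
          using w'_le posdef_pos[OF a w\<tau>] by (intro mult_left_mono) auto
        also have "\<dots> = - 1" using posdef_pos[OF a w\<tau>] by simp
        finally show "d \<le> - 1" .
      qed
    qed
  qed
  then show ?thesis by simp
qed

lemma ex_last_time_le:
  fixes w :: "real \<Rightarrow> real"
  assumes "continuous_on {a..b} w" "\<tau> \<in> {a..b}" "w \<tau> \<le> c"
  obtains s where "s \<in> {a..b}" "w s \<le> c" "\<And>r. s < r \<Longrightarrow> r \<le> b \<Longrightarrow> c < w r"
proof -
  let ?S = "{r \<in> {a..b}. w r \<le> c}"
  have "closed ?S" by (intro continuous_on_closed_Collect_le assms(1)) auto
  moreover have "bounded ?S" by (rule bounded_subset[OF bounded_closed_interval]) auto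
  ultimately have "compact ?S" by (simp add: compact_eq_bounded_closed)
  moreover have "?S \<noteq> {}" using assms(2,3) by auto
  ultimately obtain s where s: "s \<in> ?S" "\<And>r. r \<in> ?S \<Longrightarrow> r \<le> s"
    using compact_attains_sup[of ?S] by blast
  show ?thesis
  proof (rule that)
    show "s \<in> {a..b}" "w s \<le> c" using s(1) by auto
    show "c < w r" if "s < r" "r \<le> b" for r
      using s(1) s(2)[of r] that by (auto simp: not_le[symmetric])
  qed
qed

text \<open>Just after the last time at level \<open>c\<close> the value \<open>w t > c\<close> is not yet reached, which contradicts
  the decay from there on. Hence \<open>w\<close> stays above \<open>c\<close> on the whole interval.\<close>
lemma decay_above_level:
  fixes w E :: "real \<Rightarrow> real"
  assumes cont: "continuous_on {0..t} w" and t: "0 \<le> t" and c_bounds: "0 \<le> c" "c < w t"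
    and E_less: "\<And>x y. 0 < x \<Longrightarrow> x < y \<Longrightarrow> E x < E y"
    and decay: "\<And>s. s \<in> {0..t} \<Longrightarrow> (\<And>\<tau>. \<tau> \<in> {s..t} \<Longrightarrow> c < w \<tau>) \<Longrightarrow> E (w t) + t \<le> E (w s) + s"
  shows "E (w t) + t \<le> E (w 0)" "c < w 0"
proof -
  have above: "c < w \<tau>" if \<tau>: "\<tau> \<in> {0..t}" for \<tau>
  proof (rule ccontr)
    assume "\<not> c < w \<tau>"
    then have "w \<tau> \<le> c" by simp
    from ex_last_time_le[OF cont \<tau> this] obtain s where s: "s \<in> {0..t}" "w s \<le> c"
      and later: "\<And>r. s < r \<Longrightarrow> r \<le> t \<Longrightarrow> c < w r" by blast
    have st: "s < t" using s c_bounds by (cases "s = t") auto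
    have "continuous_on {s..t} w" using cont by (rule continuous_on_subset) (use s in auto)
    then have "(w \<longlongrightarrow> w s) (at_right s)" using st by (simp add: continuous_on_Icc_at_rightD)
    then have "eventually (\<lambda>r. w r < w t) (at_right s)"
      by (rule order_tendstoD(2)) (use s c_bounds in simp)
    moreover have "eventually (\<lambda>r. r \<in> {s<..<t}) (at_right s)"
      using st by (rule eventually_at_right_real)
    ultimately obtain r where r: "w r < w t" "r \<in> {s<..<t}"
      using eventually_happens[OF eventually_conj] trivial_limit_at_right_real by blast
    have "E (w t) + t \<le> E (w r) + r" by (rule decay) (use r s later in auto)
    moreover have "E (w r) < E (w t)" using r later[of r] c_bounds by (intro E_less) auto
    ultimately show False using r by simp
  qed
  show "E (w t) + t \<le> E (w 0)" using decay[of 0] above t by simp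
  show "c < w 0" using above t by simp
qed

subsection \<open>Solutions\<close>

lemma indefinite_integral_on_lipschitz_on:
  fixes F :: "real \<Rightarrow> 'a::euclidean_space"
  assumes k: "indefinite_integral_on S k F" and S: "is_interval S" and M: "0 \<le> M"
    and bound: "AE t in lborel. t \<in> S \<longrightarrow> norm (k t) \<le> M"
  shows "M-lipschitz_on S F"
proof (rule lipschitz_on_leI[OF _ M])
  fix s t :: real assume st: "s \<in> S" "t \<in> S" "s \<le> t"
  have sub: "{s..t} \<subseteq> S" using mem_is_interval_1_I[OF S st(1,2)] by auto
  have "(k has_integral F t - F s) {s..t}" by (rule indefinite_integral_onD[OF k st(3) sub])
  moreover have "negligible {t. \<not> (t \<in> S \<longrightarrow> norm (k t) \<le> M)}"
    using bound by (simp add: AE_lborel_iff_negligible)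
  ultimately have "((\<lambda>t. if t \<in> S \<and> norm (k t) \<le> M then k t else 0) has_integral F t - F s) {s..t}"
    by (rule has_integral_spike[rotated 2]) (use sub in auto)
  then have "norm (F t - F s) \<le> M * measure lborel {s..t}"
    using M by (intro has_integral_bound_real[of _ "{}"]) auto
  then show "dist (F s) (F t) \<le> M * dist s t" using st by (simp add: dist_norm norm_minus_commute)
qed

lemma indefinite_integral_on_if_eq_integral:
  assumes I: "I \<subseteq> {0..}" and int: "\<And>t. t \<in> I \<Longrightarrow> k integrable_on {0..t}"
    and eq: "\<And>t. t \<in> I \<Longrightarrow> F t = c + integral {0..t} k"
  shows "indefinite_integral_on I k F"
  unfolding indefinite_integral_on_def
proof (intro allI impI)
  fix s t :: real assume st: "s \<le> t" "{s..t} \<subseteq> I"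
  then have I_st: "s \<in> I" "t \<in> I" by auto
  then have s: "0 \<le> s" using I by auto
  have "integral {0..s} k + integral {s..t} k = integral {0..t} k"
    using s st(1) int[OF I_st(2)] by (rule Henstock_Kurzweil_Integration.integral_combine)
  then have "F t - F s = integral {s..t} k" by (simp add: eq I_st algebra_simps)
  moreover have "k integrable_on {s..t}"
    by (rule integrable_subinterval_real[OF int[OF I_st(2)]]) (use s in auto)
  ultimately show "(k has_integral F t - F s) {s..t}" by (simp add: integrable_integral)
qed

lemma is_solution_imp_indefinite_integral:
  "is_solution F x0 u {0..T} x \<Longrightarrow> indefinite_integral_on {0..T} (\<lambda>s. F (x s) (u s)) x"
  by (rule indefinite_integral_on_if_eq_integral)
    (auto simp: is_solution_def absolutely_integrable_on_def)

lemma is_solution_lipschitz_on: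
  fixes F :: "'a::euclidean_space \<Rightarrow> 'b::euclidean_space \<Rightarrow> 'a"
  assumes sol: "is_solution F x0 u {0..T} x" and F: "continuous_on UNIV (\<lambda>(x, u). F x u)"
    and u: "AE t in lborel. 0 \<le> t \<longrightarrow> norm (u t) \<le> U"
  obtains M where "M-lipschitz_on {0..T} x"
proof -
  have x_cont: "continuous_on {0..T} x" using sol by (simp add: is_solution_def)
  have "compact ((\<lambda>(x, u). F x u) ` (x ` {0..T} \<times> cball 0 U))"
    by (intro compact_continuous_image compact_Times continuous_on_subset[OF F] x_cont) auto
  then have "bounded ((\<lambda>(x, u). F x u) ` (x ` {0..T} \<times> cball 0 U))" by (rule compact_imp_bounded)
  then obtain M where "0 < M" and "\<forall>y\<in>(\<lambda>(x, u). F x u) ` (x ` {0..T} \<times> cball 0 U). norm y \<le> M"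
    unfolding bounded_pos by blast
  then have M: "norm (F (x t) v) \<le> M" if "t \<in> {0..T}" "norm v \<le> U" for t v using that by auto
  have "AE t in lborel. t \<in> {0..T} \<longrightarrow> norm (F (x t) (u t)) \<le> M"
    using u by eventually_elim (use M in auto)
  then have "M-lipschitz_on {0..T} x"
    by (rule indefinite_integral_on_lipschitz_on[OF is_solution_imp_indefinite_integral[OF sol] is_interval_cc
          less_imp_le[OF \<open>0 < M\<close>]])
  then show ?thesis by (rule that)
qed

definition lipschitz_near :: "'a::metric_space \<Rightarrow> ('a \<Rightarrow> 'b::metric_space) \<Rightarrow> bool" where
  "lipschitz_near x g \<longleftrightarrow> (\<exists>r>0. \<exists>L. L-lipschitz_on (cball x r) g)"

lemma lipschitz_nearI: "0 < r \<Longrightarrow> L-lipschitz_on (cball x r) g \<Longrightarrow> lipschitz_near x g"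
  unfolding lipschitz_near_def by blast

lemma lipschitz_nearE:
  assumes "lipschitz_near x g" "open S" "x \<in> S"
  obtains r L where "0 < r" "cball x r \<subseteq> S" "L-lipschitz_on (cball x r) g"
proof -
  obtain r L where r: "0 < r" "L-lipschitz_on (cball x r) g" using assms(1)
    unfolding lipschitz_near_def by blast
  obtain e where e: "0 < e" "cball x e \<subseteq> S" using assms(2,3) open_contains_cball by blast
  have "cball x (min r e) \<subseteq> cball x r" "cball x (min r e) \<subseteq> cball x e" by auto
  then show ?thesis using r e by (intro that[of "min r e" L]) (auto intro: lipschitz_on_subset)
qed

lemma loc_lipschitz_on_iff_lipschitz_near:
  assumes S: "open S" shows "loc_lipschitz_on S g \<longleftrightarrow> (\<forall>x\<in>S. lipschitz_near x g)"
proof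
  assume g: "loc_lipschitz_on S g"
  show "\<forall>x\<in>S. lipschitz_near x g"
  proof
    fix x assume "x \<in> S"
    then obtain r L where r: "0 < r" "L-lipschitz_on (cball x r \<inter> S) g" using g
      unfolding loc_lipschitz_on_def by blast
    obtain e where e: "0 < e" "cball x e \<subseteq> S" using S \<open>x \<in> S\<close> open_contains_cball by blast
    have "L-lipschitz_on (cball x (min r e)) g"
      by (rule lipschitz_on_subset[OF r(2)]) (use e in auto)
    then show "lipschitz_near x g" using r(1) e(1) by (intro lipschitz_nearI[of "min r e"]) auto
  qed
next
  assume "\<forall>x\<in>S. lipschitz_near x g"
  then show "loc_lipschitz_on S g"
    unfolding loc_lipschitz_on_def lipschitz_near_def
      using lipschitz_on_subset[OF _ inf_le1] by blast
qed

lemma loc_lipschitz_on_compact: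
  fixes V :: "'a::metric_space \<Rightarrow> 'b::metric_space"
  assumes V: "loc_lipschitz_on S V" and X: "compact X" "X \<subseteq> S"
  obtains L where "L-lipschitz_on X V"
proof -
  have "local_lipschitz {0::real} X (\<lambda>_. V)"
  proof (rule local_lipschitzI)
    fix t :: real and x assume "x \<in> X"
    then obtain r L where "r > 0" and L: "L-lipschitz_on (cball x r \<inter> S) V"
      using V X(2) unfolding loc_lipschitz_on_def by blast
    have "L-lipschitz_on (cball x r \<inter> X) V" using X(2) by (intro lipschitz_on_subset[OF L]) auto
    then show "\<exists>u>0. \<exists>L. \<forall>t\<in>cball t u \<inter> {0}. L-lipschitz_on (cball x u \<inter> X) V"
      using \<open>r > 0\<close> by blast
  qed
  from local_lipschitz_compact_implies_lipschitz[OF this X(1), of thesis] show ?thesis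
    using that by auto
qed

lemma right_derivative_along_curve_le:
  fixes x :: "real \<Rightarrow> 'a::real_normed_vector"
  assumes lip: "K-lipschitz_on (cball (x t) r) V" and r: "0 < r"
    and x: "(x has_vector_derivative v) (at_right t)"
    and d: "((\<lambda>t. V (x t)) has_real_derivative d) (at_right t)"
    and V_le: "eventually (\<lambda>h. V (x t + h *\<^sub>R v) \<le> V (x t) + h * c) (at_right 0)"
  shows "d \<le> c"
proof -
  let ?q = "\<lambda>h. (x (t + h) - x t) /\<^sub>R h"
  have q: "(?q \<longlongrightarrow> v) (at_right 0)" using x by (simp add: has_vector_derivative_at_right_iff)
  have "(x \<longlongrightarrow> x t) (at_right t)"
    using has_vector_derivative_continuous[OF x] by (simp add: continuous_within)
  then have "((\<lambda>h. x (t + h)) \<longlongrightarrow> x t) (at_right 0)"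
    by (simp add: filterlim_at_right_to_0[of _ _ t] add.commute)
  then have near: "eventually (\<lambda>h. x (t + h) \<in> ball (x t) r) (at_right 0)"
    using r by (intro topological_tendstoD) auto
  have "((\<lambda>h. c + K * norm (?q h - v)) \<longlongrightarrow> c + K * norm (v - v)) (at_right 0)"
    by (intro tendsto_intros q)
  then have "((\<lambda>h. c + K * norm (?q h - v)) \<longlongrightarrow> c) (at_right 0)" by simp
  moreover have "((\<lambda>h. (V (x (t + h)) - V (x t)) / h) \<longlongrightarrow> d) (at_right 0)"
    using d by (simp add: has_real_derivative_at_right_iff)
  moreover have "eventually (\<lambda>h. (V (x (t + h)) - V (x t)) / h \<le> c + K * norm (?q h - v)) (at_right 0)"
    using near eventually_add_scaleR_in_ball[OF r, of "x t" v] V_le eventually_at_right_less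
  proof eventually_elim
    case (elim h)
    have "x (t + h) - (x t + h *\<^sub>R v) = h *\<^sub>R (?q h - v)"
      using elim(4) by (simp add: scaleR_diff_right)
    then have "norm (x (t + h) - (x t + h *\<^sub>R v)) = h * norm (?q h - v)" using elim(4) by simp
    then have "\<bar>V (x (t + h)) - V (x t + h *\<^sub>R v)\<bar> \<le> K * (h * norm (?q h - v))"
      using lipschitz_onD[OF lip, of "x (t + h)" "x t + h *\<^sub>R v"] elim(1,2)
        by (simp add: dist_norm less_imp_le)
    then have "V (x (t + h)) - V (x t) \<le> h * (c + K * norm (?q h - v))"
      using elim(3) by (simp add: algebra_simps abs_le_iff)
    then show ?case using elim(4) by (simp add: field_simps)
  qed
  ultimately show ?thesis by (rule tendsto_le[OF trivial_limit_at_right_real])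
qed

lemma lipschitz_derivative_along_flow_le:
  fixes V :: "'a::euclidean_space \<Rightarrow> real"
  assumes lip: "K-lipschitz_on (cball (x t) r) V" and r: "0 < r"
    and \<Phi>: "isCont \<Phi> (x t)" and \<beta>: "isCont \<beta> (x t)"
    and decay: "\<And>z D. z \<in> ball (x t) r \<Longrightarrow> (V has_derivative D) (at z) \<Longrightarrow> D (\<Phi> z) \<le> - \<beta> z"
    and x: "(x has_vector_derivative \<Phi> (x t)) (at_right t)"
    and d: "((\<lambda>t. V (x t)) has_real_derivative d) (at_right t)"
  shows "d \<le> - \<beta> (x t)"
proof (rule field_le_epsilon)
  fix \<epsilon> :: real assume "0 < \<epsilon>"
  obtain \<delta> where \<delta>: "0 < \<delta>" "\<And>z h. 0 \<le> h \<Longrightarrow> z \<in> ball (x t) \<delta> \<Longrightarrow> z + h *\<^sub>R \<Phi> (x t) \<in> ball (x t) \<delta> \<Longrightarrow>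
      V (z + h *\<^sub>R \<Phi> (x t)) \<le> V z + h * (\<epsilon> - \<beta> (x t))"
  proof (rule increment_along_field[where y="x t" and \<Phi>=\<Phi> and \<beta>=\<beta>, OF lip r \<Phi> \<beta> _ \<open>0 < \<epsilon>\<close>])
    show "D (\<Phi> z) \<le> - \<beta> z" if "z \<in> ball (x t) r" "(V has_derivative D) (at z)" for z D
      using that by (rule decay)
  qed blast
  have "eventually (\<lambda>h. V (x t + h *\<^sub>R \<Phi> (x t)) \<le> V (x t) + h * (\<epsilon> - \<beta> (x t))) (at_right 0)"
    using eventually_add_scaleR_in_ball[OF \<delta>(1), of "x t" "\<Phi> (x t)"] eventually_at_right_less
    by eventually_elim (use \<delta> in auto)
  from right_derivative_along_curve_le[OF lip r x d this] show "d \<le> - \<beta> (x t) + \<epsilon>" by simp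
qed

subsection \<open>The decay estimate\<close>

locale lyapunov_function =
  fixes F :: "'a::euclidean_space \<Rightarrow> 'b::euclidean_space \<Rightarrow> 'a" and V :: "'a \<Rightarrow> real"
    and \<gamma> \<alpha> :: "real \<Rightarrow> real"
  assumes F_cont: "continuous_on UNIV (\<lambda>(x, u). F x u)"
    and V_cont: "continuous_on UNIV V" and V_proper: "proper_posdef UNIV V"
    and V_lip: "loc_lipschitz_on (UNIV - {0}) V"
    and \<gamma>: "classK \<gamma>" and \<alpha>: "posdef \<alpha>"
    and V_decreases: "(V has_derivative D) (at y) \<Longrightarrow> \<gamma> (norm v) \<le> V y \<Longrightarrow> D (F y v) \<le> - \<alpha> (norm y)"
begin

lemma V_nonneg: "0 \<le> V y"
  using proper_posdef_nonneg[OF V_proper] by simp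

lemma V_0: "V 0 = 0"
  using proper_posdef_0[OF V_proper] by simp

lemma right_derivative_le:
  assumes above: "\<gamma> (norm v) < V (x t)"
    and x: "(x has_vector_derivative F (x t) v) (at_right t)"
    and d: "((\<lambda>t. V (x t)) has_real_derivative d) (at_right t)"
  shows "d \<le> - \<alpha> (norm (x t))"
proof -
  have "0 \<le> \<gamma> (norm v)" using classK_nonneg[OF \<gamma>] by simp
  then have not_0: "0 \<notin> {z. \<gamma> (norm v) < V z}" using V_0 by simp
  have near: "lipschitz_near (x t) V"
    using V_lip not_0 above by (auto simp: loc_lipschitz_on_iff_lipschitz_near open_delete)
  have "open {z. \<gamma> (norm v) < V z}" using V_cont by (intro open_Collect_less) auto
  then obtain r K where r: "0 < r" "cball (x t) r \<subseteq> {z. \<gamma> (norm v) < V z}"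
    and lip: "K-lipschitz_on (cball (x t) r) V"
    by (rule lipschitz_nearE[OF near]) (use above in auto)
  have \<Phi>: "isCont (\<lambda>z. F z v) y" for y
  proof -
    have "continuous_on UNIV (\<lambda>z. (\<lambda>(x, u). F x u) (z, v))"
      by (rule continuous_on_compose2[OF F_cont]) (auto intro!: continuous_intros)
    then show ?thesis by (simp add: continuous_on_eq_continuous_at)
  qed
  have \<beta>: "isCont (\<lambda>z. \<alpha> (norm z)) y" for y :: 'a
  proof -
    have "continuous_on UNIV (\<lambda>z::'a. \<alpha> (norm z))"
      by (rule continuous_on_compose2[OF posdef_cont[OF \<alpha>] continuous_on_norm_id]) auto
    then show ?thesis by (simp add: continuous_on_eq_continuous_at)
  qed
  show ?thesis
  proof (rule lipschitz_derivative_along_flow_le[where x=x and t=t and \<beta>="\<lambda>z. \<alpha> (norm z)", OF lip r(1) \<Phi> \<beta> _ x d])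
    show "D (F z v) \<le> - \<alpha> (norm z)" if z: "z \<in> ball (x t) r"
      and D: "(V has_derivative D) (at z)" for z D
    proof (rule V_decreases[OF D])
      have "z \<in> cball (x t) r" using z by simp
      then show "\<gamma> (norm v) \<le> V z" using r(2) by auto
    qed
  qed
qed

lemma decay_along_solution:
  assumes a: "posdef a" "\<And>y. 0 < V y \<Longrightarrow> a (V y) \<le> \<alpha> (norm y)" and E: "decay_clock a E"
    and sol: "is_solution F x0 u {0..T} x" and u: "AE t in lborel. 0 \<le> t \<longrightarrow> norm (u t) \<le> U"
    and U: "0 \<le> U"
    and st: "0 \<le> s" "s \<le> t" "t \<le> T" and above: "\<And>\<tau>. \<tau> \<in> {s..t} \<Longrightarrow> \<gamma> U < V (x \<tau>)"
  shows "E (V (x t)) + t \<le> E (V (x s)) + s"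
proof -
  have V_pos: "0 < V (x \<tau>)" if "\<tau> \<in> {s..t}" for \<tau>
    using above[OF that] classK_nonneg[OF \<gamma> U] by simp
  obtain M where "M-lipschitz_on {0..T} x" using is_solution_lipschitz_on[OF sol F_cont u] .
  then have x_lip: "M-lipschitz_on {s..t} x" by (rule lipschitz_on_subset) (use st in auto)
  have "compact (x ` {s..t})"
    by (intro compact_continuous_image lipschitz_on_continuous_on[OF x_lip]) auto
  moreover have "x \<tau> \<noteq> 0" if "\<tau> \<in> {s..t}" for \<tau> using V_pos[OF that] V_0 by auto
  then have "x ` {s..t} \<subseteq> UNIV - {0}" by (simp add: image_subset_iff)
  ultimately obtain K where "K-lipschitz_on (x ` {s..t}) V"
    using loc_lipschitz_on_compact[OF V_lip] by blast
  then have Vx_lip: "(K * M)-lipschitz_on {s..t} (\<lambda>\<tau>. V (x \<tau>))"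
    by (rule lipschitz_on_compose2[OF x_lip])
  show ?thesis
  proof (rule decay_clock_comparison[OF E a(1) Vx_lip st(2) V_pos])
    show "AE \<tau> in lborel. \<tau> \<in> {s<..<t} \<longrightarrow>
        (\<forall>d. ((\<lambda>\<tau>. V (x \<tau>)) has_real_derivative d) (at_right \<tau>) \<longrightarrow> d \<le> - a (V (x \<tau>)))"
      using u indefinite_integral_on_imp_right_derivative_AE[OF is_solution_imp_indefinite_integral[OF sol]]
    proof eventually_elim
      case (elim \<tau>)
      show ?case
      proof (intro impI allI)
        fix d assume \<tau>: "\<tau> \<in> {s<..<t}" and d: "((\<lambda>\<tau>. V (x \<tau>)) has_real_derivative d) (at_right \<tau>)"
        have x': "(x has_vector_derivative F (x \<tau>) (u \<tau>)) (at_right \<tau>)" and "norm (u \<tau>) \<le> U"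
          using elim \<tau> st by auto
        then have "\<gamma> (norm (u \<tau>)) < V (x \<tau>)"
          using classK_mono[OF \<gamma>, of "norm (u \<tau>)" U] above[of \<tau>] \<tau> by simp
        then have "d \<le> - \<alpha> (norm (x \<tau>))" using x' d by (rule right_derivative_le)
        then show "d \<le> - a (V (x \<tau>))" using a(2)[OF V_pos, of \<tau>] \<tau> by simp
      qed
    qed
  qed
qed

lemma V_solution_le:
  assumes a: "posdef a" "\<And>y. 0 < V y \<Longrightarrow> a (V y) \<le> \<alpha> (norm y)" "\<And>r. 0 \<le> r \<Longrightarrow> a r \<le> r"
    and E: "decay_clock a E"
    and sol: "is_solution F x0 u {0..T} x" and u: "AE t in lborel. 0 \<le> t \<longrightarrow> norm (u t) \<le> U"
    and U: "0 \<le> U"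
    and t: "t \<in> {0..T}"
  shows "V (x t) \<le> max (sinv (exp_gauge E) (exp (- t) * exp_gauge E (V x0))) (\<gamma> U)"
proof (rule ccontr)
  let ?h = "exp_gauge E"
  assume "\<not> ?thesis"
  then have V_xt: "sinv ?h (exp (- t) * ?h (V x0)) < V (x t)" "\<gamma> U < V (x t)"
    by (simp_all add: not_le)
  have h: "classKinf ?h" by (rule classKinf_exp_gauge[OF E a(1,3)])
  have x: "continuous_on {0..T} x" "x 0 = x0" using sol by (auto simp: is_solution_def)
  have cont: "continuous_on {0..t} (\<lambda>\<tau>. V (x \<tau>))"
    by (rule continuous_on_compose2[OF V_cont continuous_on_subset[OF x(1)]]) (use t in auto)
  have t': "0 \<le> t" "t \<le> T" using t by auto
  have decay: "E (V (x t)) + t \<le> E (V (x s)) + s"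
    if "s \<in> {0..t}" "\<And>\<tau>. \<tau> \<in> {s..t} \<Longrightarrow> \<gamma> U < V (x \<tau>)" for s
    by (rule decay_along_solution[OF a(1,2) E sol u U _ _ t'(2) that(2)]) (use that(1) in auto)
  have "E (V (x t)) + t \<le> E (V x0)" "\<gamma> U < V x0"
    using decay_above_level[OF cont t'(1) classK_nonneg[OF \<gamma> U] V_xt(2) decay_clock_less[OF E a(1)] decay]
    by (simp_all add: x(2))
  moreover have "0 \<le> \<gamma> U" by (rule classK_nonneg[OF \<gamma> U])
  ultimately have "?h (V (x t)) \<le> exp (- t) * ?h (V x0)"
    using V_xt(2) by (simp add: exp_gauge_def mult_exp_exp)
  moreover have "exp (- t) * ?h (V x0) < ?h (V (x t))"
    using V_xt(1) classK_nonneg[OF classKinfD[OF h] V_nonneg]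
      by (simp add: sinv_less_iff[OF h] V_nonneg)
  ultimately show False by simp
qed

end

subsection \<open>Existence of solutions\<close>

locale bounded_lipschitz_field =
  fixes g :: "real \<Rightarrow> 'a::euclidean_space \<Rightarrow> 'a" and L M :: real
  assumes measurable: "continuous_on {0..} Y \<Longrightarrow> (\<lambda>s. g s (Y s)) \<in> borel_measurable (lebesgue_on {0..})"
    and bound: "norm (g s y) \<le> M"
    and lip: "norm (g s y - g s z) \<le> L * norm (y - z)" and L: "0 < L"
begin

lemma M_nonneg: "0 \<le> M"
  using bound norm_ge_zero order_trans by blast

lemma absolutely_integrable_along:
  assumes Y: "continuous_on {0..} Y" shows "(\<lambda>s. g s (Y s)) absolutely_integrable_on {0..t}"
proof (rule measurable_bounded_by_integrable_imp_absolutely_integrable[of _ _ "\<lambda>_. M"])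
  show "(\<lambda>s. g s (Y s)) \<in> borel_measurable (lebesgue_on {0..t})"
    by (rule measurable_restrict_mono[OF measurable[OF Y]]) auto
qed (auto simp: bound)

lemma integrable_along: "continuous_on {0..} Y \<Longrightarrow> (\<lambda>s. g s (Y s)) integrable_on {0..t}"
  using absolutely_integrable_along by (auto simp: absolutely_integrable_on_def)

definition volterra :: "(real \<Rightarrow> 'a) \<Rightarrow> real \<Rightarrow> 'a" where
  "volterra Y t = integral {0..t} (\<lambda>s. g s (Y s))"

lemma volterra_lipschitz_on:
  assumes "continuous_on {0..} Y" shows "M-lipschitz_on {0..} (volterra Y)"
proof (rule indefinite_integral_on_lipschitz_on[OF _ is_interval_ci M_nonneg])
  show "indefinite_integral_on {0..} (\<lambda>s. g s (Y s)) (volterra Y)"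
    by (rule indefinite_integral_on_if_eq_integral[OF order_refl integrable_along[OF assms], of _ 0])
      (simp add: volterra_def)
qed (simp add: bound)

lemma norm_volterra_le:
  assumes "continuous_on {0..} Y" "0 \<le> t" shows "norm (volterra Y t) \<le> M * t"
  using lipschitz_onD[OF volterra_lipschitz_on[OF assms(1)], of t 0] assms(2)
  by (simp add: volterra_def)

lemma norm_volterra_diff_le:
  assumes Y: "continuous_on {0..} Y" and Z: "continuous_on {0..} Z" and t: "0 \<le> t"
    and close: "\<And>s. 0 \<le> s \<Longrightarrow> norm (Y s - Z s) \<le> exp (2 * L * s) * d"
  shows "norm (volterra Y t - volterra Z t) \<le> exp (2 * L * t) * (d / 2)"
proof -
  have d: "0 \<le> d" using order_trans[OF norm_ge_zero close[of 0]] by simp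
  have exp_int: "((\<lambda>s. L * (exp (2 * L * s) * d)) has_integral exp (2 * L * t) * d / 2 - exp (2 * L * 0) * d / 2) {0..t}"
    by (rule fundamental_theorem_of_calculus[OF t])
      (auto intro!: derivative_eq_intros simp: has_real_derivative_iff_has_vector_derivative[symmetric])
  have "volterra Y t - volterra Z t = integral {0..t} (\<lambda>s. g s (Y s) - g s (Z s))"
    unfolding volterra_def
    by (rule Henstock_Kurzweil_Integration.integral_diff[symmetric]) (intro integrable_along Y Z)+
  also have "norm \<dots> \<le> integral {0..t} (\<lambda>s. L * (exp (2 * L * s) * d))"
  proof (rule integral_norm_bound_integral)
    show "(\<lambda>s. g s (Y s) - g s (Z s)) integrable_on {0..t}"
      by (intro Henstock_Kurzweil_Integration.integrable_diff integrable_along Y Z)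
    show "(\<lambda>s. L * (exp (2 * L * s) * d)) integrable_on {0..t}"
      using exp_int by (rule has_integral_integrable)
    fix s assume "s \<in> {0..t}"
    then have "L * norm (Y s - Z s) \<le> L * (exp (2 * L * s) * d)"
      using L close by (intro mult_left_mono) auto
    then show "norm (g s (Y s) - g s (Z s)) \<le> L * (exp (2 * L * s) * d)"
      using lip[of s "Y s" "Z s"] by linarith
  qed
  also have "\<dots> = exp (2 * L * t) * d / 2 - exp (2 * L * 0) * d / 2"
    using exp_int by (rule integral_unique)
  finally show ?thesis using d by simp
qed

text \<open>In the weighted coordinates \<open>x t = x0 + exp (2 * L * t) *\<^sub>R z t\<close> the integral equation becomes a
  fixed point equation for a contraction of the bounded continuous functions.\<close>
definition curve :: "'a \<Rightarrow> (real \<Rightarrow>\<^sub>C 'a) \<Rightarrow> real \<Rightarrow> 'a" where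
  "curve x0 z t = x0 + exp (2 * L * t) *\<^sub>R z t"

definition picard :: "'a \<Rightarrow> (real \<Rightarrow>\<^sub>C 'a) \<Rightarrow> (real \<Rightarrow>\<^sub>C 'a)" where
  "picard x0 z = Bcontfun (\<lambda>t. exp (- (2 * L * max 0 t)) *\<^sub>R volterra (curve x0 z) (max 0 t))"

lemma continuous_on_curve: "continuous_on S (curve x0 z)"
  unfolding curve_def by (intro continuous_intros continuous_on_apply_bcontfun)

lemma picard_apply: "picard x0 z t = exp (- (2 * L * max 0 t)) *\<^sub>R volterra (curve x0 z) (max 0 t)"
proof -
  let ?p = "\<lambda>t. exp (- (2 * L * max 0 t)) *\<^sub>R volterra (curve x0 z) (max 0 t)"
  have "?p \<in> bcontfun"
  proof (rule bcontfun_normI)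
    have "continuous_on UNIV (\<lambda>t. volterra (curve x0 z) (max 0 t))"
      by (rule continuous_on_compose2[OF lipschitz_on_continuous_on[OF volterra_lipschitz_on[OF continuous_on_curve]]])
        (auto intro!: continuous_intros)
    then show "continuous_on UNIV ?p" by (intro continuous_intros)
    show "norm (?p t) \<le> M / (2 * L)" for t
    proof -
      let ?r = "max 0 t"
      have "2 * L * ?r \<le> exp (2 * L * ?r)" using exp_ge_add_one_self[of "2 * L * ?r"] by linarith
      then have "exp (- (2 * L * ?r)) * ?r \<le> 1 / (2 * L)"
        using L by (simp add: exp_minus field_simps)
      then have weight: "M * (exp (- (2 * L * ?r)) * ?r) \<le> M * (1 / (2 * L))"
        by (rule mult_left_mono[OF _ M_nonneg])
      have "norm (?p t) = exp (- (2 * L * ?r)) * norm (volterra (curve x0 z) ?r)" by simp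
      also have "\<dots> \<le> exp (- (2 * L * ?r)) * (M * ?r)"
        by (intro mult_left_mono norm_volterra_le continuous_on_curve) auto
      also have "\<dots> = M * (exp (- (2 * L * ?r)) * ?r)" by simp
      also note weight
      finally show ?thesis by simp
    qed
  qed
  then show ?thesis unfolding picard_def by (simp add: Bcontfun_inverse)
qed

lemma picard_contraction: "dist (picard x0 z) (picard x0 w) \<le> 1 / 2 * dist z w"
proof (rule dist_bound)
  fix t :: real
  let ?r = "max 0 t"
  have "norm (volterra (curve x0 z) ?r - volterra (curve x0 w) ?r) \<le> exp (2 * L * ?r) * (dist z w / 2)"
  proof (rule norm_volterra_diff_le[OF continuous_on_curve continuous_on_curve])
    fix s :: real
    have "curve x0 z s - curve x0 w s = exp (2 * L * s) *\<^sub>R (z s - w s)"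
      by (simp add: curve_def scaleR_diff_right)
    then show "norm (curve x0 z s - curve x0 w s) \<le> exp (2 * L * s) * dist z w"
      using dist_bounded[of z s w] by (simp add: dist_norm)
  qed simp
  then have "exp (- (2 * L * ?r)) * norm (volterra (curve x0 z) ?r - volterra (curve x0 w) ?r) \<le> dist z w / 2"
    by (simp add: exp_minus field_simps)
  then show "dist (picard x0 z t) (picard x0 w t) \<le> 1 / 2 * dist z w"
    by (simp add: picard_apply dist_norm scaleR_diff_right[symmetric])
qed

theorem ex_caratheodory_solution:
  obtains x where "continuous_on {0..} x" "x 0 = x0"
    "\<And>t. 0 \<le> t \<Longrightarrow> (\<lambda>s. g s (x s)) absolutely_integrable_on {0..t}"
    "\<And>t. 0 \<le> t \<Longrightarrow> x t = x0 + integral {0..t} (\<lambda>s. g s (x s))"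
proof -
  obtain z where z: "picard x0 z = z"
    using banach_fix_type[of "1 / 2" "picard x0"] picard_contraction by auto
  have curve_eq: "curve x0 z t = x0 + volterra (curve x0 z) t" if "0 \<le> t" for t
  proof -
    have "exp (2 * L * t) *\<^sub>R z t = exp (2 * L * t) *\<^sub>R picard x0 z t" by (simp add: z)
    also have "\<dots> = volterra (curve x0 z) t" using that by (simp add: picard_apply mult_exp_exp)
    finally show ?thesis by (simp add: curve_def)
  qed
  show ?thesis
  proof (rule that)
    show "curve x0 z 0 = x0" using curve_eq[of 0] by (simp add: volterra_def)
  qed (use curve_eq in \<open>auto simp: volterra_def intro: continuous_on_curve absolutely_integrable_along\<close>)
qed

end

lemma uniform_lipschitz_on_cball:
  fixes F :: "'a::euclidean_space \<Rightarrow> 'b::euclidean_space \<Rightarrow> 'a"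
  assumes F_cont: "continuous_on UNIV (\<lambda>(x, u). F x u)"
    and F_lip: "\<And>r x. \<exists>\<delta>>0. \<exists>L. \<forall>v. norm v \<le> r \<longrightarrow> L-lipschitz_on (cball x \<delta>) (\<lambda>y. F y v)"
  obtains L where "\<And>v. norm v \<le> U \<Longrightarrow> L-lipschitz_on (cball 0 R) (\<lambda>y. F y v)"
proof -
  have F_input_cont: "continuous_on (cball 0 U) (\<lambda>v. F y v)" for y
  proof -
    have "continuous_on (cball 0 U) (\<lambda>v. (\<lambda>(x, u). F x u) (y, v))"
      by (rule continuous_on_compose2[OF F_cont]) (auto intro!: continuous_intros)
    then show ?thesis by simp
  qed
  have "local_lipschitz (cball 0 U) (cball 0 R) (\<lambda>v y. F y v)"
  proof (rule local_lipschitzI)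
    fix v y
    obtain \<delta> L where "\<delta> > 0" "\<forall>v. norm v \<le> U \<longrightarrow> L-lipschitz_on (cball y \<delta>) (\<lambda>y. F y v)"
      using F_lip by blast
    then show "\<exists>d>0. \<exists>L. \<forall>t\<in>cball v d \<inter> cball 0 U. L-lipschitz_on (cball y d \<inter> cball 0 R) (\<lambda>y. F y t)"
      by (intro exI[of _ \<delta>] conjI exI[of _ L]) (auto intro: lipschitz_on_subset)
  qed
  from local_lipschitz_compact_implies_lipschitz[OF this compact_cball compact_cball]
  obtain L where "\<And>v. v \<in> cball 0 U \<Longrightarrow> L-lipschitz_on (cball 0 R) (\<lambda>y. F y v)"
    using F_input_cont by blast
  then show ?thesis by (intro that) simp
qed

lemma ex_solution_truncated_field:
  fixes F :: "'a::euclidean_space \<Rightarrow> 'b::euclidean_space \<Rightarrow> 'a"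
  assumes F_cont: "continuous_on UNIV (\<lambda>(x, u). F x u)"
    and F_lip: "\<And>r x. \<exists>\<delta>>0. \<exists>L. \<forall>v. norm v \<le> r \<longrightarrow> L-lipschitz_on (cball x \<delta>) (\<lambda>y. F y v)"
    and v: "v \<in> borel_measurable lebesgue" "\<And>t. norm (v t) \<le> U" and R: "0 \<le> R"
  shows "\<exists>x. is_solution (\<lambda>y w. F (closest_point (cball 0 R) y) w) x0 v {0..} x"
proof -
  let ?c = "closest_point (cball (0::'a) R)"
  have ne: "cball (0::'a) R \<noteq> {}" using R by simp
  have clip: "?c y \<in> cball 0 R" for y by (rule closest_point_in_set[OF closed_cball ne])
  obtain L where L: "\<And>w. norm w \<le> U \<Longrightarrow> L-lipschitz_on (cball 0 R) (\<lambda>y. F y w)"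
    using uniform_lipschitz_on_cball[OF F_cont F_lip] by metis
  have "compact ((\<lambda>(x, u). F x u) ` (cball 0 R \<times> cball 0 U))"
    by (intro compact_continuous_image compact_Times continuous_on_subset[OF F_cont] compact_cball) auto
  then have "bounded ((\<lambda>(x, u). F x u) ` (cball 0 R \<times> cball 0 U))" by (rule compact_imp_bounded)
  then obtain M where M: "\<forall>y\<in>(\<lambda>(x, u). F x u) ` (cball 0 R \<times> cball 0 U). norm y \<le> M"
    unfolding bounded_iff by blast
  interpret bounded_lipschitz_field "\<lambda>s y. F (?c y) (v s)" "max L 1" M
  proof
    fix Y :: "real \<Rightarrow> 'a" assume "continuous_on {0..} Y"
    then have "continuous_on {0..} (\<lambda>s. ?c (Y s))"
      by (intro continuous_on_compose2[OF continuous_on_closest_point[OF convex_cball closed_cball ne]]) auto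
    then have "(\<lambda>s. ?c (Y s)) \<in> borel_measurable (lebesgue_on {0..})"
      by (rule continuous_imp_measurable_on_sets_lebesgue) auto
    moreover have "v \<in> borel_measurable (lebesgue_on {0..})"
      using v(1) by (rule measurable_restrict_space1)
    moreover have "continuous_on UNIV (\<lambda>p. F (fst p) (snd p))"
      using F_cont by (simp add: case_prod_beta')
    ultimately show "(\<lambda>s. F (?c (Y s)) (v s)) \<in> borel_measurable (lebesgue_on {0..})"
      by (rule borel_measurable_continuous_Pair)
  next
    fix s y z
    show "norm (F (?c y) (v s)) \<le> M" using M clip[of y] v(2)[of s] by auto
    have "norm (F (?c y) (v s) - F (?c z) (v s)) \<le> L * norm (?c y - ?c z)"
      by (rule lipschitz_on_normD[OF L[OF v(2)] clip clip])
    also have "\<dots> \<le> max L 1 * norm (y - z)"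
      using closest_point_lipschitz[OF convex_cball closed_cball ne, of y z]
      by (intro mult_mono) (auto simp: dist_norm)
    finally show "norm (F (?c y) (v s) - F (?c z) (v s)) \<le> max L 1 * norm (y - z)" .
  qed simp
  obtain x where "continuous_on {0..} x" "x 0 = x0"
    "\<And>t. 0 \<le> t \<Longrightarrow> (\<lambda>s. F (?c (x s)) (v s)) absolutely_integrable_on {0..t}"
    "\<And>t. 0 \<le> t \<Longrightarrow> x t = x0 + integral {0..t} (\<lambda>s. F (?c (x s)) (v s))"
    using ex_caratheodory_solution[of x0] by blast
  then show ?thesis unfolding is_solution_def by (intro exI[of _ x]) auto
qed

subsection \<open>Essentially bounded inputs\<close>

lemma linf_norm_nonneg:
  assumes "admissible_input u" shows "0 \<le> linf_norm u"
  unfolding linf_norm_def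
proof (rule cInf_greatest)
  show "{c. AE t in lebesgue. t \<in> {0..} \<longrightarrow> norm (u t) \<le> c} \<noteq> {}"
    using assms by (auto simp: admissible_input_def)
  fix c assume "c \<in> {c. AE t in lebesgue. t \<in> {0..} \<longrightarrow> norm (u t) \<le> c}"
  then have "AE t in lborel. t \<in> {0..} \<longrightarrow> norm (u t) \<le> c" by (simp add: AE_completion_iff)
  then obtain t :: real where "t \<in> {0<..<1}" "t \<in> {0..} \<longrightarrow> norm (u t) \<le> c"
    by (rule ex_in_open_if_AE_lborel[of _ "{0<..<1}"]) auto
  then have "norm (u t) \<le> c" by simp
  then show "0 \<le> c" by (rule order_trans[OF norm_ge_zero])
qed

lemma norm_le_linf_norm_AE:
  assumes "admissible_input u" shows "AE t in lborel. 0 \<le> t \<longrightarrow> norm (u t) \<le> linf_norm u"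
proof -
  let ?C = "{c. AE t in lebesgue. t \<in> {0..} \<longrightarrow> norm (u t) \<le> c}"
  have ne: "?C \<noteq> {}" using assms by (auto simp: admissible_input_def)
  have "AE t in lborel. 0 \<le> t \<longrightarrow> norm (u t) \<le> linf_norm u + inverse (real (Suc k))" for k
  proof -
    have "Inf ?C < linf_norm u + inverse (real (Suc k))"
      by (simp add: linf_norm_def del: of_nat_Suc)
    from cInf_lessD[OF ne this] obtain c where "c \<in> ?C"
      and c_less: "c < linf_norm u + inverse (real (Suc k))"
      by blast
    then have "AE t in lborel. t \<in> {0..} \<longrightarrow> norm (u t) \<le> c" by (simp add: AE_completion_iff)
    then show ?thesis by eventually_elim (use c_less in auto)
  qed
  then have "AE t in lborel. \<forall>k. 0 \<le> t \<longrightarrow> norm (u t) \<le> linf_norm u + inverse (real (Suc k))"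
    by (intro AE_all_countable[THEN iffD2] allI)
  then show ?thesis
  proof eventually_elim
    case (elim t)
    show ?case
    proof
      assume "0 \<le> t"
      then show "norm (u t) \<le> linf_norm u"
        using elim by (intro LIMSEQ_le_const[OF LIMSEQ_inverse_real_of_nat_add]) blast
    qed
  qed
qed

lemma admissible_input_bounded_version:
  fixes u :: "real \<Rightarrow> 'b::euclidean_space"
  assumes u: "admissible_input u"
  obtains v where "v \<in> borel_measurable lebesgue" "\<And>t. norm (v t) \<le> linf_norm u"
    "AE t in lborel. 0 \<le> t \<longrightarrow> v t = u t"
proof
  define w where "w t = indicator {0..} t *\<^sub>R u t" for t :: real
  define v where "v t = (if norm (w t) \<le> linf_norm u then w t else 0)" for t
  have "w \<in> borel_measurable lebesgue"
    using u by (simp add: admissible_input_def set_borel_measurable_def w_def[abs_def])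
  then show "v \<in> borel_measurable lebesgue" unfolding v_def by measurable
  show "norm (v t) \<le> linf_norm u" for t using linf_norm_nonneg[OF u] by (simp add: v_def)
  show "AE t in lborel. 0 \<le> t \<longrightarrow> v t = u t"
    using norm_le_linf_norm_AE[OF u] by eventually_elim (simp add: v_def w_def)
qed

lemma is_solution_cong_AE:
  assumes sol: "is_solution F x0 u I x" and J: "J \<subseteq> I"
    and eq: "AE s in lborel. \<forall>t\<in>J. s \<in> {0..t} \<longrightarrow> G (x s) (v s) = F (x s) (u s)"
  shows "is_solution G x0 v J x"
  unfolding is_solution_def
proof (intro conjI ballI)
  show "continuous_on J x" "x 0 = x0"
    using sol J by (auto simp: is_solution_def intro: continuous_on_subset)
  fix t assume t: "t \<in> J"
  let ?N = "{s. \<not> (\<forall>t\<in>J. s \<in> {0..t} \<longrightarrow> G (x s) (v s) = F (x s) (u s))}"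
  have N: "negligible ?N" using eq by (simp add: AE_lborel_iff_negligible)
  have int: "(\<lambda>s. F (x s) (u s)) absolutely_integrable_on {0..t}" "x t = x0 + integral {0..t} (\<lambda>s. F (x s) (u s))"
    using sol J t by (auto simp: is_solution_def)
  show "(\<lambda>s. G (x s) (v s)) absolutely_integrable_on {0..t}"
    by (rule absolutely_integrable_spike[OF int(1) N]) (use t in auto)
  have "integral {0..t} (\<lambda>s. F (x s) (u s)) = integral {0..t} (\<lambda>s. G (x s) (v s))"
    by (rule integral_spike[OF N]) (use t in auto)
  then show "x t = x0 + integral {0..t} (\<lambda>s. G (x s) (v s))" using int(2) by simp
qed

lemma ex_first_time_ge:
  fixes w :: "real \<Rightarrow> real"
  assumes w: "continuous_on {a..b} w" and \<tau>: "\<tau> \<in> {a..b}" "c \<le> w \<tau>"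
  obtains s where "s \<in> {a..b}" "c \<le> w s" "\<And>r. a \<le> r \<Longrightarrow> r < s \<Longrightarrow> w r < c"
proof -
  have "continuous_on {a..b} (\<lambda>r. - w (a + b - r))"
    by (intro continuous_intros continuous_on_compose2[OF w]) auto
  moreover have "a + b - \<tau> \<in> {a..b}" "- w (a + b - (a + b - \<tau>)) \<le> - c" using \<tau> by auto
  ultimately obtain s where s: "s \<in> {a..b}" "- w (a + b - s) \<le> - c"
    and later: "\<And>r. s < r \<Longrightarrow> r \<le> b \<Longrightarrow> - c < - w (a + b - r)"
    by (rule ex_last_time_le) blast
  show ?thesis
  proof (rule that)
    show "a + b - s \<in> {a..b}" "c \<le> w (a + b - s)" using s by auto
    show "w r < c" if "a \<le> r" "r < a + b - s" for r using later[of "a + b - r"] that by simp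
  qed
qed

theorem ex_global_solution_if_bounded:
  fixes F :: "'a::euclidean_space \<Rightarrow> 'b::euclidean_space \<Rightarrow> 'a"
  assumes F_cont: "continuous_on UNIV (\<lambda>(x, u). F x u)"
    and F_lip: "\<And>r x. \<exists>\<delta>>0. \<exists>L. \<forall>v. norm v \<le> r \<longrightarrow> L-lipschitz_on (cball x \<delta>) (\<lambda>y. F y v)"
    and u: "admissible_input u"
    and bounded: "\<And>x T. 0 \<le> T \<Longrightarrow> is_solution F x0 u {0..T} x \<Longrightarrow> norm (x T) < R"
  shows "\<exists>x. is_solution F x0 u {0..} x"
proof -
  let ?F = "\<lambda>y. F (closest_point (cball 0 R) y)"
  obtain v where v: "v \<in> borel_measurable lebesgue" "\<And>t. norm (v t) \<le> linf_norm u"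
    and vu: "AE t in lborel. 0 \<le> t \<longrightarrow> v t = u t"
    using admissible_input_bounded_version[OF u] by blast
  have "is_solution F x0 u {0..0} (\<lambda>_. x0)"
    using integrable_on_refl[of "\<lambda>s. F x0 (u s)" 0] integrable_on_refl[of "\<lambda>s. norm (F x0 (u s))" 0]
    by (simp add: is_solution_def absolutely_integrable_on_def)
  then have R: "norm x0 < R" using bounded[of 0] by simp
  then have "0 \<le> R" using norm_ge_zero[of x0] by linarith
  then obtain x where x: "is_solution ?F x0 v {0..} x"
    using ex_solution_truncated_field[OF F_cont F_lip v] by blast
  have x_cont: "continuous_on {0..} x" using x by (simp add: is_solution_def)
  have same: "F (x s) (u s) = ?F (x s) (v s)" if "norm (x s) < R" "v s = u s" for s
    using that by (simp add: closest_point_self)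
  have small: "norm (x t) < R" if t: "0 \<le> t" for t
  proof (rule ccontr)
    assume "\<not> norm (x t) < R"
    moreover have "continuous_on {0..t} (\<lambda>s. norm (x s))"
      by (rule continuous_on_norm[OF continuous_on_subset[OF x_cont]]) auto
    ultimately obtain s where s: "s \<in> {0..t}" "R \<le> norm (x s)"
      and before: "\<And>r. 0 \<le> r \<Longrightarrow> r < s \<Longrightarrow> norm (x r) < R"
      using ex_first_time_ge[of 0 t "\<lambda>s. norm (x s)" t R] t by auto
    have "is_solution F x0 u {0..s} x"
    proof (rule is_solution_cong_AE[OF x])
      show "AE r in lborel. \<forall>t\<in>{0..s}. r \<in> {0..t} \<longrightarrow> F (x r) (u r) = ?F (x r) (v r)"
        using vu AE_lborel_singleton[of s] by eventually_elim (use before same in force)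
    qed auto
    then have "norm (x s) < R" by (rule bounded[rotated]) (use s in simp)
    then show False using s(2) by simp
  qed
  have "is_solution F x0 u {0..} x"
  proof (rule is_solution_cong_AE[OF x order_refl])
    show "AE r in lborel. \<forall>t\<in>{0..}. r \<in> {0..t} \<longrightarrow> F (x r) (u r) = ?F (x r) (v r)"
      using vu by eventually_elim (use small same in auto)
  qed
  then show ?thesis by blast
qed

subsection \<open>Lyapunov functions imply stability\<close>

lemma (in lyapunov_function) ex_ISS_gains:
  "\<exists>\<beta> g. classKL \<beta> \<and> classK g \<and> (\<forall>x0 u T x t. admissible_input u \<longrightarrow> is_solution F x0 u {0..T} x \<longrightarrow>
     t \<in> {0..T} \<longrightarrow> norm (x t) \<le> \<beta> (norm x0) t + g (linf_norm u))"
proof -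
  obtain \<psi>\<^sub>1 \<psi>\<^sub>2 where \<psi>: "classKinf \<psi>\<^sub>1" "classKinf \<psi>\<^sub>2"
    and bounds: "\<And>x. \<psi>\<^sub>1 (norm x) \<le> V x" "\<And>x. V x \<le> \<psi>\<^sub>2 (norm x)"
    using V_proper unfolding proper_posdef_def by blast
  obtain a where a: "posdef a" "\<And>y. 0 < V y \<Longrightarrow> a (V y) \<le> \<alpha> (norm y)" "\<And>r. 0 \<le> r \<Longrightarrow> a r \<le> r"
    using ex_posdef_minorant_along_levels[OF V_proper \<alpha>] by auto
  obtain E where E: "decay_clock a E" using ex_decay_clock[OF a(1)] by blast
  define h where "h = exp_gauge E"
  have h: "classKinf h" unfolding h_def by (rule classKinf_exp_gauge[OF E a(1,3)])
  note \<psi>\<^sub>1_inv = classKinfD[OF classKinf_sinv[OF \<psi>(1)]]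
    and h_inv = classKinfD[OF classKinf_sinv[OF h]]
  define \<beta> where "\<beta> s t = sinv \<psi>\<^sub>1 (sinv h (exp (- t) * h (\<psi>\<^sub>2 s)))" for s t
  define g where "g r = sinv \<psi>\<^sub>1 (\<gamma> r)" for r
  have "norm (x t) \<le> \<beta> (norm x0) t + g (linf_norm u)"
    if u: "admissible_input u" and sol: "is_solution F x0 u {0..T} x"
      and t: "t \<in> {0..T}" for x0 u T x t
  proof -
    let ?b = "sinv h (exp (- t) * h (\<psi>\<^sub>2 (norm x0)))" and ?c = "\<gamma> (linf_norm u)"
    have nonneg: "0 \<le> exp (- t) * h (V x0)" "0 \<le> ?b" "0 \<le> ?c"
      using classK_nonneg[OF classKinfD[OF h]] classK_nonneg[OF h_inv] classK_nonneg[OF classKinfD[OF \<psi>(2)]]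
        classK_nonneg[OF \<gamma> linf_norm_nonneg[OF u]] V_nonneg by simp_all
    have "\<psi>\<^sub>1 (norm (x t)) \<le> max (sinv h (exp (- t) * h (V x0))) ?c"
      using V_solution_le[OF a E sol norm_le_linf_norm_AE[OF u] linf_norm_nonneg[OF u] t] bounds(1)[of "x t"]
      by (simp add: h_def)
    also have "\<dots> \<le> max ?b ?c"
      using classK_mono[OF classKinfD[OF h] V_nonneg bounds(2)] nonneg
      by (intro max.mono classK_mono[OF h_inv]) auto
    finally have "norm (x t) \<le> sinv \<psi>\<^sub>1 (max ?b ?c)"
      using nonneg by (simp add: le_sinv_iff[OF \<psi>(1)])
    also have "\<dots> \<le> sinv \<psi>\<^sub>1 ?b + sinv \<psi>\<^sub>1 ?c"
      using classK_nonneg[OF \<psi>\<^sub>1_inv] nonneg by (simp add: max_def)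
    finally show ?thesis by (simp add: \<beta>_def g_def)
  qed
  moreover have "classKL \<beta>"
    using classKL_exp_decay[OF classKinf_compose[OF classKinf_sinv[OF \<psi>(1)] classKinf_sinv[OF h]]
        classKinf_compose[OF h \<psi>(2)]] by (simp add: \<beta>_def[abs_def])
  moreover have "classK g" unfolding g_def using \<psi>\<^sub>1_inv \<gamma> by (rule classK_compose)
  ultimately show ?thesis by blast
qed

theorem ISS_lyapunov_imp_ISS:
  fixes F :: "'a::euclidean_space \<Rightarrow> 'b::euclidean_space \<Rightarrow> 'a"
  assumes F_cont: "continuous_on UNIV (\<lambda>(x, u). F x u)"
    and F_lip: "\<And>r x. \<exists>\<delta>>0. \<exists>L. \<forall>v. norm v \<le> r \<longrightarrow> L-lipschitz_on (cball x \<delta>) (\<lambda>y. F y v)"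
    and lyap: "ISS_lyapunov F V"
  shows "ISS F"
proof -
  obtain \<gamma> \<alpha> where "lyapunov_function F V \<gamma> \<alpha>"
    using lyap F_cont unfolding ISS_lyapunov_def lyapunov_function_def by blast
  then obtain \<beta> g where \<beta>: "classKL \<beta>" and g: "classK g"
    and estimate: "\<And>x0 u T x t. admissible_input u \<Longrightarrow> is_solution F x0 u {0..T} x \<Longrightarrow> t \<in> {0..T} \<Longrightarrow>
      norm (x t) \<le> \<beta> (norm x0) t + g (linf_norm u)"
    using lyapunov_function.ex_ISS_gains by metis
  have "\<exists>x. is_solution F x0 u {0..} x" if u: "admissible_input u" for x0 u
  proof (rule ex_global_solution_if_bounded[OF F_cont F_lip u])
    fix x T assume T: "0 \<le> T" and "is_solution F x0 u {0..T} x"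
    then have "norm (x T) \<le> \<beta> (norm x0) T + g (linf_norm u)" using estimate[OF u] by simp
    also have "\<beta> (norm x0) T \<le> \<beta> (norm x0) 0" using \<beta> T norm_ge_zero[of x0]
      unfolding classKL_def by blast
    finally show "norm (x T) < \<beta> (norm x0) 0 + g (linf_norm u) + 1" by simp
  qed
  then show ?thesis unfolding ISS_def using \<beta> g estimate by (intro exI[of _ \<beta>] exI[of _ g]) blast
qed

section \<open>The composite Lyapunov function\<close>

subsection \<open>Projections onto blocks of coordinates\<close>

lemma inner_proj:
  assumes "A \<subseteq> Basis" "b \<in> Basis" shows "proj A x \<bullet> b = (if b \<in> A then x \<bullet> b else 0)"
proof -
  have fin: "finite A" using assms(1) finite_subset finite_Basis by blast
  have "proj A x \<bullet> b = (\<Sum>c\<in>A. (x \<bullet> c) * (c \<bullet> b))" by (simp add: proj_def inner_sum_left)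
  also have "\<dots> = (\<Sum>c\<in>A. if c = b then x \<bullet> c else 0)"
    using assms by (intro sum.cong) (auto simp: inner_Basis)
  finally show ?thesis using fin by (simp add: sum.delta')
qed

lemma linear_proj: "linear (proj A)"
  by (rule linearI) (auto simp: proj_def inner_add_left scaleR_left_distrib sum.distrib scaleR_sum_right)

lemma norm_proj_le: "A \<subseteq> Basis \<Longrightarrow> norm (proj A x) \<le> norm x"
  by (rule norm_le_componentwise) (auto simp: inner_proj)

lemma dist_proj_le: "A \<subseteq> Basis \<Longrightarrow> dist (proj A x) (proj A y) \<le> dist x y"
  using norm_proj_le[of A "x - y"] by (simp add: dist_norm linear_diff[OF linear_proj])

lemma proj_in_span: "proj A x \<in> span A"
  unfolding proj_def by (intro span_sum span_scale span_base) auto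

lemma proj_Basis:
  fixes c :: "'a::euclidean_space"
  assumes A: "A \<subseteq> Basis" and c_Basis: "c \<in> Basis" shows "proj A c = (if c \<in> A then c else 0)"
proof (rule euclidean_eqI)
  fix b :: 'a assume "b \<in> Basis"
  then show "proj A c \<bullet> b = (if c \<in> A then c else 0) \<bullet> b"
    using inner_proj[OF A, of b c] c_Basis by (simp add: inner_Basis)
qed

lemma proj_eq_0_on_span:
  fixes y :: "'a::euclidean_space"
  assumes "A \<subseteq> Basis" "A' \<subseteq> Basis" "A \<inter> A' = {}" "y \<in> span A'" shows "proj A y = 0"
proof (rule linear_eq_on_span[OF linear_proj linear_zero _ assms(4)])
  fix c assume "c \<in> A'"
  then have "c \<in> Basis" "c \<notin> A" using assms(2,3) by auto
  then show "proj A c = 0" using assms(1) by (simp add: proj_Basis)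
qed

lemma proj_eq_self_on_span:
  fixes y :: "'a::euclidean_space"
  assumes "A \<subseteq> Basis" "y \<in> span A" shows "proj A y = y"
proof (rule linear_eq_on_span[OF linear_proj linear_id _ assms(2), unfolded id_def])
  fix c assume "c \<in> A"
  then have "c \<in> Basis" using assms(1) by auto
  then show "proj A c = c" using assms(1) \<open>c \<in> A\<close> by (simp add: proj_Basis)
qed

lemma continuous_on_proj: "continuous_on S (proj A)"
  using linear_proj linear_continuous_on linear_linear by blast

lemma sum_proj:
  assumes "block_partition n B" shows "(\<Sum>i<n. proj (B i) x) = x"
proof -
  have "(\<Sum>i<n. proj (B i) x) = (\<Sum>b\<in>(\<Union>i<n. B i). (x \<bullet> b) *\<^sub>R b)"
    unfolding proj_def using assms
    by (intro sum.UNION_disjoint[symmetric]) (auto simp: block_partition_def intro: finite_subset[OF _ finite_Basis])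
  also have "\<dots> = x" using assms by (simp add: block_partition_def euclidean_representation)
  finally show ?thesis .
qed

lemma has_derivative_within_span_if_compose_proj:
  fixes v :: "'a::euclidean_space \<Rightarrow> real"
  assumes A: "A \<subseteq> Basis" and D: "((\<lambda>x. v (proj A x)) has_derivative D) (at z)"
  shows "(v has_derivative D) (at (proj A z) within span A)"
proof -
  let ?T = "\<lambda>y. y + (z - proj A z)"
  have "((\<lambda>y. v (proj A (?T y))) has_derivative D) (at (proj A z) within span A)"
    by (rule has_derivative_compose[of ?T "\<lambda>y. y", simplified])
      (use D in \<open>auto intro!: derivative_eq_intros\<close>)
  then show ?thesis
  proof (rule has_derivative_transform[rotated 2])
    show "proj A z \<in> span A" by (rule proj_in_span)
    show "v y = v (proj A (?T y))" if "y \<in> span A" for y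
      using that A
      by (simp add: linear_add[OF linear_proj] linear_diff[OF linear_proj] proj_eq_self_on_span proj_in_span)
  qed
qed

subsection \<open>Lipschitz neighbourhoods\<close>

lemma lipschitz_near_const: "lipschitz_near x (\<lambda>_. c)"
  by (rule lipschitz_nearI[OF zero_less_one lipschitz_on_constant])

lemma lipschitz_near_cong:
  assumes "lipschitz_near x g" and eq: "eventually (\<lambda>y. f y = g y) (nhds x)"
  shows "lipschitz_near x f"
proof -
  obtain S where S: "open S" "x \<in> S" and eq: "\<And>y. y \<in> S \<Longrightarrow> f y = g y"
    using eq unfolding eventually_nhds by blast
  obtain r L where r: "0 < r" "cball x r \<subseteq> S" and L: "L-lipschitz_on (cball x r) g"
    by (rule lipschitz_nearE[OF assms(1) S])
  have "L-lipschitz_on (cball x r) f" by (rule lipschitz_on_transform[OF L]) (use eq r(2) in auto)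
  with r(1) show ?thesis by (rule lipschitz_nearI)
qed

lemma lipschitz_near_compose:
  assumes g: "lipschitz_near x g" and cont: "isCont g x" and h: "lipschitz_near (g x) h"
  shows "lipschitz_near x (\<lambda>y. h (g y))"
proof -
  obtain s M where s: "0 < s" and M: "M-lipschitz_on (cball (g x) s) h" using h
    unfolding lipschitz_near_def by blast
  have "eventually (\<lambda>y. g y \<in> ball (g x) s) (nhds x)"
    using cont s by (intro topological_tendstoD) (auto simp: isCont_def tendsto_at_iff_tendsto_nhds)
  then obtain S where S: "open S" "x \<in> S" and near: "\<And>y. y \<in> S \<Longrightarrow> g y \<in> ball (g x) s"
    unfolding eventually_nhds by blast
  obtain r L where r: "0 < r" "cball x r \<subseteq> S" and L: "L-lipschitz_on (cball x r) g"
    by (rule lipschitz_nearE[OF g S])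
  have "g ` cball x r \<subseteq> ball (g x) s" using near r(2) by blast
  then have "g ` cball x r \<subseteq> cball (g x) s" using ball_subset_cball by (rule subset_trans)
  with M have "M-lipschitz_on (g ` cball x r) h" by (rule lipschitz_on_subset)
  from r(1) lipschitz_on_compose2[OF L this] show ?thesis by (rule lipschitz_nearI)
qed

lemma abs_max_diff_le: "\<bar>max a b - max c d\<bar> \<le> max \<bar>a - c\<bar> \<bar>b - d\<bar>" for a b c d :: real
  by (auto simp: max_def)

lemma lipschitz_near_max:
  fixes f g :: "'a::metric_space \<Rightarrow> real"
  assumes "lipschitz_near x f" "lipschitz_near x g" shows "lipschitz_near x (\<lambda>y. max (f y) (g y))"
proof -
  obtain r K where r: "0 < r" "K-lipschitz_on (cball x r) f" using assms(1)
    unfolding lipschitz_near_def by blast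
  obtain s L where s: "0 < s" "L-lipschitz_on (cball x s) g" using assms(2)
    unfolding lipschitz_near_def by blast
  have "(max K L)-lipschitz_on (cball x (min r s)) (\<lambda>y. max (f y) (g y))"
  proof (rule lipschitz_onI)
    fix y z assume "y \<in> cball x (min r s)" "z \<in> cball x (min r s)"
    then have "dist (f y) (f z) \<le> K * dist y z" "dist (g y) (g z) \<le> L * dist y z"
      using lipschitz_onD[OF r(2)] lipschitz_onD[OF s(2)] by auto
    then have "max (dist (f y) (f z)) (dist (g y) (g z)) \<le> max (K * dist y z) (L * dist y z)"
      by (rule max.mono)
    also have "\<dots> = max K L * dist y z" by (simp add: max_mult_distrib_right)
    finally show "dist (max (f y) (g y)) (max (f z) (g z)) \<le> max K L * dist y z"
      unfolding dist_real_def by (rule order_trans[OF abs_max_diff_le])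
  qed (use lipschitz_on_nonneg[OF r(2)] in simp)
  then show ?thesis using r(1) s(1) by (intro lipschitz_nearI[of "min r s"]) auto
qed

lemma lipschitz_near_Max:
  fixes g :: "'i \<Rightarrow> 'a::metric_space \<Rightarrow> real"
  assumes "finite A" "A \<noteq> {}" "\<And>i. i \<in> A \<Longrightarrow> lipschitz_near x (g i)"
  shows "lipschitz_near x (\<lambda>y. Max ((\<lambda>i. g i y) ` A))"
  using assms
proof (induction A rule: finite_ne_induct)
  case (insert i A)
  have "lipschitz_near x (\<lambda>y. max (g i y) (Max ((\<lambda>i. g i y) ` A)))"
    by (rule lipschitz_near_max[OF insert.prems[OF insertI1] insert.IH[OF insert.prems[OF insertI2]]])
  then show ?case using insert.hyps by simp
qed simp

lemma uniform_lipschitz_sum: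
  fixes g :: "'i \<Rightarrow> 'p \<Rightarrow> 'a::metric_space \<Rightarrow> 'c::real_normed_vector"
  assumes "finite I" "\<And>i. i \<in> I \<Longrightarrow> \<exists>\<delta>>0. \<exists>L. \<forall>v\<in>S. L-lipschitz_on (cball x \<delta>) (g i v)"
  shows "\<exists>\<delta>>0. \<exists>L. \<forall>v\<in>S. L-lipschitz_on (cball x \<delta>) (\<lambda>y. \<Sum>i\<in>I. g i v y)"
  using assms
proof (induction I rule: finite_induct)
  case empty
  show ?case by (intro exI[of _ 1] conjI exI[of _ 0] ballI) (simp_all add: lipschitz_on_constant)
next
  case (insert i I)
  from insert.IH[OF insert.prems[OF insertI2]] obtain \<delta> K where \<delta>: "0 < \<delta>"
    and K: "\<And>v. v \<in> S \<Longrightarrow> K-lipschitz_on (cball x \<delta>) (\<lambda>y. \<Sum>i\<in>I. g i v y)" by blast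
  obtain \<epsilon> L where \<epsilon>: "0 < \<epsilon>" and L: "\<And>v. v \<in> S \<Longrightarrow> L-lipschitz_on (cball x \<epsilon>) (g i v)"
    using insert.prems[OF insertI1] by blast
  have "(L + K)-lipschitz_on (cball x (min \<delta> \<epsilon>)) (\<lambda>y. \<Sum>i\<in>insert i I. g i v y)" if "v \<in> S" for v
  proof -
    have "L-lipschitz_on (cball x (min \<delta> \<epsilon>)) (g i v)"
      by (rule lipschitz_on_subset[OF L[OF that]]) auto
    moreover have "K-lipschitz_on (cball x (min \<delta> \<epsilon>)) (\<lambda>y. \<Sum>i\<in>I. g i v y)"
      by (rule lipschitz_on_subset[OF K[OF that]]) auto
    ultimately show ?thesis using insert.hyps by (simp add: lipschitz_on_add)
  qed
  then show ?case using \<delta> \<epsilon> by (intro exI[of _ "min \<delta> \<epsilon>"] exI[of _ "L + K"] conjI ballI) simp_all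
qed

subsection \<open>Increments against the flow\<close>

lemma derivative_le_if_increase_backwards:
  assumes D: "(V has_derivative D) (at x)"
    and increase: "eventually (\<lambda>h. V x + h * c \<le> V (x - h *\<^sub>R v)) (at_right 0)"
  shows "D v \<le> - c"
proof -
  have "((\<lambda>h. (V (x + h *\<^sub>R - v) - V x) / h) \<longlongrightarrow> D (- v)) (at_right 0)"
    using has_derivative_imp_right_deriv_along[OF D] by (simp only: right_deriv_along_iff)
  moreover have "eventually (\<lambda>h. c \<le> (V (x + h *\<^sub>R - v) - V x) / h) (at_right 0)"
    using increase eventually_at_right_less by eventually_elim (simp add: field_simps)
  ultimately have "c \<le> D (- v)" by (rule tendsto_lowerbound) simp
  then show ?thesis by (simp add: linear_neg[OF has_derivative_linear[OF D]])
qed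

lemma eventually_slope_increase:
  assumes slopes: "slopes_between m M {a..b} g" and mono: "\<And>y z. a \<le> y \<Longrightarrow> y \<le> z \<Longrightarrow> g y \<le> g z"
    and w: "a \<le> w" "w < b" and c_nonneg: "0 \<le> c"
    and increase: "eventually (\<lambda>h. w + h * c \<le> w' h) (at_right 0)"
  shows "eventually (\<lambda>h. g w + h * (m * c) \<le> g (w' h)) (at_right 0)"
proof -
  have "((\<lambda>h. w + h * c) \<longlongrightarrow> w + 0 * c) (at_right 0)" by (intro tendsto_intros)
  then have "eventually (\<lambda>h. w + h * c < b) (at_right 0)" using w by (intro order_tendstoD(2)) auto
  with increase show ?thesis using eventually_at_right_less
  proof eventually_elim
    case (elim h)
    have hc: "0 \<le> h * c" using elim(3) c_nonneg by simp
    have "m * (h * c) \<le> g (w + h * c) - g w"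
      using slopes_betweenD(1)[OF slopes, of w "w + h * c"] w hc elim(2) by simp
    moreover have "g (w + h * c) \<le> g (w' h)" using w hc elim(1) by (intro mono) auto
    ultimately show ?case by (simp add: mult_ac)
  qed
qed

subsection \<open>The interconnection\<close>

locale interconnection =
  fixes n :: nat and Isum :: "nat set"
    and B :: "nat \<Rightarrow> 'a::euclidean_space set" and C :: "nat \<Rightarrow> 'b::euclidean_space set"
    and f :: "nat \<Rightarrow> 'a \<Rightarrow> 'b \<Rightarrow> 'a" and V :: "nat \<Rightarrow> 'a \<Rightarrow> real"
    and \<gamma> :: "nat \<Rightarrow> nat \<Rightarrow> real \<Rightarrow> real" and \<gamma>u \<alpha>i :: "nat \<Rightarrow> real \<Rightarrow> real"
  assumes Bpart: "block_partition n B" and Cpart: "block_partition n C"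
    and f_range: "\<forall>i<n. \<forall>x. \<forall>v\<in>span (C i). f i x v \<in> span (B i)"
    and f_cont: "\<forall>i<n. continuous_on (UNIV \<times> span (C i)) (\<lambda>(x, v). f i x v)"
    and f_lip: "\<forall>i<n. \<forall>r. \<forall>x. \<exists>\<delta>>0. \<exists>L. \<forall>v\<in>span (C i). norm v \<le> r \<longrightarrow>
                   L-lipschitz_on (cball x \<delta>) (\<lambda>y. f i y v)"
    and lyap: "\<forall>i<n. sub_ISS_lyapunov n Isum B C f V \<gamma> \<gamma>u \<alpha>i i"
begin

lemma V_cont: "i < n \<Longrightarrow> continuous_on (span (B i)) (V i)"
  and V_proper: "i < n \<Longrightarrow> proper_posdef (span (B i)) (V i)"
  and V_lip: "i < n \<Longrightarrow> loc_lipschitz_on (span (B i) - {0}) (V i)"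
  and \<gamma>u: "i < n \<Longrightarrow> classK (\<gamma>u i)" and \<alpha>i: "i < n \<Longrightarrow> posdef (\<alpha>i i)"
  using lyap by (auto simp: sub_ISS_lyapunov_def)

lemma B_Basis: "i < n \<Longrightarrow> B i \<subseteq> Basis" and C_Basis: "i < n \<Longrightarrow> C i \<subseteq> Basis"
  using Bpart Cpart by (auto simp: block_partition_def)

sublocale gain_operator n Isum \<gamma>
proof
  have "(\<Union>i<n. B i) \<noteq> {}" using Bpart nonempty_Basis by (simp add: block_partition_def)
  then show "0 < n" by (cases n) auto
qed (use lyap in \<open>auto simp: sub_ISS_lyapunov_def\<close>)

definition F :: "'a \<Rightarrow> 'b \<Rightarrow> 'a" where
  "F x u = (\<Sum>i<n. f i x (proj (C i) u))"

lemma f_in_span: "i < n \<Longrightarrow> f i x (proj (C i) u) \<in> span (B i)"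
  using f_range proj_in_span by blast

lemma proj_F:
  assumes i: "i < n" shows "proj (B i) (F x u) = f i x (proj (C i) u)"
proof -
  have "proj (B i) (f j x (proj (C j) u)) = (if j = i then f i x (proj (C i) u) else 0)"
    if j: "j < n" for j
  proof (cases "j = i")
    case True
    then show ?thesis using proj_eq_self_on_span[OF B_Basis f_in_span] i by simp
  next
    case False
    then have "B i \<inter> B j = {}" using Bpart i j unfolding block_partition_def by auto
    then show ?thesis using proj_eq_0_on_span[OF B_Basis B_Basis _ f_in_span] i j False by simp
  qed
  then show ?thesis using i unfolding F_def by (simp add: linear_sum[OF linear_proj])
qed

lemma continuous_on_f_proj:
  assumes "i < n" shows "continuous_on UNIV (\<lambda>(x, u). f i x (proj (C i) u))"
proof -
  have "continuous_on UNIV (\<lambda>p::'a \<times> 'b. (\<lambda>(x, v). f i x v) (fst p, proj (C i) (snd p)))"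
    by (rule continuous_on_compose2[OF f_cont[rule_format, OF assms]])
      (auto intro!: continuous_intros continuous_on_compose2[OF continuous_on_proj[of UNIV]] simp: proj_in_span)
  then show ?thesis by (simp add: case_prod_beta')
qed

lemma continuous_on_F: "continuous_on UNIV (\<lambda>(x, u). F x u)"
proof -
  have "continuous_on UNIV (\<lambda>p. \<Sum>i<n. (\<lambda>(x, u). f i x (proj (C i) u)) p)"
    using continuous_on_f_proj by (intro continuous_on_sum) auto
  then show ?thesis by (simp add: F_def case_prod_beta')
qed

lemma uniform_lipschitz_F: "\<exists>\<delta>>0. \<exists>L. \<forall>v. norm v \<le> r \<longrightarrow> L-lipschitz_on (cball x \<delta>) (\<lambda>y. F y v)"
proof -
  have "\<exists>\<delta>>0. \<exists>L. \<forall>v\<in>cball 0 r. L-lipschitz_on (cball x \<delta>) (\<lambda>y. \<Sum>i<n. f i y (proj (C i) v))"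
  proof (rule uniform_lipschitz_sum)
    fix i assume "i \<in> {..<n}"
    then have i: "i < n" by simp
    obtain \<delta> L where "0 < \<delta>"
      and L: "\<And>v. v \<in> span (C i) \<Longrightarrow> norm v \<le> r \<Longrightarrow> L-lipschitz_on (cball x \<delta>) (\<lambda>y. f i y v)"
      using f_lip i by blast
    have "L-lipschitz_on (cball x \<delta>) (\<lambda>y. f i y (proj (C i) v))" if "v \<in> cball 0 r" for v
      using order_trans[OF norm_proj_le[OF C_Basis[OF i]]] that by (intro L proj_in_span) simp
    then show "\<exists>\<delta>>0. \<exists>L. \<forall>v\<in>cball 0 r. L-lipschitz_on (cball x \<delta>) (\<lambda>y. f i y (proj (C i) v))"
      using \<open>0 < \<delta>\<close> by blast
  qed simp
  then show ?thesis by (simp add: F_def Ball_def)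
qed

definition component :: "nat \<Rightarrow> 'a \<Rightarrow> real" where
  "component i x = V i (proj (B i) x)"

lemma component_nonneg: "i < n \<Longrightarrow> 0 \<le> component i x"
  unfolding component_def by (rule proper_posdef_nonneg[OF V_proper proj_in_span])

lemma continuous_on_component: "i < n \<Longrightarrow> continuous_on S (component i)"
  unfolding component_def
  by (rule continuous_on_compose2[OF V_cont continuous_on_proj]) (auto simp: proj_in_span)

lemma isCont_component: "i < n \<Longrightarrow> isCont (component i) x"
  using continuous_on_component[of i UNIV] by (simp add: continuous_on_eq_continuous_at)

lemma lipschitz_near_component:
  assumes i: "i < n" and x: "0 < component i x"
  shows "lipschitz_near x (component i)"
proof -
  let ?p = "proj (B i) x"
  have "?p \<noteq> 0" using x proper_posdef_0[OF V_proper[OF i] span_0] by (auto simp: component_def)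
  then obtain r L where r: "r > 0" and L: "L-lipschitz_on (cball ?p r \<inter> (span (B i) - {0})) (V i)"
    using V_lip[OF i] proj_in_span[of "B i" x] unfolding loc_lipschitz_on_def by blast
  define \<delta> where "\<delta> = min r (norm ?p / 2)"
  have \<delta>: "0 < \<delta>" "\<delta> \<le> r" "\<delta> < norm ?p" using r \<open>?p \<noteq> 0\<close> by (auto simp: \<delta>_def min_def)
  have "proj (B i) y \<in> cball ?p r \<inter> (span (B i) - {0})" if "y \<in> cball x \<delta>" for y
  proof -
    have "dist ?p (proj (B i) y) \<le> \<delta>" using dist_proj_le[OF B_Basis[OF i], of x y] that by simp
    then show ?thesis using \<delta> proj_in_span by (auto simp: dist_norm)
  qed
  then have "L-lipschitz_on (proj (B i) ` cball x \<delta>) (V i)"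
    by (intro lipschitz_on_subset[OF L] image_subsetI)
  moreover have "1-lipschitz_on (cball x \<delta>) (proj (B i))"
    by (rule lipschitz_onI) (simp_all add: dist_proj_le[OF B_Basis[OF i]])
  ultimately have "(L * 1)-lipschitz_on (cball x \<delta>) (component i)"
    unfolding component_def by (intro lipschitz_on_compose2)
  with \<delta>(1) show ?thesis by (rule lipschitz_nearI)
qed

lemma component_decreases:
  assumes i: "i < n" and D: "(component i has_derivative D) (at z)"
    and above: "Gambar n Isum \<gamma> \<gamma>u (\<lambda>j. component j z) (norm u) i \<le> component i z"
  shows "D (f i z (proj (C i) u)) \<le> - \<alpha>i i (norm (proj (B i) z))"
proof -
  have D': "(V i has_derivative D) (at (proj (B i) z) within span (B i))"
    using D
      unfolding component_def by (rule has_derivative_within_span_if_compose_proj[OF B_Basis[OF i]])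
  have decreases: "\<forall>x u D. (V i has_derivative D) (at (proj (B i) x) within span (B i)) \<longrightarrow>
      Gambar n Isum \<gamma> \<gamma>u (\<lambda>j. component j x) (norm u) i \<le> component i x \<longrightarrow>
      D (f i x (proj (C i) u)) \<le> - \<alpha>i i (norm (proj (B i) x))"
    using lyap i by (simp add: sub_ISS_lyapunov_def component_def)
  show ?thesis by (rule decreases[rule_format, OF D' above])
qed

lemma open_above_gain:
  assumes "i < n" shows "open {z. Gambar n Isum \<gamma> \<gamma>u (\<lambda>j. component j z) c i < component i z}"
proof (rule open_Collect_less[OF _ continuous_on_component[OF assms]])
  have "isCont (\<lambda>z. G (\<lambda>j. component j z) (\<gamma>u i c) i) z" for z
    unfolding isCont_def using isCont_component component_nonneg
    by (intro G_tendsto[where s="\<lambda>z j. component j z", OF assms]) (simp_all add: isCont_def)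
  then show "continuous_on UNIV (\<lambda>z. Gambar n Isum \<gamma> \<gamma>u (\<lambda>j. component j z) c i)"
    unfolding Gambar_eq_G[of \<gamma>u] by (simp add: continuous_on_eq_continuous_at)
qed

lemma component_increases_backwards:
  assumes i: "i < n" and x: "0 < component i x" and \<epsilon>: "0 < \<epsilon>"
    and above: "Gambar n Isum \<gamma> \<gamma>u (\<lambda>j. component j x) (norm u) i < component i x"
  shows "eventually (\<lambda>h. component i x + h * (\<alpha>i i (norm (proj (B i) x)) - \<epsilon>) \<le> component i (x - h *\<^sub>R F x u)) (at_right 0)"
proof -
  let ?\<Phi> = "\<lambda>z. f i z (proj (C i) u)"
  let ?\<beta> = "\<lambda>z. \<alpha>i i (norm (proj (B i) z))"
  obtain r K where r: "0 < r" and above_ball: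
      "cball x r \<subseteq> {z. Gambar n Isum \<gamma> \<gamma>u (\<lambda>j. component j z) (norm u) i < component i z}"
    and lip: "K-lipschitz_on (cball x r) (component i)"
    by (rule lipschitz_nearE[OF lipschitz_near_component[OF i x] open_above_gain[OF i]]) (use above in auto)
  have "continuous_on UNIV (\<lambda>z. (\<lambda>(x, u). f i x (proj (C i) u)) (z, u))"
    by (rule continuous_on_compose2[OF continuous_on_f_proj[OF i]]) (auto intro!: continuous_intros)
  then have \<Phi>: "isCont ?\<Phi> x" by (simp add: continuous_on_eq_continuous_at)
  have "continuous_on UNIV ?\<beta>"
    by (rule continuous_on_compose2[OF posdef_cont[OF \<alpha>i[OF i]] continuous_on_norm[OF continuous_on_proj]]) auto
  then have \<beta>: "isCont ?\<beta> x" by (simp add: continuous_on_eq_continuous_at)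
  obtain \<delta> where "0 < \<delta>" and \<delta>: "\<And>z h. 0 \<le> h \<Longrightarrow> z \<in> ball x \<delta> \<Longrightarrow> z + h *\<^sub>R ?\<Phi> x \<in> ball x \<delta> \<Longrightarrow>
      component i (z + h *\<^sub>R ?\<Phi> x) \<le> component i z + h * (\<epsilon> - ?\<beta> x)"
  proof (rule increment_along_field[where y=x and \<Phi>="?\<Phi>" and \<beta>="?\<beta>", OF lip r \<Phi> \<beta> _ \<epsilon>])
    fix z D assume z: "z \<in> ball x r" and D: "(component i has_derivative D) (at z)"
    have "z \<in> cball x r" using z by simp
    with above_ball show "D (?\<Phi> z) \<le> - ?\<beta> z"
      by (intro component_decreases[OF i D]) (auto intro: less_imp_le)
  qed blast
  have "eventually (\<lambda>h. x + h *\<^sub>R - ?\<Phi> x \<in> ball x \<delta>) (at_right 0)"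
    by (rule eventually_add_scaleR_in_ball[OF \<open>0 < \<delta>\<close>])
  then show ?thesis using eventually_at_right_less
  proof eventually_elim
    case (elim h)
    have "proj (B i) (?\<Phi> x) = ?\<Phi> x" by (rule proj_eq_self_on_span[OF B_Basis[OF i] f_in_span[OF i]])
    then have "component i (x - h *\<^sub>R F x u) = component i (x - h *\<^sub>R ?\<Phi> x)"
      unfolding component_def
        by (simp add: linear_diff[OF linear_proj] linear_scale[OF linear_proj] proj_F[OF i])
    then show ?case using \<delta>[of h "x - h *\<^sub>R ?\<Phi> x"] elim \<open>0 < \<delta>\<close> by (simp add: algebra_simps)
  qed
qed

end

locale interconnection_path = interconnection +
  fixes \<sigma> :: "nat \<Rightarrow> real \<Rightarrow> real" and \<phi> :: "real \<Rightarrow> real"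
  assumes \<sigma>: "i < n \<Longrightarrow> classKinf (\<sigma> i)" and \<sigma>_bilip: "i < n \<Longrightarrow> loc_bilip (\<sigma> i)"
    and \<phi>: "classKinf \<phi>"
    and path: "0 < r \<Longrightarrow> i < n \<Longrightarrow> Gambar n Isum \<gamma> \<gamma>u (\<lambda>j. \<sigma> j r) (\<phi> r) i < \<sigma> i r"
begin

definition rescaled :: "nat \<Rightarrow> 'a \<Rightarrow> real" where
  "rescaled i x = sinv (\<sigma> i) (component i x)"

definition composite :: "'a \<Rightarrow> real" where
  "composite x = Max ((\<lambda>i. rescaled i x) ` {..<n})"

lemma classK_sinv_\<sigma>: "i < n \<Longrightarrow> classK (sinv (\<sigma> i))"
  by (rule classKinfD[OF classKinf_sinv[OF \<sigma>]])

lemma rescaled_nonneg: "i < n \<Longrightarrow> 0 \<le> rescaled i x"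
  unfolding rescaled_def by (rule classK_nonneg[OF classK_sinv_\<sigma> component_nonneg])

lemma isCont_rescaled:
  assumes "i < n" shows "isCont (rescaled i) x"
proof -
  have "continuous_on UNIV (rescaled i)"
    unfolding rescaled_def
    by (rule continuous_on_compose2[OF classK_cont[OF classK_sinv_\<sigma>] continuous_on_component])
      (use assms component_nonneg in auto)
  then show ?thesis by (simp add: continuous_on_eq_continuous_at)
qed

lemma rescaled_le_composite: "i < n \<Longrightarrow> rescaled i x \<le> composite x"
  unfolding composite_def by (rule Max_ge) auto

lemma ex_active: "\<exists>i<n. rescaled i x = composite x"
proof -
  have "composite x \<in> (\<lambda>i. rescaled i x) ` {..<n}" unfolding composite_def
    using n_pos by (intro Max_in) auto
  then show ?thesis by auto
qed

lemma composite_nonneg: "0 \<le> composite x"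
  using rescaled_nonneg[OF n_pos] rescaled_le_composite[OF n_pos] by (rule order_trans)

lemma isCont_composite: "isCont composite x"
  unfolding isCont_def composite_def
  using n_pos isCont_rescaled by (intro tendsto_Max_image) (auto simp: isCont_def)

lemma component_le: "i < n \<Longrightarrow> component i x \<le> \<sigma> i (composite x)"
  using rescaled_le_composite[of i x] sinv_le_iff[OF \<sigma> component_nonneg composite_nonneg, of i i x x]
  by (simp add: rescaled_def)

lemma component_active: "i < n \<Longrightarrow> rescaled i x = composite x \<Longrightarrow> component i x = \<sigma> i (composite x)"
  using apply_sinv[OF \<sigma> component_nonneg, of i i x] by (simp add: rescaled_def)

lemma ex_composite_upper_bound: "\<exists>\<Psi>. classKinf \<Psi> \<and> (\<forall>x. composite x \<le> \<Psi> (norm x))"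
proof -
  have "\<exists>\<psi>. classKinf \<psi> \<and> (\<forall>x\<in>span (B i). V i x \<le> \<psi> (norm x))" if "i < n" for i
    using V_proper[OF that] unfolding proper_posdef_def by blast
  then obtain \<psi> where \<psi>: "\<And>i. i < n \<Longrightarrow> classKinf (\<psi> i)"
    and V_le: "\<And>i x. i < n \<Longrightarrow> x \<in> span (B i) \<Longrightarrow> V i x \<le> \<psi> i (norm x)" by metis
  define \<Psi> where "\<Psi> r = (\<Sum>i<n. sinv (\<sigma> i) (\<psi> i r))" for r
  have summand: "classKinf (\<lambda>r. sinv (\<sigma> i) (\<psi> i r))" if "i < n" for i
    by (rule classKinf_compose[OF classKinf_sinv[OF \<sigma>[OF that]] \<psi>[OF that]])
  have "composite x \<le> \<Psi> (norm x)" for x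
  proof -
    obtain i where i: "i < n" "rescaled i x = composite x" using ex_active by blast
    have "component i x \<le> \<psi> i (norm (proj (B i) x))"
      unfolding component_def by (rule V_le[OF i(1) proj_in_span])
    also have "\<dots> \<le> \<psi> i (norm x)"
      by (rule classK_mono[OF classKinfD[OF \<psi>[OF i(1)]] norm_ge_zero norm_proj_le[OF B_Basis[OF i(1)]]])
    finally have "composite x \<le> sinv (\<sigma> i) (\<psi> i (norm x))"
      unfolding i(2)[symmetric] rescaled_def
        by (rule classK_mono[OF classK_sinv_\<sigma>[OF i(1)] component_nonneg[OF i(1)]])
    also have "\<dots> \<le> \<Psi> (norm x)"
      unfolding \<Psi>_def using i(1) classK_nonneg[OF classKinfD[OF summand] norm_ge_zero]
      by (intro member_le_sum) auto
    finally show ?thesis .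
  qed
  moreover have "classKinf \<Psi>" unfolding \<Psi>_def using n_pos summand by (intro classKinf_sum) auto
  ultimately show ?thesis by blast
qed

lemma ex_composite_lower_bound: "\<exists>\<Psi>. classKinf \<Psi> \<and> (\<forall>x. \<Psi> (norm x) \<le> composite x)"
proof -
  have "\<exists>\<psi>. classKinf \<psi> \<and> (\<forall>x\<in>span (B i). \<psi> (norm x) \<le> V i x)" if "i < n" for i
    using V_proper[OF that] unfolding proper_posdef_def by blast
  then obtain \<psi> where \<psi>: "\<And>i. i < n \<Longrightarrow> classKinf (\<psi> i)"
    and le_V: "\<And>i x. i < n \<Longrightarrow> x \<in> span (B i) \<Longrightarrow> \<psi> i (norm x) \<le> V i x" by metis
  define \<eta> where "\<eta> r = (\<Sum>i<n. sinv (\<psi> i) (\<sigma> i r))" for r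
  have "classKinf (\<lambda>r. sinv (\<psi> i) (\<sigma> i r))" if "i < n" for i
    by (rule classKinf_compose[OF classKinf_sinv[OF \<psi>[OF that]] \<sigma>[OF that]])
  then have \<eta>: "classKinf \<eta>" unfolding \<eta>_def using n_pos by (intro classKinf_sum) auto
  have "norm x \<le> \<eta> (composite x)" for x
  proof -
    have "norm (proj (B i) x) \<le> sinv (\<psi> i) (\<sigma> i (composite x))" if i: "i < n" for i
    proof -
      have "\<psi> i (norm (proj (B i) x)) \<le> \<sigma> i (composite x)"
        using le_V[OF i proj_in_span] component_le[OF i]
          unfolding component_def by (rule order_trans)
      then show ?thesis
        using classK_nonneg[OF classKinfD[OF \<sigma>[OF i]] composite_nonneg]
          by (simp add: le_sinv_iff[OF \<psi>[OF i]])
    qed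
    then have "(\<Sum>i<n. norm (proj (B i) x)) \<le> \<eta> (composite x)"
      unfolding \<eta>_def by (intro sum_mono) simp
    moreover have "norm x \<le> (\<Sum>i<n. norm (proj (B i) x))"
      using norm_sum[of "\<lambda>i. proj (B i) x" "{..<n}"] by (simp add: sum_proj[OF Bpart])
    ultimately show ?thesis by linarith
  qed
  then have "sinv \<eta> (norm x) \<le> composite x" for x by (simp add: sinv_le_iff[OF \<eta>] composite_nonneg)
  then show ?thesis using classKinf_sinv[OF \<eta>] by blast
qed

lemma proper_posdef_composite: "proper_posdef UNIV composite"
  unfolding proper_posdef_def using ex_composite_lower_bound ex_composite_upper_bound by blast

lemma lipschitz_near_truncated_rescaled:
  assumes i: "i < n" and c_pos: "0 < c"
  shows "lipschitz_near x (\<lambda>y. max (rescaled i y) c)"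
proof (cases "rescaled i x < c")
  case True
  have "eventually (\<lambda>y. rescaled i y < c) (nhds x)"
    using isCont_rescaled[OF i, of x] True
    by (intro order_tendstoD(2)) (auto simp: isCont_def tendsto_at_iff_tendsto_nhds)
  then have "eventually (\<lambda>y. max (rescaled i y) c = c) (nhds x)" by eventually_elim simp
  with lipschitz_near_const show ?thesis by (rule lipschitz_near_cong)
next
  case False
  have "0 < component i x"
  proof (rule ccontr)
    assume "\<not> 0 < component i x"
    then have "component i x = 0" using component_nonneg[OF i, of x] by simp
    then show False using False c_pos classK_0[OF classK_sinv_\<sigma>[OF i]] by (simp add: rescaled_def)
  qed
  moreover have "loc_lipschitz_on {0<..} (sinv (\<sigma> i))"
    by (rule loc_bilip_imp_loc_lipschitz_on[OF loc_bilip_sinv[OF \<sigma>[OF i] \<sigma>_bilip[OF i]]])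
  ultimately have "lipschitz_near (component i x) (sinv (\<sigma> i))" "lipschitz_near x (component i)"
    using lipschitz_near_component[OF i] by (simp_all add: loc_lipschitz_on_iff_lipschitz_near)
  then have "lipschitz_near x (rescaled i)"
    unfolding rescaled_def by (rule lipschitz_near_compose[OF _ isCont_component[OF i], rotated])
  then show ?thesis by (rule lipschitz_near_max[OF _ lipschitz_near_const])
qed

text \<open>Near \<open>x \<noteq> 0\<close> the terms below half the maximum are inactive, so truncating all of them at that
  level does not change the maximum, and removes the points where \<open>V i\<close> is not Lipschitz.\<close>
lemma loc_lipschitz_on_composite: "loc_lipschitz_on (UNIV - {0}) composite"
proof -
  have "lipschitz_near x composite" if "x \<noteq> 0" for x
  proof -
    define c where "c = composite x / 2"
    have c_bounds: "0 < c" "c < composite x"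
      using proper_posdef_pos[OF proper_posdef_composite _ that] by (auto simp: c_def)
    have "lipschitz_near x (\<lambda>y. Max ((\<lambda>i. max (rescaled i y) c) ` {..<n}))"
      using n_pos lipschitz_near_truncated_rescaled[OF _ c_bounds(1)]
        by (intro lipschitz_near_Max) auto
    moreover have "eventually (\<lambda>y. c < composite y) (nhds x)"
      using isCont_composite[of x] c_bounds(2)
        by (intro order_tendstoD(1)) (auto simp: isCont_def tendsto_at_iff_tendsto_nhds)
    then have "eventually (\<lambda>y. composite y = Max ((\<lambda>i. max (rescaled i y) c) ` {..<n})) (nhds x)"
    proof eventually_elim
      case (elim y)
      obtain i where i: "i < n" "rescaled i y = composite y" using ex_active by blast
      show ?case
      proof (rule Max_eqI[symmetric])
        show "composite y \<in> (\<lambda>i. max (rescaled i y) c) ` {..<n}"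
          using i elim by (intro image_eqI[of _ _ i]) auto
      qed (use rescaled_le_composite elim in \<open>auto intro: less_imp_le\<close>)
    qed
    ultimately show ?thesis by (rule lipschitz_near_cong)
  qed
  then show ?thesis by (simp add: loc_lipschitz_on_iff_lipschitz_near open_delete)
qed

lemma active_above_gain:
  assumes i: "i < n" and active: "rescaled i x = composite x" and x: "0 < composite x"
    and u: "norm u \<le> \<phi> (composite x)"
  shows "Gambar n Isum \<gamma> \<gamma>u (\<lambda>j. component j x) (norm u) i < component i x"
proof -
  have "Gambar n Isum \<gamma> \<gamma>u (\<lambda>j. component j x) (norm u) i \<le>
      Gambar n Isum \<gamma> \<gamma>u (\<lambda>j. \<sigma> j (composite x)) (\<phi> (composite x)) i"
    unfolding Gambar_eq_G[of \<gamma>u]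
    by (intro G_mono i component_nonneg component_le classK_mono[OF \<gamma>u] norm_ge_zero u)
  also have "\<dots> < component i x" using path[OF x i] component_active[OF i active] by simp
  finally show ?thesis .
qed

text \<open>At a point of differentiability of the maximum an active term need not be differentiable. It
  does touch the maximum from below, so its increase along \<open>- F x u\<close> bounds \<open>D (- F x u)\<close>.\<close>
lemma active_decrease:
  assumes i: "i < n" and active: "rescaled i x = composite x"
    and D: "(composite has_derivative D) (at x)" and c_nonneg: "0 \<le> c"
    and slopes: "slopes_between m M {a..b} (sinv (\<sigma> i))" and a: "0 \<le> a"
    and component: "component i x \<in> {a..<b}"
    and increase: "eventually (\<lambda>h. component i x + h * c \<le> component i (x - h *\<^sub>R F x u)) (at_right 0)"
  shows "D (F x u) \<le> - (m * c)"
proof (rule derivative_le_if_increase_backwards[OF D])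
  have "eventually (\<lambda>h. sinv (\<sigma> i) (component i x) + h * (m * c) \<le>
      sinv (\<sigma> i) (component i (x - h *\<^sub>R F x u))) (at_right 0)"
    by (rule eventually_slope_increase[OF slopes _ _ _ c_nonneg increase])
      (use component a in \<open>auto intro: classK_mono[OF classK_sinv_\<sigma>[OF i]]\<close>)
  then show "eventually (\<lambda>h. composite x + h * (m * c) \<le> composite (x - h *\<^sub>R F x u)) (at_right 0)"
    unfolding rescaled_def[symmetric] active
    by eventually_elim (rule order_trans[OF _ rescaled_le_composite[OF i]])
qed

lemma active_uniform_decrease:
  assumes i: "i < n" and p: "0 < p"
  shows "\<exists>c>0. \<forall>x u D. composite x \<in> {p..q} \<longrightarrow> rescaled i x = composite x \<longrightarrow> norm u \<le> \<phi> (composite x) \<longrightarrow>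
    (composite has_derivative D) (at x) \<longrightarrow> D (F x u) \<le> - c"
proof (cases "p \<le> q")
  case True
  define a b where "a = \<sigma> i p" and "b = \<sigma> i q"
  have a: "0 < a" unfolding a_def by (rule classK_pos[OF classKinfD[OF \<sigma>[OF i]] p])
  have ab: "a \<le> b" unfolding a_def b_def
    using p True by (intro classK_mono[OF classKinfD[OF \<sigma>[OF i]]]) auto
  obtain m M where m: "0 < m" and slopes: "slopes_between m M {a..b + 1} (sinv (\<sigma> i))"
    by (rule loc_bilipE[OF loc_bilip_sinv[OF \<sigma>[OF i] \<sigma>_bilip[OF i]] a, of "b + 1"]) (use ab in auto)
  obtain \<mu> where \<mu>: "0 < \<mu>" "\<And>y. y \<in> span (B i) \<Longrightarrow> V i y \<in> {a..b} \<Longrightarrow> \<mu> \<le> \<alpha>i i (norm y)"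
    using ex_posdef_lower_bound_on_level_band[OF V_proper[OF i] \<alpha>i[OF i] a, of b] by blast
  have "D (F x u) \<le> - (m * (\<mu> / 2))"
    if x: "composite x \<in> {p..q}" and active: "rescaled i x = composite x"
      and u: "norm u \<le> \<phi> (composite x)"
      and D: "(composite has_derivative D) (at x)" for x u D
  proof -
    have component: "component i x \<in> {a..b}"
      unfolding component_active[OF i active] a_def b_def
      using x p by (auto intro!: classK_mono[OF classKinfD[OF \<sigma>[OF i]]])
    have "Gambar n Isum \<gamma> \<gamma>u (\<lambda>j. component j x) (norm u) i < component i x"
      using x p by (intro active_above_gain[OF i active _ u]) auto
    then have "eventually (\<lambda>h. component i x + h * (\<alpha>i i (norm (proj (B i) x)) - \<mu> / 2)
        \<le> component i (x - h *\<^sub>R F x u)) (at_right 0)"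
      using component a \<mu>(1) by (intro component_increases_backwards[OF i]) auto
    moreover have rate: "\<mu> \<le> \<alpha>i i (norm (proj (B i) x))"
      using component by (intro \<mu>(2) proj_in_span) (simp add: component_def)
    ultimately have "D (F x u) \<le> - (m * (\<alpha>i i (norm (proj (B i) x)) - \<mu> / 2))"
      using component a \<mu>(1) by (intro active_decrease[OF i active D _ slopes]) auto
    moreover have "m * (\<mu> / 2) \<le> m * (\<alpha>i i (norm (proj (B i) x)) - \<mu> / 2)"
      using rate m by (intro mult_left_mono) auto
    ultimately show ?thesis by linarith
  qed
  then show ?thesis using m \<mu>(1) by (intro exI[of _ "m * (\<mu> / 2)"]) auto
qed (auto intro: exI[of _ 1])

lemma composite_uniform_decrease:
  assumes p: "0 < p"
  shows "\<exists>c>0. \<forall>x u D. composite x \<in> {p..q} \<longrightarrow> norm u \<le> \<phi> (composite x) \<longrightarrow>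
    (composite has_derivative D) (at x) \<longrightarrow> D (F x u) \<le> - c"
proof -
  obtain c where c_pos: "\<And>i. i < n \<Longrightarrow> 0 < c i"
    and decrease: "\<And>i x u D. i < n \<Longrightarrow> composite x \<in> {p..q} \<Longrightarrow>
      rescaled i x = composite x \<Longrightarrow> norm u \<le> \<phi> (composite x) \<Longrightarrow> (composite has_derivative D) (at x) \<Longrightarrow>
      D (F x u) \<le> - c i"
    using active_uniform_decrease[OF _ p, of _ q] by metis
  have "0 < Min (c ` {..<n})" using n_pos c_pos by (subst Min_gr_iff) auto
  moreover have "D (F x u) \<le> - Min (c ` {..<n})"
    if x: "composite x \<in> {p..q}" "norm u \<le> \<phi> (composite x)" "(composite has_derivative D) (at x)" for x u D
  proof -
    obtain i where i: "i < n" "rescaled i x = composite x" using ex_active by blast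
    have "Min (c ` {..<n}) \<le> c i" using i(1) by (intro Min_le) auto
    then show ?thesis using decrease[OF i(1) x(1) i(2) x(2,3)] by simp
  qed
  ultimately show ?thesis by blast
qed

lemma composite_derivative_at_0_le:
  assumes "(composite has_derivative D) (at 0)" shows "D v \<le> 0"
proof -
  have "composite 0 = 0" by (rule proper_posdef_0[OF proper_posdef_composite UNIV_I])
  then have "eventually (\<lambda>h. composite 0 + h * 0 \<le> composite (0 - h *\<^sub>R v)) (at_right 0)"
    using composite_nonneg by simp
  from derivative_le_if_increase_backwards[OF assms this] show ?thesis by simp
qed

lemma ex_decrease_rate:
  "\<exists>\<alpha>. posdef \<alpha> \<and> (\<forall>x u D. norm u \<le> \<phi> (composite x) \<longrightarrow> (composite has_derivative D) (at x) \<longrightarrow>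
     D (F x u) \<le> - \<alpha> (norm x))"
proof -
  let ?P = "\<lambda>s c. \<forall>x u D. norm x = s \<longrightarrow> norm u \<le> \<phi> (composite x) \<longrightarrow> (composite has_derivative D) (at x) \<longrightarrow>
    D (F x u) \<le> - c"
  have "\<exists>\<alpha>. posdef \<alpha> \<and> (\<forall>s>0. ?P s (\<alpha> s)) \<and> (\<forall>s\<ge>0. \<alpha> s \<le> s)"
  proof (rule ex_posdef_satisfying)
    show "?P s d" if "?P s c" "d \<le> c" for s c d
    proof (intro allI impI)
      fix x :: 'a and u :: 'b
        and D assume "norm x = s" "norm u \<le> \<phi> (composite x)" "(composite has_derivative D) (at x)"
      then have "D (F x u) \<le> - c" using that(1) by blast
      then show "D (F x u) \<le> - d" using that(2) by simp
    qed
    fix p q :: real assume p: "0 < p"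
    obtain a b where "0 < a" and ab: "\<And>x. norm x \<in> {p..q} \<Longrightarrow> composite x \<in> {a..b}"
      using proper_posdef_value_bounds[OF proper_posdef_composite p, of q] by auto
    obtain c where "0 < c" and decrease: "\<And>x u D. composite x \<in> {a..b} \<Longrightarrow> norm u \<le> \<phi> (composite x) \<Longrightarrow>
        (composite has_derivative D) (at x) \<Longrightarrow> D (F x u) \<le> - c"
      using composite_uniform_decrease[OF \<open>0 < a\<close>, of b] by blast
    have "?P s c" if "s \<in> {p..q}" for s
    proof (intro allI impI)
      fix x :: 'a and u :: 'b
        and D assume x: "norm x = s" "norm u \<le> \<phi> (composite x)" "(composite has_derivative D) (at x)"
      then have "composite x \<in> {a..b}" using that by (intro ab) simp
      then show "D (F x u) \<le> - c" using x(2,3) by (rule decrease)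
    qed
    then show "\<exists>c>0. \<forall>s\<in>{p..q}. ?P s c" using \<open>0 < c\<close> by blast
  qed
  then obtain \<alpha> where \<alpha>: "posdef \<alpha>" "\<And>s. 0 < s \<Longrightarrow> ?P s (\<alpha> s)" by blast
  have "D (F x u) \<le> - \<alpha> (norm x)"
    if "norm u \<le> \<phi> (composite x)" "(composite has_derivative D) (at x)" for x u D
    using that \<alpha>(2)[of "norm x"] composite_derivative_at_0_le[of D]
      by (cases "x = 0") (auto simp: posdef_0[OF \<alpha>(1)])
  then show ?thesis using \<alpha>(1) by blast
qed

theorem ISS_lyapunov_composite: "ISS_lyapunov F composite"
proof -
  obtain \<alpha> where \<alpha>: "posdef \<alpha>" and decrease: "\<And>x u D. norm u \<le> \<phi> (composite x) \<Longrightarrow>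
      (composite has_derivative D) (at x) \<Longrightarrow> D (F x u) \<le> - \<alpha> (norm x)"
    using ex_decrease_rate by blast
  have "D (F x u) \<le> - \<alpha> (norm x)"
    if D: "(composite has_derivative D) (at x)" and u: "sinv \<phi> (norm u) \<le> composite x" for x u D
    using u by (intro decrease D) (simp add: sinv_le_iff[OF \<phi>] composite_nonneg)
  moreover have "classK (sinv \<phi>)" by (rule classKinfD[OF classKinf_sinv[OF \<phi>]])
  moreover have "continuous_on UNIV composite"
    using isCont_composite by (simp add: continuous_on_eq_continuous_at)
  ultimately show ?thesis
    unfolding ISS_lyapunov_def using proper_posdef_composite loc_lipschitz_on_composite \<alpha> by blast
qed

end

theorem theorem6:
  fixes n :: nat and Isum :: "nat set"
    and B :: "nat \<Rightarrow> 'a::euclidean_space set" and C :: "nat \<Rightarrow> 'b::euclidean_space set"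
    and f :: "nat \<Rightarrow> 'a \<Rightarrow> 'b \<Rightarrow> 'a"
    and V :: "nat \<Rightarrow> 'a \<Rightarrow> real"
    and \<gamma> :: "nat \<Rightarrow> nat \<Rightarrow> real \<Rightarrow> real" and \<gamma>u :: "nat \<Rightarrow> real \<Rightarrow> real"
    and \<alpha>i :: "nat \<Rightarrow> real \<Rightarrow> real"
  assumes Isum: "Isum \<subseteq> {..<n}"
    and Bpart: "block_partition n B" and Cpart: "block_partition n C"
    and f_range: "\<forall>i<n. \<forall>x. \<forall>v\<in>span (C i). f i x v \<in> span (B i)"
    and f_cont: "\<forall>i<n. continuous_on (UNIV \<times> span (C i)) (\<lambda>(x, v). f i x v)"
    and f_lip: "\<forall>i<n. \<forall>r. \<forall>x. \<exists>\<delta>>0. \<exists>L. \<forall>v\<in>span (C i). norm v \<le> r \<longrightarrow>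
                   L-lipschitz_on (cball x \<delta>) (\<lambda>y. f i y v)"
    and lyap: "\<forall>i<n. sub_ISS_lyapunov n Isum B C f V \<gamma> \<gamma>u \<alpha>i i"
    and small_gain: "\<exists>\<alpha>. classKinf \<alpha> \<and>
       (\<forall>s. (\<forall>i<n. 0 \<le> s i) \<and> (\<exists>i<n. s i \<noteq> 0) \<longrightarrow>
            (\<exists>i<n. Gam n Isum \<gamma> (Dalpha Isum \<alpha> s) i < s i))"
  shows "ISS (\<lambda>x u. \<Sum>i<n. f i x (proj (C i) u)) \<and>
    (\<exists>\<sigma> \<phi>. omega_path n Isum \<gamma> \<sigma> \<and> classKinf \<phi> \<and>
       (\<forall>r>0. \<forall>i<n. Gambar n Isum \<gamma> \<gamma>u (\<lambda>j. \<sigma> j r) (\<phi> r) i < \<sigma> i r) \<and>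
       ISS_lyapunov (\<lambda>x u. \<Sum>i<n. f i x (proj (C i) u))
         (\<lambda>x. Max ((\<lambda>i. sinv (\<sigma> i) (V i (proj (B i) x))) ` {..<n})))"
proof -
  interpret interconnection n Isum B C f V \<gamma> \<gamma>u \<alpha>i
    by unfold_locales (rule Bpart Cpart f_range f_cont f_lip lyap)+
  obtain \<alpha> where "small_gain n Isum \<gamma> \<alpha>"
    using small_gain gain_operator_axioms unfolding small_gain_def small_gain_axioms_def by blast
  then obtain \<sigma> \<phi> where \<sigma>: "\<And>i. i < n \<Longrightarrow> classKinf (\<sigma> i)" "\<And>i. i < n \<Longrightarrow> loc_bilip (\<sigma> i)"
    and \<phi>: "classKinf \<phi>"
    and path: "\<And>r i. 0 < r \<Longrightarrow> i < n \<Longrightarrow> Gambar n Isum \<gamma> \<gamma>u (\<lambda>j. \<sigma> j r) (\<phi> r) i < \<sigma> i r"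
    using small_gain.ex_path_with_inputs[where \<gamma>u=\<gamma>u, OF _ \<gamma>u] by blast
  interpret path: interconnection_path n Isum B C f V \<gamma> \<gamma>u \<alpha>i \<sigma> \<phi>
    by unfold_locales (fact \<sigma> \<phi> path)+
  have Gam_less: "Gam n Isum \<gamma> (\<lambda>j. \<sigma> j r) i < \<sigma> i r" if "0 < r" "i < n" for r i
    using Gam_le_G[OF classK_nonneg[OF \<gamma>u[OF that(2)] classK_nonneg[OF classKinfD[OF \<phi>] less_imp_le[OF that(1)]]]]
      path[OF that] unfolding Gambar_eq_G[of \<gamma>u] by (rule le_less_trans)
  have "omega_path n Isum \<gamma> \<sigma>" using \<sigma> Gam_less by (rule omega_pathI)
  moreover have "ISS F"
    by (rule ISS_lyapunov_imp_ISS[OF continuous_on_F uniform_lipschitz_F path.ISS_lyapunov_composite])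
  ultimately show ?thesis
    using \<phi> path path.ISS_lyapunov_composite
    unfolding F_def[abs_def] path.composite_def[abs_def] path.rescaled_def component_def by blast
qed

end
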